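(* Let $k$ be a field, $R=k[x_1,\dots,x_d]$ a polynomial ring with the standard grading, and $\mathfrak m=(x_1,\dots,x_d)$. Let $I$ be a monomial ideal of $R$ and let $i\geq 0$ be an integer such that $H^i_{\mathfrak m}(R/I^n)$ is Noetherian for $n\gg 0$. Then: (1) if $\tilde H_{i-1}(\Delta(I),k)\neq 0$, then $\operatorname{indeg} H^i_{\mathfrak m}(R/I^n)=0$ for $n\gg 0$; (2) if $\tilde H_{i-1}(\Delta(I),k)=0$, then $\displaystyle\liminf_{n\to\infty}\frac{\operatorname{indeg} H^i_{\mathfrak m}(R/I^n)}{n}\geq 1$.
   Context: $H^i_{\mathfrak m}(-)$ denotes (graded) local cohomology with support in $\mathfrak m$. For a graded module $M=\bigoplus_{j\in\mathbb Z}M_j$, $\operatorname{indeg} M=\min\{j\mid M_j\neq 0\}$, with $\operatorname{indeg} 0=\infty$. $\Delta(I)$ is the simplicial complex on $\{1,\dots,d\}$ whose Stanley-Reisner ideal is $\sqrt I$, i.e. $F\subseteq\{1,\dots,d\}$ is a face if and only if $\prod_{j\in F}x_j\notin\sqrt I$. $\tilde H_{j}(\Delta,k)$ denotes reduced simplicial homology with coefficients in $k$. *)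

theory Defs
  imports
    "HOL-Algebra.Module"
    "HOL-Algebra.Ideal_Product"
    "HOL-Library.Poly_Mapping"
    "HOL-Library.Extended_Real"
    "HOL-Library.Liminf_Limsup"
begin

section \<open>Modules over a commutative ring\<close>

text \<open>In module records the fields \<^const>\<open>mult\<close> and \<^const>\<open>one\<close> carry no meaning
  and are left undefined.\<close>

definition module_quotient ::
    "('a, 'm, 'c) module_scheme \<Rightarrow> 'm set \<Rightarrow> ('a, 'm set) module" where
  "module_quotient M N =
     \<lparr>carrier = a_rcosets\<^bsub>M\<^esub> N, mult = undefined, one = undefined,
      zero = N, add = set_add M,
      smult = (\<lambda>a X. \<Union>x\<in>X. N +>\<^bsub>M\<^esub> (a \<odot>\<^bsub>M\<^esub> x))\<rparr>"

definition noetherian_module :: "('a, 'b) ring_scheme \<Rightarrow> ('a, 'm, 'c) module_scheme \<Rightarrow> bool" where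
  "noetherian_module R M \<longleftrightarrow>
     (\<forall>N. submodule N R M \<longrightarrow>
        (\<exists>A \<subseteq> carrier M. finite A \<and> N = \<Inter>{K. submodule K R M \<and> A \<subseteq> K}))"

record ('a, 'm) graded_module = "('a, 'm) module" +
  grade :: "int \<Rightarrow> 'm set"

definition graded_quotient ::
    "('a, 'm) graded_module \<Rightarrow> 'm set \<Rightarrow> ('a, 'm set) graded_module" where
  "graded_quotient M N =
     module.extend (module_quotient M N)
       (graded_module.fields (\<lambda>j. (\<lambda>x. N +>\<^bsub>M\<^esub> x) ` grade M j))"

text \<open>The infimum is taken in the extended reals: it is \<open>\<infinity>\<close> for the zero module, it is the
  minimum whenever the degrees are bounded below, and \<open>-\<infinity>\<close> otherwise.\<close>

definition indeg :: "('a, 'm) graded_module \<Rightarrow> ereal" where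
  "indeg M = (INF j \<in> {j. grade M j \<noteq> {\<zero>\<^bsub>M\<^esub>}}. ereal (real_of_int j))"


subsection \<open>Localization at the powers of one element\<close>

text \<open>The pair \<open>(m, s)\<close> stands for the fraction \<open>m / f^s\<close>.\<close>

definition frac_rel ::
    "('a, 'b) ring_scheme \<Rightarrow> ('a, 'm, 'c) module_scheme \<Rightarrow> 'a \<Rightarrow> (('m \<times> nat) \<times> ('m \<times> nat)) set" where
  "frac_rel R M f =
     {((m, s), (m', s')). m \<in> carrier M \<and> m' \<in> carrier M \<and>
        (\<exists>t::nat. (f [^]\<^bsub>R\<^esub> (t + s')) \<odot>\<^bsub>M\<^esub> m = (f [^]\<^bsub>R\<^esub> (t + s)) \<odot>\<^bsub>M\<^esub> m')}"

definition loc_frac ::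
    "('a, 'b) ring_scheme \<Rightarrow> ('a, 'm, 'c) module_scheme \<Rightarrow> 'a \<Rightarrow> 'm \<Rightarrow> nat \<Rightarrow> ('m \<times> nat) set" where
  "loc_frac R M f m s = frac_rel R M f `` {(m, s)}"

text \<open>The localization \<open>M_f\<close>, where \<open>f\<close> is homogeneous of degree \<open>e\<close>. Operations on classes are
  written as unions over all representatives, all of which give the same class.\<close>

definition localization ::
    "('a, 'b) ring_scheme \<Rightarrow> ('a, 'm) graded_module \<Rightarrow> 'a \<Rightarrow> nat \<Rightarrow>
       ('a, ('m \<times> nat) set) graded_module" where
  "localization R M f e =
     \<lparr>carrier = {loc_frac R M f m s | m s. m \<in> carrier M},
      mult = undefined, one = undefined,
      zero = loc_frac R M f \<zero>\<^bsub>M\<^esub> 0,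
      add = (\<lambda>X Y. \<Union>(m, s)\<in>X. \<Union>(m', s')\<in>Y.
               loc_frac R M f (((f [^]\<^bsub>R\<^esub> s') \<odot>\<^bsub>M\<^esub> m) \<oplus>\<^bsub>M\<^esub> ((f [^]\<^bsub>R\<^esub> s) \<odot>\<^bsub>M\<^esub> m')) (s + s')),
      smult = (\<lambda>a X. \<Union>(m, s)\<in>X. loc_frac R M f (a \<odot>\<^bsub>M\<^esub> m) s),
      grade = (\<lambda>j. {loc_frac R M f m s | m s. m \<in> grade M (j + int s * int e)})\<rparr>"

text \<open>The natural map \<open>M_f \<rightarrow> M_(fg)\<close>, sending \<open>m / f^s\<close> to \<open>g^s m / (fg)^s\<close>.\<close>

definition loc_map ::
    "('a, 'b) ring_scheme \<Rightarrow> ('a, 'm, 'c) module_scheme \<Rightarrow> 'a \<Rightarrow> 'a \<Rightarrow>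
       ('m \<times> nat) set \<Rightarrow> ('m \<times> nat) set" where
  "loc_map R M f g X =
     (\<Union>(m, s)\<in>X. loc_frac R M (f \<otimes>\<^bsub>R\<^esub> g) ((g [^]\<^bsub>R\<^esub> s) \<odot>\<^bsub>M\<^esub> m) s)"


section \<open>The polynomial ring in \<open>d\<close> variables and its monomial ideals\<close>

type_synonym 'k mpoly = "(nat \<Rightarrow>\<^sub>0 nat) \<Rightarrow>\<^sub>0 'k"

definition poly_ring :: "nat \<Rightarrow> 'k::field mpoly ring" where
  "poly_ring d =
     \<lparr>carrier = {p. \<forall>m \<in> Poly_Mapping.keys p. Poly_Mapping.keys m \<subseteq> {1..d}},
      mult = (*), one = 1, zero = 0, add = (+)\<rparr>"

definition monom :: "(nat \<Rightarrow>\<^sub>0 nat) \<Rightarrow> 'k::field mpoly" where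
  "monom m = Poly_Mapping.single m 1"

definition var :: "nat \<Rightarrow> 'k::field mpoly" where
  "var j = monom (Poly_Mapping.single j 1)"

definition var_prod :: "nat set \<Rightarrow> 'k::field mpoly" where
  "var_prod F = (\<Prod>j\<in>F. var j)"

definition total_degree :: "(nat \<Rightarrow>\<^sub>0 nat) \<Rightarrow> nat" where
  "total_degree m = (\<Sum>j \<in> Poly_Mapping.keys m. Poly_Mapping.lookup m j)"

definition poly_graded_module :: "nat \<Rightarrow> ('k::field mpoly, 'k mpoly) graded_module" where
  "poly_graded_module d =
     \<lparr>carrier = carrier (poly_ring d), mult = undefined, one = undefined,
      zero = 0, add = (+), smult = (*),
      grade = (\<lambda>j. {p \<in> carrier (poly_ring d).
                     \<forall>m \<in> Poly_Mapping.keys p. int (total_degree m) = j})\<rparr>"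

definition monomial_ideal :: "nat \<Rightarrow> 'k::field mpoly set \<Rightarrow> bool" where
  "monomial_ideal d I \<longleftrightarrow>
     (\<exists>A \<subseteq> {m. Poly_Mapping.keys m \<subseteq> {1..d}}. I = genideal (poly_ring d) (monom ` A))"

definition ideal_power :: "('a, 'b) ring_scheme \<Rightarrow> 'a set \<Rightarrow> nat \<Rightarrow> 'a set" where
  "ideal_power R I n = I [^]\<^bsub>ideals_set R\<^esub> n"

definition ideal_radical :: "('a, 'b) ring_scheme \<Rightarrow> 'a set \<Rightarrow> 'a set" where
  "ideal_radical R I = {a \<in> carrier R. \<exists>n::nat. a [^]\<^bsub>R\<^esub> n \<in> I}"


section \<open>Local cohomology with support in \<open>(x_1, \<dots>, x_d)\<close>\<close>

text \<open>Graded local cohomology of a graded module \<open>M\<close> is the cohomology of the Cech complex of \<open>M\<close>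
  with respect to the generators \<open>x_1, \<dots>, x_d\<close> of the maximal ideal: the \<open>p\<close>-th term is the direct
  sum of the \<open>M_(x_F)\<close> over the \<open>p\<close>-element subsets \<open>F\<close> of \<open>{1..d}\<close>, with \<open>x_F = \<Prod>j\<in>F. x_j\<close> of
  degree \<open>card F\<close>.\<close>

definition cech_index :: "nat \<Rightarrow> nat \<Rightarrow> nat set set" where
  "cech_index d p = {F. F \<subseteq> {1..d} \<and> card F = p}"

definition position_sign :: "nat \<Rightarrow> nat set \<Rightarrow> 'r::ring_1" where
  "position_sign j F = (- 1) ^ card {l \<in> F. l < j}"

definition cech_loc ::
    "nat \<Rightarrow> ('k::field mpoly, 'm) graded_module \<Rightarrow> nat set \<Rightarrow>
       ('k mpoly, ('m \<times> nat) set) graded_module" where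
  "cech_loc d M F = localization (poly_ring d) M (var_prod F) (card F)"

definition cech_module ::
    "nat \<Rightarrow> ('k::field mpoly, 'm) graded_module \<Rightarrow> nat \<Rightarrow>
       ('k mpoly, nat set \<Rightarrow> ('m \<times> nat) set) graded_module" where
  "cech_module d M p =
     \<lparr>carrier = (\<Pi>\<^sub>E F \<in> cech_index d p. carrier (cech_loc d M F)),
      mult = undefined, one = undefined,
      zero = (\<lambda>F \<in> cech_index d p. \<zero>\<^bsub>cech_loc d M F\<^esub>),
      add = (\<lambda>c c'. \<lambda>F \<in> cech_index d p. c F \<oplus>\<^bsub>cech_loc d M F\<^esub> c' F),
      smult = (\<lambda>a c. \<lambda>F \<in> cech_index d p. a \<odot>\<^bsub>cech_loc d M F\<^esub> c F),
      grade = (\<lambda>j. \<Pi>\<^sub>E F \<in> cech_index d p. grade (cech_loc d M F) j)\<rparr>"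

definition cech_diff ::
    "nat \<Rightarrow> ('k::field mpoly, 'm) graded_module \<Rightarrow> nat \<Rightarrow>
       (nat set \<Rightarrow> ('m \<times> nat) set) \<Rightarrow> (nat set \<Rightarrow> ('m \<times> nat) set)" where
  "cech_diff d M p c =
     (\<lambda>F \<in> cech_index d (Suc p).
        \<Oplus>\<^bsub>cech_loc d M F\<^esub> j \<in> F.
          position_sign j F \<odot>\<^bsub>cech_loc d M F\<^esub>
            loc_map (poly_ring d) M (var_prod (F - {j})) (var j) (c (F - {j})))"

definition cech_cocycles ::
    "nat \<Rightarrow> ('k::field mpoly, 'm) graded_module \<Rightarrow> nat \<Rightarrow> (nat set \<Rightarrow> ('m \<times> nat) set) set" where
  "cech_cocycles d M p =
     {c \<in> carrier (cech_module d M p). cech_diff d M p c = \<zero>\<^bsub>cech_module d M (Suc p)\<^esub>}"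

definition cech_coboundaries ::
    "nat \<Rightarrow> ('k::field mpoly, 'm) graded_module \<Rightarrow> nat \<Rightarrow> (nat set \<Rightarrow> ('m \<times> nat) set) set" where
  "cech_coboundaries d M p =
     (case p of 0 \<Rightarrow> {\<zero>\<^bsub>cech_module d M 0\<^esub>}
              | Suc q \<Rightarrow> cech_diff d M q ` carrier (cech_module d M q))"

definition local_cohomology ::
    "nat \<Rightarrow> nat \<Rightarrow> ('k::field mpoly, 'm) graded_module \<Rightarrow>
       ('k mpoly, (nat set \<Rightarrow> ('m \<times> nat) set) set) graded_module" where
  "local_cohomology d i M =
     graded_quotient
       ((cech_module d M i)
          \<lparr>carrier := cech_cocycles d M i,
           grade := (\<lambda>j. cech_cocycles d M i \<inter> grade (cech_module d M i) j)\<rparr>)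
       (cech_coboundaries d M i)"


section \<open>Reduced simplicial homology\<close>

text \<open>For \<open>I\<close> the unit ideal this is the void complex, which does not even contain the empty face.\<close>

definition stanley_reisner_complex :: "nat \<Rightarrow> 'k::field mpoly set \<Rightarrow> nat set set" where
  "stanley_reisner_complex d I =
     {F. F \<subseteq> {1..d} \<and> var_prod F \<notin> ideal_radical (poly_ring d) I}"

text \<open>Chains are finitely supported functions on faces; the empty face spans the chains of
  dimension \<open>-1\<close>.\<close>

definition chains :: "nat set set \<Rightarrow> int \<Rightarrow> (nat set \<Rightarrow>\<^sub>0 'k::field) set" where
  "chains \<Delta> q =
     {c. Poly_Mapping.keys c \<subseteq> {F \<in> \<Delta>. finite F \<and> int (card F) = q + 1}}"

definition boundary :: "(nat set \<Rightarrow>\<^sub>0 'k::field) \<Rightarrow> (nat set \<Rightarrow>\<^sub>0 'k)" where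
  "boundary c =
     (\<Sum>F \<in> Poly_Mapping.keys c. \<Sum>j\<in>F.
        Poly_Mapping.single (F - {j}) (position_sign j F * Poly_Mapping.lookup c F))"

definition cycles_module :: "nat set set \<Rightarrow> int \<Rightarrow> ('k::field, nat set \<Rightarrow>\<^sub>0 'k) module" where
  "cycles_module \<Delta> q =
     \<lparr>carrier = {c \<in> chains \<Delta> q. boundary c = 0}, mult = undefined, one = undefined,
      zero = 0, add = (+), smult = (\<lambda>a. Poly_Mapping.map ((*) a))\<rparr>"

definition reduced_homology ::
    "nat set set \<Rightarrow> int \<Rightarrow> ('k::field, (nat set \<Rightarrow>\<^sub>0 'k) set) module" where
  "reduced_homology \<Delta> q = module_quotient (cycles_module \<Delta> q) (boundary ` chains \<Delta> (q + 1))"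

definition zero_module :: "('a, 'm, 'c) module_scheme \<Rightarrow> bool" where
  "zero_module M \<longleftrightarrow> carrier M = {\<zero>\<^bsub>M\<^esub>}"

end

theory Submission
  imports Defs
begin

text \<open>The polynomial ring is graded by integer vectors \<open>a\<close>, and so is the Cech complex of
  \<open>R/J\<close> for a monomial ideal \<open>J\<close>. The localization of \<open>R/J\<close> at \<open>x_F\<close> is zero or one-dimensional
  in each multidegree: it is spanned by \<open>x^a\<close> if the negative coordinates of \<open>a\<close> lie in \<open>F\<close> and
  \<open>x^a\<close> is not in the extension of \<open>J\<close>. With \<open>D_a\<close> the family of these \<open>F\<close> (the set
  \<open>degree_complex a\<close>), the part of the Cech complex in multidegree \<open>a\<close> is the complex of simplicial
  cochains on \<open>D_a\<close> (\<open>strand_cech_diff\<close>), so the local cohomology in multidegree \<open>a\<close> vanishes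
  exactly if \<open>D_a\<close> is acyclic at \<open>i\<close>. This is the idea behind Takayama's formula.

  Two observations finish the proof. If \<open>a\<close> has a negative coordinate, then \<open>D_a\<close> does not
  depend on the value of that coordinate; a cohomology class in multidegree \<open>a\<close> would therefore
  recur in multidegrees unbounded below, which a finitely generated module over the polynomial ring
  does not allow (\<open>noetherian_imp_acyclic\<close>). If \<open>a\<close> is nonnegative of total degree less than \<open>n\<close>
  and \<open>J = I^n\<close>, then \<open>D_a\<close> is the Stanley-Reisner complex of \<open>I\<close>: inverting \<open>x_F\<close> turns \<open>I\<close>
  into the unit ideal if \<open>F\<close> is not a face, and otherwise into a proper monomial ideal, whose
  \<open>n\<close>-th power has no monomials of degree less than \<open>n\<close> in the remaining variables
  (\<open>degree_complex_power\<close>).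

  So the cohomology vanishes in negative degrees, and in the degrees from \<open>0\<close> to \<open>n - 1\<close> it is
  governed by the simplicial cohomology of the Stanley-Reisner complex. Over a field this vanishes
  together with the homology (\<open>acyclic_iff_chains_exact\<close>). If it is nonzero, the multidegree \<open>0\<close>
  contributes and the initial degree is \<open>0\<close>; otherwise the initial degree is at least \<open>n\<close>.\<close>

section \<open>Exactness over a field is self-dual\<close>

text \<open>Induction on the rows. If the new row does not vanish on the common kernel of the other rows,
  then subtracting a multiple of it from \<open>u\<close> makes \<open>u\<close> vanish on that whole kernel.\<close>

lemma functional_in_row_span:
  fixes r :: "'x \<Rightarrow> 'y \<Rightarrow> 'k::field" and u :: "'y \<Rightarrow> 'k"
  assumes "finite X" "finite Y"
    and "\<And>v. (\<forall>x\<in>X. (\<Sum>y\<in>Y. r x y * v y) = 0) \<Longrightarrow> (\<Sum>y\<in>Y. u y * v y) = 0"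
  shows "\<exists>w. \<forall>y\<in>Y. u y = (\<Sum>x\<in>X. w x * r x y)"
  using assms(1,3)
proof (induction X arbitrary: u rule: finite_induct)
  case empty
  have "u y = 0" if "y \<in> Y" for y
    using empty[of "\<lambda>z. if z = y then 1 else 0"] that \<open>finite Y\<close>
    by (simp add: if_distrib[of "times _"] cong: if_cong)
  then show ?case by simp
next
  case (insert x X)
  define K where "K = {v. \<forall>x\<in>X. (\<Sum>y\<in>Y. r x y * v y) = 0}"
  show ?case
  proof (cases "\<forall>v\<in>K. (\<Sum>y\<in>Y. r x y * v y) = 0")
    case True
    have "\<exists>w. \<forall>y\<in>Y. u y = (\<Sum>x\<in>X. w x * r x y)"
      by (rule insert.IH, rule insert.prems) (use True in \<open>auto simp: K_def\<close>)
    then obtain w where w: "\<forall>y\<in>Y. u y = (\<Sum>x\<in>X. w x * r x y)" ..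
    have "u y = (\<Sum>z\<in>insert x X. (w(x := 0)) z * r z y)" if "y \<in> Y" for y
      using w that insert.hyps by (auto intro!: sum.cong)
    then show ?thesis by blast
  next
    case False
    then obtain v1 where v1: "v1 \<in> K" "(\<Sum>y\<in>Y. r x y * v1 y) \<noteq> 0" by blast
    define e where "e = (\<Sum>y\<in>Y. r x y * v1 y)"
    define v0 where "v0 = (\<lambda>y. v1 y / e)"
    have v0K: "(\<Sum>y\<in>Y. r z y * v0 y) = 0" if "z \<in> X" for z
      using v1(1) that by (simp add: K_def v0_def sum_divide_distrib[symmetric])
    have v0x: "(\<Sum>y\<in>Y. r x y * v0 y) = 1"
      using v1(2) by (simp add: v0_def e_def sum_divide_distrib[symmetric])
    \<comment> \<open>On the common kernel of \<open>X\<close>, the functional \<open>u\<close> is now \<open>c\<close> times row \<open>x\<close>, since \<open>v0\<close>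
      spans that kernel modulo the kernel of row \<open>x\<close>.\<close>
    define c where "c = (\<Sum>y\<in>Y. u y * v0 y)"
    define u' where "u' = (\<lambda>y. u y - c * r x y)"
    have "\<exists>w. \<forall>y\<in>Y. u' y = (\<Sum>x\<in>X. w x * r x y)"
    proof (rule insert.IH)
      fix v assume v: "\<forall>x\<in>X. (\<Sum>y\<in>Y. r x y * v y) = 0"
      define b where "b = (\<Sum>y\<in>Y. r x y * v y)"
      have eq: "(\<Sum>y\<in>Y. f y * (v y - b * v0 y)) =
                 (\<Sum>y\<in>Y. f y * v y) - b * (\<Sum>y\<in>Y. f y * v0 y)" for f :: "'y \<Rightarrow> 'k"
        by (simp add: sum_subtractf sum_distrib_left algebra_simps)
      have "(\<Sum>y\<in>Y. u y * (v y - b * v0 y)) = 0"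
        by (rule insert.prems) (use v v0K v0x in \<open>auto simp: eq simp flip: b_def\<close>)
      then have "(\<Sum>y\<in>Y. u y * v y) = b * c" by (simp add: eq c_def)
      moreover have "(\<Sum>y\<in>Y. u' y * v y) = (\<Sum>y\<in>Y. u y * v y) - c * b"
        unfolding u'_def b_def sum_distrib_left
        by (simp add: left_diff_distrib sum_subtractf mult.assoc)
      ultimately show "(\<Sum>y\<in>Y. u' y * v y) = 0" by simp
    qed
    then obtain w where w: "\<forall>y\<in>Y. u' y = (\<Sum>x\<in>X. w x * r x y)" ..
    have "u y = (\<Sum>z\<in>insert x X. (w(x := c)) z * r z y)" if "y \<in> Y" for y
    proof -
      have "(\<Sum>z\<in>X. (w(x := c)) z * r z y) = u' y"
        using w that insert.hyps by (auto intro!: sum.cong)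
      then show ?thesis using insert.hyps by (simp add: u'_def)
    qed
    then show ?thesis by blast
  qed
qed

text \<open>A functional that annihilates the image of \<open>P\<close> annihilates the kernel of \<open>Q\<close>, and hence
  factors through \<open>Q\<close>.\<close>

lemma exact_imp_transpose_exact:
  fixes P :: "'a \<Rightarrow> 'b \<Rightarrow> 'k::field" and Q :: "'c \<Rightarrow> 'b \<Rightarrow> 'k"
  assumes "finite B" "finite C"
    and exact: "\<And>v. \<forall>c\<in>C. (\<Sum>b\<in>B. Q c b * v b) = 0 \<Longrightarrow> \<exists>w. \<forall>b\<in>B. v b = (\<Sum>a\<in>A. w a * P a b)"
    and u: "\<forall>a\<in>A. (\<Sum>b\<in>B. P a b * u b) = 0"
  shows "\<exists>w. \<forall>b\<in>B. u b = (\<Sum>c\<in>C. w c * Q c b)"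
proof (rule functional_in_row_span[OF assms(2,1)])
  fix v assume "\<forall>c\<in>C. (\<Sum>b\<in>B. Q c b * v b) = 0"
  then obtain w where w: "\<forall>b\<in>B. v b = (\<Sum>a\<in>A. w a * P a b)" using exact by blast
  have "(\<Sum>b\<in>B. u b * v b) = (\<Sum>b\<in>B. \<Sum>a\<in>A. w a * (P a b * u b))"
    using w by (auto intro!: sum.cong simp: sum_distrib_left algebra_simps)
  also have "\<dots> = (\<Sum>a\<in>A. w a * (\<Sum>b\<in>B. P a b * u b))"
    by (subst sum.swap) (simp add: sum_distrib_left)
  also have "\<dots> = 0" using u by simp
  finally show "(\<Sum>b\<in>B. u b * v b) = 0" .
qed


section \<open>Simplicial cochains\<close>

text \<open>The family \<open>D\<close> need not be closed under subsets. For a function \<open>u\<close> supported in \<open>D\<close> the terms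
  with \<open>F - {j}\<close> outside \<open>D\<close> vanish, as in a relative cochain complex.\<close>

definition codiff :: "nat set set \<Rightarrow> (nat set \<Rightarrow> 'k::field) \<Rightarrow> nat set \<Rightarrow> 'k" where
  "codiff D u F = (if F \<in> D then \<Sum>j\<in>F. position_sign j F * u (F - {j}) else 0)"

text \<open>Asking for \<open>Suc (card F) = i\<close> rather than \<open>card F = i - 1\<close> leaves only \<open>w = 0\<close> when \<open>i = 0\<close>.\<close>

definition is_coboundary :: "nat set set \<Rightarrow> nat \<Rightarrow> (nat set \<Rightarrow> 'k::field) \<Rightarrow> bool" where
  "is_coboundary D i u \<longleftrightarrow>
     (\<exists>w. (\<forall>F. w F \<noteq> 0 \<longrightarrow> F \<in> D \<and> Suc (card F) = i) \<and> codiff D w = u)"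

definition acyclic_at :: "'k::field itself \<Rightarrow> nat set set \<Rightarrow> nat \<Rightarrow> bool" where
  "acyclic_at K D i \<longleftrightarrow>
     (\<forall>u :: nat set \<Rightarrow> 'k. (\<forall>F. u F \<noteq> 0 \<longrightarrow> F \<in> D \<and> card F = i) \<and> codiff D u = (\<lambda>_. 0) \<longrightarrow>
        is_coboundary D i u)"

lemma codiff_add: "codiff D (\<lambda>F. u F + v F) = (\<lambda>F. codiff D u F + codiff D v F)"
  by (rule ext) (simp add: codiff_def distrib_left sum.distrib)

lemma codiff_uminus: "codiff D (\<lambda>F. - u F) = (\<lambda>F. - codiff D u F)"
  by (rule ext) (simp add: codiff_def sum_negf)

lemma is_coboundary_zero: "is_coboundary D i (\<lambda>_. 0)"
  unfolding is_coboundary_def by (rule exI[of _ "\<lambda>_. 0"]) (simp add: codiff_def fun_eq_iff)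

lemma is_coboundary_add:
  assumes "is_coboundary D i u" "is_coboundary D i v"
  shows "is_coboundary D i (\<lambda>F. u F + v F)"
proof -
  obtain w w' where "\<forall>F. w F \<noteq> 0 \<longrightarrow> F \<in> D \<and> Suc (card F) = i" "codiff D w = u"
    "\<forall>F. w' F \<noteq> 0 \<longrightarrow> F \<in> D \<and> Suc (card F) = i" "codiff D w' = v"
    using assms unfolding is_coboundary_def by blast
  then show ?thesis unfolding is_coboundary_def
    by (intro exI[of _ "\<lambda>F. w F + w' F"]) (auto simp: codiff_add, (metis add_0)+)
qed

lemma is_coboundary_uminus:
  assumes "is_coboundary D i u" shows "is_coboundary D i (\<lambda>F. - u F)"
proof -
  obtain w where "\<forall>F. w F \<noteq> 0 \<longrightarrow> F \<in> D \<and> Suc (card F) = i" "codiff D w = u"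
    using assms unfolding is_coboundary_def by blast
  then show ?thesis unfolding is_coboundary_def
    by (intro exI[of _ "\<lambda>F. - w F"]) (simp add: codiff_uminus)
qed

text \<open>The coefficient of \<open>G\<close> in the boundary of \<open>F\<close>.\<close>

definition incidence :: "nat set \<Rightarrow> nat set \<Rightarrow> 'k::field" where
  "incidence F G = (\<Sum>j\<in>F. if F - {j} = G then position_sign j F else 0)"

lemma incidence_zero: "finite F \<Longrightarrow> card F \<noteq> Suc (card G) \<Longrightarrow> incidence F G = 0"
  unfolding incidence_def by (rule sum.neutral) (auto dest!: card_Suc_Diff1)

lemma codiff_incidence:
  fixes u :: "nat set \<Rightarrow> 'k::field"
  assumes "finite B" and F: "F \<in> D" "finite F"
    and u: "\<And>j. j \<in> F \<Longrightarrow> u (F - {j}) \<noteq> 0 \<Longrightarrow> F - {j} \<in> B"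
  shows "codiff D u F = (\<Sum>G\<in>B. incidence F G * u G)"
proof -
  have "(\<Sum>G\<in>B. incidence F G * u G)
      = (\<Sum>j\<in>F. \<Sum>G\<in>B. (if F - {j} = G then position_sign j F else 0) * u G)"
    unfolding incidence_def by (subst sum.swap) (simp add: sum_distrib_right)
  also have "\<dots> = (\<Sum>j\<in>F. position_sign j F * u (F - {j}))"
  proof (rule sum.cong[OF refl])
    fix j assume j: "j \<in> F"
    have "(\<Sum>G\<in>B. (if F - {j} = G then position_sign j F else 0) * u G)
        = (\<Sum>G\<in>B. if F - {j} = G then position_sign j F * u (F - {j}) else 0)"
      by (rule sum.cong) auto
    also have "\<dots> = position_sign j F * u (F - {j})"
      using \<open>finite B\<close> u[OF j] by auto
    finally show "(\<Sum>G\<in>B. (if F - {j} = G then position_sign j F else 0) * u G)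
        = position_sign j F * u (F - {j})" .
  qed
  finally show ?thesis using F by (simp add: codiff_def)
qed

lemma lookup_boundary:
  fixes c :: "nat set \<Rightarrow>\<^sub>0 'k::field"
  assumes "finite A" "Poly_Mapping.keys c \<subseteq> A"
  shows "Poly_Mapping.lookup (boundary c) G = (\<Sum>F\<in>A. incidence F G * Poly_Mapping.lookup c F)"
proof -
  have "Poly_Mapping.lookup (boundary c) G
      = (\<Sum>F\<in>Poly_Mapping.keys c. incidence F G * Poly_Mapping.lookup c F)"
    by (auto simp: boundary_def lookup_sum incidence_def sum_distrib_right lookup_single when_def
             intro!: sum.cong)
  also have "\<dots> = (\<Sum>F\<in>A. incidence F G * Poly_Mapping.lookup c F)"
    using assms by (intro sum.mono_neutral_left) (auto simp: in_keys_iff)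
  finally show ?thesis .
qed

text \<open>The cochain complex of a simplicial complex is the transpose of its chain complex, so over a
  field both are exact in the same degrees.\<close>

lemma acyclic_iff_chains_exact:
  fixes \<Delta> :: "nat set set"
  assumes fin: "finite \<Delta>" "\<And>F. F \<in> \<Delta> \<Longrightarrow> finite F"
    and down: "\<And>F G. F \<in> \<Delta> \<Longrightarrow> G \<subseteq> F \<Longrightarrow> G \<in> \<Delta>"
  shows "acyclic_at TYPE('k::field) \<Delta> i \<longleftrightarrow>
     (\<forall>c \<in> chains \<Delta> (int i - 1). boundary c = 0 \<longrightarrow>
        (c :: nat set \<Rightarrow>\<^sub>0 'k) \<in> boundary ` chains \<Delta> (int i - 1 + 1))"
proof -
  define A where "A = {F\<in>\<Delta>. card F = Suc i}"
  define B where "B = {F\<in>\<Delta>. card F = i}"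
  define C where "C = {F\<in>\<Delta>. Suc (card F) = i}"
  have finABC: "finite A" "finite B" "finite C" using fin by (auto simp: A_def B_def C_def)
  have chB: "chains \<Delta> (int i - 1) = {c :: nat set \<Rightarrow>\<^sub>0 'k. Poly_Mapping.keys c \<subseteq> B}"
    using fin by (auto simp: chains_def B_def)
  have chA: "chains \<Delta> (int i - 1 + 1) = {c :: nat set \<Rightarrow>\<^sub>0 'k. Poly_Mapping.keys c \<subseteq> A}"
    using fin by (auto simp: chains_def A_def)
  have sub1: "F - {j} \<in> \<Delta> \<and> Suc (card (F - {j})) = card F" if "F \<in> \<Delta>" "j \<in> F" for F j
    using down[OF that(1), of "F - {j}"] card_Suc_Diff1[OF fin(2)[OF that(1)] that(2)] by blast
  have inc0: "(incidence F G :: 'k) = 0" if "F \<in> \<Delta>" "G \<notin> \<Delta>" for F G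
    unfolding incidence_def by (rule sum.neutral) (use sub1 that in auto)
  \<comment> \<open>The matrix of incidence numbers acts on chains from one side and on cochains from the other.\<close>
  define chain_exact where "chain_exact \<longleftrightarrow>
     (\<forall>v :: nat set \<Rightarrow> 'k. (\<forall>c\<in>C. (\<Sum>b\<in>B. incidence b c * v b) = 0) \<longrightarrow>
        (\<exists>w. \<forall>b\<in>B. v b = (\<Sum>a\<in>A. w a * incidence a b)))"
  define cochain_exact where "cochain_exact \<longleftrightarrow>
     (\<forall>u :: nat set \<Rightarrow> 'k. (\<forall>a\<in>A. (\<Sum>b\<in>B. incidence a b * u b) = 0) \<longrightarrow>
        (\<exists>w. \<forall>b\<in>B. u b = (\<Sum>c\<in>C. w c * incidence b c)))"
  have dual: "cochain_exact \<longleftrightarrow> chain_exact"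
  proof
    assume ex: chain_exact
    show cochain_exact unfolding cochain_exact_def
    proof (intro allI impI)
      fix u :: "nat set \<Rightarrow> 'k" assume "\<forall>a\<in>A. (\<Sum>b\<in>B. incidence a b * u b) = 0"
      then show "\<exists>w. \<forall>b\<in>B. u b = (\<Sum>c\<in>C. w c * incidence b c)"
        by (rule exact_imp_transpose_exact[OF finABC(2,3), rotated])
           (rule ex[unfolded chain_exact_def, rule_format], simp)
    qed
  next
    assume ex: cochain_exact
    show chain_exact unfolding chain_exact_def
    proof (intro allI impI)
      fix v :: "nat set \<Rightarrow> 'k" assume "\<forall>c\<in>C. (\<Sum>b\<in>B. incidence b c * v b) = 0"
      then show "\<exists>w. \<forall>b\<in>B. v b = (\<Sum>a\<in>A. w a * incidence a b)"
        by (rule exact_imp_transpose_exact[OF finABC(2,1), rotated])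
           (rule ex[unfolded cochain_exact_def, rule_format], simp)
    qed
  qed
  have chain: "chain_exact \<longleftrightarrow>
     (\<forall>c \<in> chains \<Delta> (int i - 1). boundary c = 0 \<longrightarrow>
        (c :: nat set \<Rightarrow>\<^sub>0 'k) \<in> boundary ` chains \<Delta> (int i - 1 + 1))" (is "_ \<longleftrightarrow> ?R")
  proof
    assume ex: chain_exact
    show ?R
    proof (intro ballI impI)
      fix c :: "nat set \<Rightarrow>\<^sub>0 'k" assume "c \<in> chains \<Delta> (int i - 1)" and 0: "boundary c = 0"
      then have c: "Poly_Mapping.keys c \<subseteq> B" by (simp add: chB)
      have "\<forall>G\<in>C. (\<Sum>b\<in>B. incidence b G * Poly_Mapping.lookup c b) = 0"
        using 0 lookup_boundary[OF finABC(2) c] by (metis lookup_zero)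
      then obtain w where w: "\<forall>b\<in>B. Poly_Mapping.lookup c b = (\<Sum>a\<in>A. w a * incidence a b)"
        using ex unfolding chain_exact_def by blast
      define e where "e = (\<Sum>a\<in>A. Poly_Mapping.single a (w a))"
      have le: "Poly_Mapping.lookup e a = (if a \<in> A then w a else 0)" for a
        using finABC(1) by (simp add: e_def lookup_sum lookup_single when_def)
      have eA: "Poly_Mapping.keys e \<subseteq> A" by (auto simp: in_keys_iff le split: if_splits)
      have "boundary e = c"
      proof (rule poly_mapping_eqI)
        fix G
        have *: "Poly_Mapping.lookup (boundary e) G = (\<Sum>a\<in>A. incidence a G * w a)"
          unfolding lookup_boundary[OF finABC(1) eA] by (rule sum.cong) (auto simp: le)
        show "Poly_Mapping.lookup (boundary e) G = Poly_Mapping.lookup c G"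
        proof (cases "G \<in> B")
          case True then show ?thesis using w by (simp add: * mult.commute)
        next
          case False
          have "(incidence a G :: 'k) = 0" if "a \<in> A" for a
            using inc0[of a G] incidence_zero[of a G] False fin(2)[of a] that
            by (auto simp: A_def B_def)
          moreover have "Poly_Mapping.lookup c G = 0" using False c by (auto simp: in_keys_iff)
          ultimately show ?thesis by (simp add: *)
        qed
      qed
      then show "c \<in> boundary ` chains \<Delta> (int i - 1 + 1)" using eA chA by blast
    qed
  next
    assume R: ?R
    show chain_exact unfolding chain_exact_def
    proof (intro allI impI)
      fix v :: "nat set \<Rightarrow> 'k" assume v: "\<forall>c\<in>C. (\<Sum>b\<in>B. incidence b c * v b) = 0"
      define e where "e = (\<Sum>b\<in>B. Poly_Mapping.single b (v b))"
      have le: "Poly_Mapping.lookup e b = (if b \<in> B then v b else 0)" for b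
        using finABC(2) by (simp add: e_def lookup_sum lookup_single when_def)
      have eB: "Poly_Mapping.keys e \<subseteq> B" by (auto simp: in_keys_iff le split: if_splits)
      have "boundary e = 0"
      proof (rule poly_mapping_eqI)
        fix G
        have *: "Poly_Mapping.lookup (boundary e) G = (\<Sum>b\<in>B. incidence b G * v b)"
          unfolding lookup_boundary[OF finABC(2) eB] by (rule sum.cong) (auto simp: le)
        show "Poly_Mapping.lookup (boundary e) G = Poly_Mapping.lookup 0 G"
        proof (cases "G \<in> C")
          case True then show ?thesis using v by (simp add: *)
        next
          case False
          have "(incidence b G :: 'k) = 0" if "b \<in> B" for b
            using inc0[of b G] incidence_zero[of b G] False fin(2)[of b] that
            by (auto simp: C_def B_def)
          then show ?thesis by (simp add: *)
        qed
      qed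
      then have "e \<in> boundary ` chains \<Delta> (int i - 1 + 1)" using R eB chB by blast
      then obtain f where f: "Poly_Mapping.keys f \<subseteq> A" "e = boundary f" using chA by auto
      have "v b = (\<Sum>a\<in>A. Poly_Mapping.lookup f a * incidence a b)" if "b \<in> B" for b
        using le[of b] that lookup_boundary[OF finABC(1) f(1)] f(2) by (simp add: mult.commute)
      then show "\<exists>w. \<forall>b\<in>B. v b = (\<Sum>a\<in>A. w a * incidence a b)" by blast
    qed
  qed
  have cochain: "cochain_exact \<longleftrightarrow> acyclic_at TYPE('k) \<Delta> i"
  proof
    assume ex: cochain_exact
    show "acyclic_at TYPE('k) \<Delta> i" unfolding acyclic_at_def is_coboundary_def
    proof (intro allI impI, elim conjE)
      fix u :: "nat set \<Rightarrow> 'k"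
      assume u: "\<forall>F. u F \<noteq> 0 \<longrightarrow> F \<in> \<Delta> \<and> card F = i" and 0: "codiff \<Delta> u = (\<lambda>_. 0)"
      have "(\<Sum>b\<in>B. incidence a b * u b) = 0" if "a \<in> A" for a
      proof -
        have "codiff \<Delta> u a = (\<Sum>b\<in>B. incidence a b * u b)"
          using that fin(2) u by (intro codiff_incidence finABC) (auto simp: A_def B_def)
        then show ?thesis using 0 by simp
      qed
      then obtain w where w: "\<forall>b\<in>B. u b = (\<Sum>c\<in>C. w c * incidence b c)"
        using ex unfolding cochain_exact_def by blast
      define w' where "w' = (\<lambda>c. if c \<in> C then w c else 0)"
      have "codiff \<Delta> w' b = u b" for b
      proof (cases "b \<in> \<Delta>")
        case True
        have cw: "codiff \<Delta> w' b = (\<Sum>c\<in>C. incidence b c * w' c)"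
          using True fin(2) by (intro codiff_incidence finABC) (auto simp: w'_def split: if_splits)
        show ?thesis
        proof (cases "b \<in> B")
          case True
          show ?thesis unfolding cw using w True by (auto simp: w'_def mult.commute intro!: sum.cong)
        next
          case False
          have "(incidence b c :: 'k) = 0" if "c \<in> C" for c
            by (rule incidence_zero) (use fin(2) \<open>b \<in> \<Delta>\<close> False that in \<open>auto simp: B_def C_def\<close>)
          moreover have "u b = 0" using u True False by (auto simp: B_def)
          ultimately show ?thesis by (simp add: cw)
        qed
      next
        case False then show ?thesis using u by (auto simp: codiff_def)
      qed
      then have "codiff \<Delta> w' = u" ..
      moreover have "\<forall>F. w' F \<noteq> 0 \<longrightarrow> F \<in> \<Delta> \<and> Suc (card F) = i" by (auto simp: w'_def C_def)
      ultimately show "\<exists>w. (\<forall>F. w F \<noteq> 0 \<longrightarrow> F \<in> \<Delta> \<and> Suc (card F) = i) \<and> codiff \<Delta> w = u" by blast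
    qed
  next
    assume ac: "acyclic_at TYPE('k) \<Delta> i"
    show cochain_exact unfolding cochain_exact_def
    proof (intro allI impI)
      fix u :: "nat set \<Rightarrow> 'k" assume u: "\<forall>a\<in>A. (\<Sum>b\<in>B. incidence a b * u b) = 0"
      define u' where "u' = (\<lambda>b. if b \<in> B then u b else 0)"
      have u': "\<forall>F. u' F \<noteq> 0 \<longrightarrow> F \<in> \<Delta> \<and> card F = i" by (auto simp: u'_def B_def)
      have "codiff \<Delta> u' F = 0" for F
      proof (cases "F \<in> \<Delta>")
        case True
        have cu: "codiff \<Delta> u' F = (\<Sum>b\<in>B. incidence F b * u' b)"
          using True fin(2) by (intro codiff_incidence finABC) (auto simp: u'_def split: if_splits)
        show ?thesis
        proof (cases "F \<in> A")
          case True
          then show ?thesis unfolding cu using u by (simp add: u'_def)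
        next
          case False
          have "(incidence F b :: 'k) = 0" if "b \<in> B" for b
            by (rule incidence_zero) (use fin(2) \<open>F \<in> \<Delta>\<close> False that in \<open>auto simp: A_def B_def\<close>)
          then show ?thesis by (simp add: cu)
        qed
      qed (simp add: codiff_def)
      then have "codiff \<Delta> u' = (\<lambda>_. 0)" by blast
      then obtain w where w: "\<forall>F. w F \<noteq> 0 \<longrightarrow> F \<in> \<Delta> \<and> Suc (card F) = i" "codiff \<Delta> w = u'"
        using ac u' unfolding acyclic_at_def is_coboundary_def by blast
      have "u b = (\<Sum>c\<in>C. w c * incidence b c)" if "b \<in> B" for b
      proof -
        have "codiff \<Delta> w b = (\<Sum>c\<in>C. incidence b c * w c)"
          using that fin(2) w(1) by (intro codiff_incidence finABC) (auto simp: B_def C_def)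
        then show ?thesis using w(2) that by (simp add: u'_def mult.commute)
      qed
      then show "\<exists>w. \<forall>b\<in>B. u b = (\<Sum>c\<in>C. w c * incidence b c)" by blast
    qed
  qed
  show ?thesis by (rule trans[OF cochain[symmetric] trans[OF dual chain]])
qed

lemma boundary_add:
  fixes c c' :: "nat set \<Rightarrow>\<^sub>0 'k::field"
  shows "boundary (c + c') = boundary c + boundary c'"
proof (rule poly_mapping_eqI)
  fix G
  let ?A = "Poly_Mapping.keys c \<union> Poly_Mapping.keys c'"
  have "Poly_Mapping.keys (c + c') \<subseteq> ?A" by (rule keys_add)
  then show "Poly_Mapping.lookup (boundary (c + c')) G = Poly_Mapping.lookup (boundary c + boundary c') G"
    by (simp add: lookup_boundary[of ?A] lookup_add algebra_simps sum.distrib)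
qed

lemma boundary_uminus:
  fixes c :: "nat set \<Rightarrow>\<^sub>0 'k::field"
  shows "boundary (- c) = - boundary c"
proof -
  have "boundary (c + - c) = 0" by (simp add: boundary_def)
  then show ?thesis unfolding boundary_add by (metis add.inverse_unique)
qed

lemma chains_add: "c \<in> chains \<Delta> q \<Longrightarrow> c' \<in> chains \<Delta> q \<Longrightarrow> c + c' \<in> chains \<Delta> q"
  unfolding chains_def using keys_add[of c c'] by blast

lemma chains_uminus: "c \<in> chains \<Delta> q \<Longrightarrow> - c \<in> chains \<Delta> q"
  unfolding chains_def by (auto simp: in_keys_iff)

lemma zero_reduced_homology_iff:
  "zero_module (reduced_homology \<Delta> q :: ('k, (nat set \<Rightarrow>\<^sub>0 'k::field) set) module) \<longleftrightarrow>
     (\<forall>c \<in> chains \<Delta> q. boundary c = 0 \<longrightarrow> (c :: nat set \<Rightarrow>\<^sub>0 'k) \<in> boundary ` chains \<Delta> (q + 1))"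
proof -
  define B where "B = (boundary ` chains \<Delta> (q + 1) :: (nat set \<Rightarrow>\<^sub>0 'k) set)"
  define Z where "Z = {c :: nat set \<Rightarrow>\<^sub>0 'k. c \<in> chains \<Delta> q \<and> boundary c = 0}"
  have B0: "0 \<in> B"
    unfolding B_def by (rule image_eqI[of _ _ 0]) (auto simp: boundary_def chains_def)
  have Badd: "x + y \<in> B" if "x \<in> B" "y \<in> B" for x y
    using that unfolding B_def by (auto simp flip: boundary_add intro: chains_add)
  have Bneg: "- x \<in> B" if "x \<in> B" for x
    using that unfolding B_def by (auto simp flip: boundary_uminus intro: chains_uminus)
  have Z0: "0 \<in> Z" by (auto simp: Z_def boundary_def chains_def)
  have carr: "carrier (reduced_homology \<Delta> q) = (\<lambda>c. (\<lambda>b. b + c) ` B) ` Z"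
    by (auto simp: reduced_homology_def module_quotient_def cycles_module_def A_RCOSETS_def'
                   a_r_coset_def' B_def Z_def)
  have zero: "\<zero>\<^bsub>reduced_homology \<Delta> q\<^esub> = B"
    by (simp add: reduced_homology_def module_quotient_def B_def)
  have coset: "(\<lambda>b. b + c) ` B = B \<longleftrightarrow> c \<in> B" for c
  proof
    assume "(\<lambda>b. b + c) ` B = B"
    then show "c \<in> B" using B0 by (metis add_0 image_eqI)
  next
    assume c: "c \<in> B"
    show "(\<lambda>b. b + c) ` B = B"
    proof (intro equalityI subsetI)
      fix x assume "x \<in> (\<lambda>b. b + c) ` B"
      then show "x \<in> B" using Badd[OF _ c] by (elim imageE) simp
    next
      fix x assume "x \<in> B"
      from Badd[OF this Bneg[OF c]] show "x \<in> (\<lambda>b. b + c) ` B"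
        by (rule rev_image_eqI) simp
    qed
  qed
  have img: "f ` Z = {B} \<longleftrightarrow> (\<forall>c\<in>Z. f c = B)" for f :: "_ \<Rightarrow> (nat set \<Rightarrow>\<^sub>0 'k) set"
    using Z0 by blast
  have "zero_module (reduced_homology \<Delta> q :: ('k, (nat set \<Rightarrow>\<^sub>0 'k) set) module) \<longleftrightarrow> (\<forall>c\<in>Z. c \<in> B)"
    unfolding zero_module_def carr zero img coset ..
  then show ?thesis by (auto simp: Z_def B_def)
qed


section \<open>Monomial ideals as sets of exponents\<close>

definition exponents :: "nat \<Rightarrow> (nat \<Rightarrow>\<^sub>0 nat) set" where
  "exponents d = {m. Poly_Mapping.keys m \<subseteq> {1..d}}"

lemma exponents_zero: "0 \<in> exponents d"
  by (simp add: exponents_def)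

lemma exponents_add: "m \<in> exponents d \<Longrightarrow> m' \<in> exponents d \<Longrightarrow> m + m' \<in> exponents d"
  unfolding exponents_def using keys_add[of m m'] by blast

lemma poly_ring_simps:
  "carrier (poly_ring d) = {p. Poly_Mapping.keys p \<subseteq> exponents d}"
  "x \<otimes>\<^bsub>poly_ring d\<^esub> y = x * y" "\<one>\<^bsub>poly_ring d\<^esub> = 1"
  "\<zero>\<^bsub>poly_ring d\<^esub> = 0" "x \<oplus>\<^bsub>poly_ring d\<^esub> y = x + y"
  by (auto simp: poly_ring_def exponents_def)

lemma keys_add_subset: "Poly_Mapping.keys p \<subseteq> E \<Longrightarrow> Poly_Mapping.keys q \<subseteq> E \<Longrightarrow> Poly_Mapping.keys (p + q) \<subseteq> E"
  using keys_add[of p q] by blast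

lemma keys_uminus_eq: "Poly_Mapping.keys (- p) = Poly_Mapping.keys (p :: 'a \<Rightarrow>\<^sub>0 'b::ab_group_add)"
  by (auto simp: in_keys_iff)

lemma keys_mult_subset:
  assumes "Poly_Mapping.keys p \<subseteq> A" "Poly_Mapping.keys q \<subseteq> B" "\<And>a b. a \<in> A \<Longrightarrow> b \<in> B \<Longrightarrow> a + b \<in> C"
  shows "Poly_Mapping.keys (p * q) \<subseteq> C"
  using keys_mult[of p q] assms by blast

lemma poly_ring_cring: "cring (poly_ring d :: 'k::field mpoly ring)"
proof (rule cringI)
  show "abelian_group (poly_ring d :: 'k mpoly ring)"
  proof (rule abelian_groupI)
    fix x :: "'k mpoly" assume "x \<in> carrier (poly_ring d)"
    then show "\<exists>y\<in>carrier (poly_ring d). y \<oplus>\<^bsub>poly_ring d\<^esub> x = \<zero>\<^bsub>poly_ring d\<^esub>"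
      by (intro bexI[of _ "- x"]) (auto simp: poly_ring_simps keys_uminus_eq)
  qed (auto simp: poly_ring_simps add.assoc add.commute dest!: keys_add[THEN subsetD])
  show "comm_monoid (poly_ring d :: 'k mpoly ring)"
  proof (rule comm_monoidI)
    fix x y :: "'k mpoly" assume "x \<in> carrier (poly_ring d)" "y \<in> carrier (poly_ring d)"
    then show "x \<otimes>\<^bsub>poly_ring d\<^esub> y \<in> carrier (poly_ring d)"
      unfolding poly_ring_simps mem_Collect_eq by (rule keys_mult_subset) (rule exponents_add)
  qed (auto simp: poly_ring_simps exponents_zero mult.assoc mult.commute)
qed (simp add: poly_ring_simps distrib_right)

lemma poly_ring_nat_pow: "x [^]\<^bsub>poly_ring d\<^esub> (n::nat) = x ^ n"
proof -
  interpret cring "poly_ring d" by (rule poly_ring_cring)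
  show ?thesis by (induction n) (simp_all add: poly_ring_simps mult.commute)
qed

lemma poly_mapping_sum_singles:
  fixes p :: "'a \<Rightarrow>\<^sub>0 'b::comm_monoid_add"
  shows "(\<Sum>m\<in>Poly_Mapping.keys p. Poly_Mapping.single m (Poly_Mapping.lookup p m)) = p"
  by (rule poly_mapping_eqI) (auto simp: lookup_sum lookup_single when_def in_keys_iff)

lemma keys_sum_subset:
  "(\<And>i. i \<in> I \<Longrightarrow> Poly_Mapping.keys (f i) \<subseteq> E) \<Longrightarrow> Poly_Mapping.keys (sum f I) \<subseteq> E"
  by (induction I rule: infinite_finite_induct) (auto dest: keys_add[THEN subsetD])

locale exponent_ideal =
  fixes d :: nat and E :: "(nat \<Rightarrow>\<^sub>0 nat) set"
  assumes subset_exponents: "E \<subseteq> exponents d"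
    and add_closed: "\<And>m e. m \<in> E \<Longrightarrow> e \<in> exponents d \<Longrightarrow> m + e \<in> E"

definition monomial_span :: "(nat \<Rightarrow>\<^sub>0 nat) set \<Rightarrow> 'k::field mpoly set" where
  "monomial_span E = {p. Poly_Mapping.keys p \<subseteq> E}"

lemma (in exponent_ideal) ideal_monomial_span: "ideal (monomial_span E :: 'k::field mpoly set) (poly_ring d)"
proof -
  interpret R: cring "poly_ring d :: 'k mpoly ring" by (rule poly_ring_cring)
  have add_closed': "m \<in> E \<Longrightarrow> e \<in> exponents d \<Longrightarrow> e + m \<in> E" for m e
    by (metis add.commute add_closed)
  have inv: "inv\<^bsub>add_monoid (poly_ring d)\<^esub> a = - a" if "a \<in> carrier (poly_ring d)" for a :: "'k mpoly"
    using R.minus_equality[of "- a" a] that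
    by (auto simp: poly_ring_simps keys_uminus_eq a_inv_def)
  show ?thesis
  proof (rule idealI)
    show "subgroup (monomial_span E :: 'k mpoly set) (add_monoid (poly_ring d))"
    proof
      show sub: "monomial_span E \<subseteq> carrier (add_monoid (poly_ring d :: 'k mpoly ring))"
        using subset_exponents by (auto simp: monomial_span_def poly_ring_simps)
      show "\<one>\<^bsub>add_monoid (poly_ring d)\<^esub> \<in> (monomial_span E :: 'k mpoly set)"
        by (simp add: monomial_span_def poly_ring_simps)
      fix x y :: "'k mpoly" assume x: "x \<in> monomial_span E"
      then have "x \<in> carrier (poly_ring d)" using sub by auto
      then show "inv\<^bsub>add_monoid (poly_ring d)\<^esub> x \<in> monomial_span E"
        using x unfolding monomial_span_def mem_Collect_eq by (subst inv) (simp_all add: keys_uminus_eq)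
      assume "y \<in> monomial_span E"
      then show "x \<otimes>\<^bsub>add_monoid (poly_ring d)\<^esub> y \<in> monomial_span E"
        using x keys_add_subset[of x E y] by (simp add: monomial_span_def poly_ring_simps)
    qed
  next
    fix a x :: "'k mpoly" assume a: "a \<in> monomial_span E" and x: "x \<in> carrier (poly_ring d)"
    show "x \<otimes>\<^bsub>poly_ring d\<^esub> a \<in> monomial_span E"
      using keys_mult_subset[of x "exponents d" a E E] x a add_closed'
      by (simp add: monomial_span_def poly_ring_simps)
    show "a \<otimes>\<^bsub>poly_ring d\<^esub> x \<in> monomial_span E"
      using keys_mult_subset[of a E x "exponents d" E] x a add_closed
      by (simp add: monomial_span_def poly_ring_simps)
  qed (rule R.ring_axioms)
qed

lemma monomial_span_subset:
  assumes "0 \<in> I" and add: "\<And>p q :: 'k::field mpoly. p \<in> I \<Longrightarrow> q \<in> I \<Longrightarrow> p + q \<in> I"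
    and "\<And>m c. m \<in> E \<Longrightarrow> Poly_Mapping.single m c \<in> I"
  shows "monomial_span E \<subseteq> I"
proof
  fix p :: "'k mpoly" assume p: "p \<in> monomial_span E"
  have "(\<Sum>m\<in>S. Poly_Mapping.single m (Poly_Mapping.lookup p m)) \<in> I" if "finite S" "S \<subseteq> E" for S
    using that by (induction S rule: finite_induct) (auto intro: assms)
  from this[OF finite_keys, of p] p show "p \<in> I"
    by (simp add: poly_mapping_sum_singles monomial_span_def)
qed

definition up_closure :: "nat \<Rightarrow> (nat \<Rightarrow>\<^sub>0 nat) set \<Rightarrow> (nat \<Rightarrow>\<^sub>0 nat) set" where
  "up_closure d A = {a + e | a e. a \<in> A \<and> e \<in> exponents d}"

lemma exponent_ideal_up_closure: "A \<subseteq> exponents d \<Longrightarrow> exponent_ideal d (up_closure d A)"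
proof
  assume A: "A \<subseteq> exponents d"
  then show "up_closure d A \<subseteq> exponents d"
    unfolding up_closure_def using exponents_add by blast
  fix m e assume "m \<in> up_closure d A" and e: "e \<in> exponents d"
  then obtain a e' where "m = a + e'" "a \<in> A" "e' \<in> exponents d" by (auto simp: up_closure_def)
  moreover from this e have "e' + e \<in> exponents d" by (intro exponents_add)
  ultimately show "m + e \<in> up_closure d A" by (auto simp: up_closure_def add.assoc)
qed

lemma genideal_monomials:
  assumes A: "A \<subseteq> exponents d"
  shows "genideal (poly_ring d) (monom ` A :: 'k::field mpoly set) = monomial_span (up_closure d A)"
proof
  interpret R: cring "poly_ring d :: 'k mpoly ring" by (rule poly_ring_cring)
  interpret exponent_ideal d "up_closure d A" by (rule exponent_ideal_up_closure[OF A])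
  have sub: "(monom ` A :: 'k mpoly set) \<subseteq> carrier (poly_ring d)"
    using A by (auto simp: monom_def poly_ring_simps)
  have "a \<in> up_closure d A" if "a \<in> A" for a
    unfolding up_closure_def using that exponents_zero by force
  then show "genideal (poly_ring d) (monom ` A :: 'k mpoly set) \<subseteq> monomial_span (up_closure d A)"
    by (intro R.genideal_minimal ideal_monomial_span) (auto simp: monomial_span_def monom_def)
  define G where "G = genideal (poly_ring d) (monom ` A :: 'k mpoly set)"
  have G: "ideal G (poly_ring d)" unfolding G_def by (rule R.genideal_ideal[OF sub])
  then interpret G: ideal G "poly_ring d" .
  show "monomial_span (up_closure d A) \<subseteq> genideal (poly_ring d) (monom ` A :: 'k mpoly set)"
  proof (rule monomial_span_subset, fold G_def)
    fix m and c :: 'k assume "m \<in> up_closure d A"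
    then obtain a e where ae: "m = a + e" "a \<in> A" "e \<in> exponents d" by (auto simp: up_closure_def)
    have "(monom a :: 'k mpoly) \<in> G" unfolding G_def using R.genideal_self[OF sub] ae by blast
    then have "monom a \<otimes>\<^bsub>poly_ring d\<^esub> Poly_Mapping.single e c \<in> G"
      by (rule G.I_r_closed) (use ae in \<open>auto simp: poly_ring_simps\<close>)
    then show "Poly_Mapping.single m c \<in> G" by (simp add: poly_ring_simps monom_def mult_single ae)
  qed (use G.zero_closed G.a_closed in \<open>auto simp: poly_ring_simps\<close>)
qed

lemma ideal_prod_monomial_span:
  fixes d :: nat
  shows "ideal_prod (poly_ring d) (monomial_span E) (monomial_span E' :: 'k::field mpoly set)
    = monomial_span {a + b | a b. a \<in> E \<and> b \<in> E'}" (is "?L = monomial_span ?S")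
proof
  show "?L \<subseteq> monomial_span ?S"
  proof
    fix p assume "p \<in> ?L"
    then show "p \<in> monomial_span ?S"
    proof (induction p rule: ideal_prod.induct)
      case (prod i j)
      then show ?case unfolding monomial_span_def poly_ring_simps mem_Collect_eq
        by (rule keys_mult_subset) blast
    next
      case (sum p q)
      then show ?case unfolding monomial_span_def poly_ring_simps mem_Collect_eq
        by (intro keys_add_subset)
    qed
  qed
  have prodI: "p * q \<in> ?L" if "p \<in> monomial_span E" "q \<in> monomial_span E'" for p q
    using ideal_prod.prod[OF that, of "poly_ring d"] by (simp add: poly_ring_simps)
  show "monomial_span ?S \<subseteq> ?L"
  proof (rule monomial_span_subset)
    show "0 \<in> ?L" using prodI[of 0 0] by (simp add: monomial_span_def)
    show "p + q \<in> ?L" if "p \<in> ?L" "q \<in> ?L" for p q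
      using ideal_prod.sum[OF that] by (simp add: poly_ring_simps)
    fix m and c :: 'k assume "m \<in> ?S"
    then obtain a b where ab: "m = a + b" "a \<in> E" "b \<in> E'" by auto
    then show "Poly_Mapping.single m c \<in> ?L"
      using prodI[of "Poly_Mapping.single a 1" "Poly_Mapping.single b c"]
      by (auto simp: mult_single monomial_span_def split: if_splits)
  qed
qed

fun exponent_power :: "nat \<Rightarrow> (nat \<Rightarrow>\<^sub>0 nat) set \<Rightarrow> nat \<Rightarrow> (nat \<Rightarrow>\<^sub>0 nat) set" where
  "exponent_power d E 0 = exponents d"
| "exponent_power d E (Suc n) = {a + b | a b. a \<in> exponent_power d E n \<and> b \<in> E}"

lemma ideal_power_monomial_span:
  "ideal_power (poly_ring d) (monomial_span E :: 'k::field mpoly set) n = monomial_span (exponent_power d E n)"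
proof (induction n)
  case 0
  show ?case by (auto simp: ideal_power_def nat_pow_def ideals_set_def poly_ring_simps monomial_span_def)
next
  case (Suc n)
  have "ideal_power (poly_ring d) (monomial_span E :: 'k mpoly set) (Suc n)
     = ideal_prod (poly_ring d) (ideal_power (poly_ring d) (monomial_span E) n) (monomial_span E)"
    by (simp add: ideal_power_def nat_pow_def ideals_set_def)
  then show ?case by (simp add: Suc ideal_prod_monomial_span)
qed

lemma (in exponent_ideal) exponent_ideal_power: "exponent_ideal d (exponent_power d E n)"
proof (induction n)
  case 0
  show ?case by unfold_locales (auto intro: exponents_add)
next
  case (Suc n)
  interpret n: exponent_ideal d "exponent_power d E n" by (rule Suc)
  show ?case
  proof
    show "exponent_power d E (Suc n) \<subseteq> exponents d"
      using n.subset_exponents subset_exponents exponents_add by fastforce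
    fix m e assume "m \<in> exponent_power d E (Suc n)" "e \<in> exponents d"
    then obtain a b where "m = a + b" "a \<in> exponent_power d E n" "b \<in> E" by auto
    moreover from this \<open>e \<in> exponents d\<close> have "b + e \<in> E" by (intro add_closed)
    ultimately show "m + e \<in> exponent_power d E (Suc n)" by (auto simp: add.assoc)
  qed
qed


subsection \<open>Integer exponents\<close>

text \<open>Fractions have integer exponents, so polynomials are treated as functions on
  \<open>nat \<Rightarrow> int\<close> that vanish outside the range of \<open>zexp\<close>.\<close>

definition zexp :: "(nat \<Rightarrow>\<^sub>0 nat) \<Rightarrow> nat \<Rightarrow> int" where
  "zexp m l = int (Poly_Mapping.lookup m l)"

definition zcoef :: "'k::field mpoly \<Rightarrow> (nat \<Rightarrow> int) \<Rightarrow> 'k" where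
  "zcoef p b = (\<Sum>m\<in>Poly_Mapping.keys p. if zexp m = b then Poly_Mapping.lookup p m else 0)"

lemma zexp_inj: "zexp m = zexp m' \<longleftrightarrow> m = m'"
  by (auto simp: zexp_def fun_eq_iff intro: poly_mapping_eqI)

lemma zexp_add: "zexp (m + m') = (\<lambda>l. zexp m l + zexp m' l)"
  by (simp add: zexp_def fun_eq_iff lookup_add)

lemma zcoef_zexp [simp]: "zcoef p (zexp m) = Poly_Mapping.lookup p m"
  by (simp add: zcoef_def zexp_inj in_keys_iff)

lemma zcoef_not_range: "b \<notin> range zexp \<Longrightarrow> zcoef p b = 0"
  by (auto simp: zcoef_def intro!: sum.neutral)

lemma zcoef_nonzero: "zcoef p b \<noteq> 0 \<Longrightarrow> \<exists>m\<in>Poly_Mapping.keys p. b = zexp m"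
  by (cases "b \<in> range zexp") (auto simp: zcoef_not_range in_keys_iff)

lemma zcoef_linear [simp]:
  "zcoef 0 b = 0" "zcoef (p + q) b = zcoef p b + zcoef q b" "zcoef (p - q) b = zcoef p b - zcoef q b"
  "zcoef (- p) b = - zcoef p b"
  by (cases "b \<in> range zexp"; auto simp: zcoef_not_range lookup_add lookup_minus)+

lemma zcoef_sum: "zcoef (sum f S) b = (\<Sum>i\<in>S. zcoef (f i) b)"
  by (induction S rule: infinite_finite_induct) auto

lemma zcoef_single: "zcoef (Poly_Mapping.single m c) b = (if b = zexp m then c else 0)"
proof (cases "b \<in> range zexp")
  case True
  then show ?thesis by (auto simp: zexp_inj lookup_single when_def)
qed (auto simp: zcoef_not_range)

lemma zcoef_single_mult:
  "zcoef (Poly_Mapping.single m c * p) b = c * zcoef p (\<lambda>l. b l - zexp m l)"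
proof -
  have "Poly_Mapping.single m c * p =
      (\<Sum>m'\<in>Poly_Mapping.keys p. Poly_Mapping.single (m + m') (c * Poly_Mapping.lookup p m'))"
    by (subst (1) poly_mapping_sum_singles[of p, symmetric]) (simp add: sum_distrib_left mult_single)
  then have "zcoef (Poly_Mapping.single m c * p) b =
      (\<Sum>m'\<in>Poly_Mapping.keys p. if b = zexp (m + m') then c * Poly_Mapping.lookup p m' else 0)"
    by (simp add: zcoef_sum zcoef_single)
  also have "\<dots> = c * zcoef p (\<lambda>l. b l - zexp m l)"
  proof -
    have "(b = zexp (m + m')) = (zexp m' = (\<lambda>l. b l - zexp m l))" for m'
      by (auto simp: zexp_add fun_eq_iff)
    then show ?thesis unfolding zcoef_def by (auto simp: sum_distrib_left intro!: sum.cong)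
  qed
  finally show ?thesis .
qed

lemma zcoef_mult:
  "zcoef (q * p) b = (\<Sum>m\<in>Poly_Mapping.keys q. Poly_Mapping.lookup q m * zcoef p (\<lambda>l. b l - zexp m l))"
proof -
  have "q * p = (\<Sum>m\<in>Poly_Mapping.keys q. Poly_Mapping.single m (Poly_Mapping.lookup q m) * p)"
    by (simp add: sum_distrib_right[symmetric] poly_mapping_sum_singles)
  then show ?thesis by (simp add: zcoef_sum zcoef_single_mult)
qed

lemma finite_zcoef: "finite {b. zcoef p b \<noteq> 0}"
  by (rule finite_subset[of _ "zexp ` Poly_Mapping.keys p"]) (auto dest: zcoef_nonzero)

text \<open>Multiplication by \<open>x_F^k\<close> moves the coefficient at \<open>a\<close> to \<open>shift F k a\<close>.\<close>

definition shift :: "nat set \<Rightarrow> int \<Rightarrow> (nat \<Rightarrow> int) \<Rightarrow> nat \<Rightarrow> int" where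
  "shift F k a = (\<lambda>l. if l \<in> F then a l + k else a l)"

lemma shift_shift [simp]: "shift F k (shift F k' a) = shift F (k + k') a"
  by (auto simp: shift_def)

lemma shift_0 [simp]: "shift F 0 a = a"
  by (auto simp: shift_def)

definition face_exp :: "nat set \<Rightarrow> nat \<Rightarrow> (nat \<Rightarrow>\<^sub>0 nat)" where
  "face_exp F t = (\<Sum>j\<in>F. Poly_Mapping.single j t)"

lemma lookup_face_exp: "finite F \<Longrightarrow> Poly_Mapping.lookup (face_exp F t) l = (if l \<in> F then t else 0)"
  by (simp add: face_exp_def lookup_sum lookup_single when_def)

lemma face_exp_in_exponents: "F \<subseteq> {1..d} \<Longrightarrow> face_exp F t \<in> exponents d"
  unfolding exponents_def face_exp_def mem_Collect_eq by (rule keys_sum_subset) auto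

lemma var_prod_power: "finite F \<Longrightarrow> var_prod F ^ t = (monom (face_exp F t) :: 'k::field mpoly)"
proof -
  assume F: "finite F"
  have 1: "var_prod F = (monom (face_exp F 1) :: 'k mpoly)"
    unfolding var_prod_def face_exp_def using F
    by (induction F rule: finite_induct) (auto simp: var_def monom_def mult_single)
  show ?thesis
  proof (induction t)
    case 0
    then show ?case by (simp add: face_exp_def monom_def)
  next
    case (Suc t)
    then show ?case
      by (simp add: 1) (simp add: monom_def mult_single face_exp_def sum.distrib[symmetric] single_add[symmetric])
  qed
qed

lemma zcoef_var_prod_mult:
  assumes "finite F" shows "zcoef (var_prod F ^ t * p) b = zcoef p (shift F (- int t) b)"
proof -
  have "(\<lambda>l. b l - zexp (face_exp F t) l) = shift F (- int t) b"
    using assms by (auto simp: shift_def zexp_def lookup_face_exp)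
  then show ?thesis using assms by (simp add: var_prod_power monom_def zcoef_single_mult)
qed

lemma var_prod_power_in_carrier: "F \<subseteq> {1..d} \<Longrightarrow> (var_prod F :: 'k::field mpoly) ^ t \<in> carrier (poly_ring d)"
  using finite_subset[of F "{1..d}"]
  by (simp add: var_prod_power poly_ring_simps monom_def face_exp_in_exponents)


subsection \<open>Localization of exponent sets\<close>

context exponent_ideal
begin

text \<open>These are the exponents \<open>a\<close> of the Laurent monomials that lie in the extension of the ideal to
  the localization at \<open>x_F\<close>.\<close>

definition local_exps :: "nat set \<Rightarrow> (nat \<Rightarrow> int) set" where
  "local_exps F = {a. \<exists>t. shift F (int t) a \<in> zexp ` E}"

lemma shift_in_zexp_mono:
  assumes "F \<subseteq> {1..d}" "shift F (int s) a \<in> zexp ` E" "s \<le> t"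
  shows "shift F (int t) a \<in> zexp ` E"
proof -
  obtain m where m: "m \<in> E" "shift F (int s) a = zexp m" using assms by auto
  have "finite F" using assms(1) finite_subset by blast
  have "shift F (int t) a = shift F (int (t - s)) (shift F (int s) a)"
    using assms(3) by (simp add: of_nat_diff)
  also have "\<dots> = zexp (m + face_exp F (t - s))"
    unfolding m(2) using \<open>finite F\<close> by (auto simp: zexp_add shift_def zexp_def lookup_face_exp)
  finally show ?thesis using add_closed[OF m(1) face_exp_in_exponents[OF assms(1)]] by blast
qed

lemma local_exps_mono:
  assumes "F \<subseteq> G" "G \<subseteq> {1..d}" shows "local_exps F \<subseteq> local_exps G"
proof
  fix a assume "a \<in> local_exps F"
  then obtain t m where m: "m \<in> E" "shift F (int t) a = zexp m" by (auto simp: local_exps_def)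
  have fin: "finite (G - F)" using assms(2) finite_subset by blast
  have "shift G (int t) a = shift (G - F) (int t) (shift F (int t) a)"
    using assms(1) by (intro ext) (auto simp: shift_def)
  also have "\<dots> = zexp (m + face_exp (G - F) t)"
    unfolding m(2) using fin by (auto simp: zexp_add shift_def zexp_def lookup_face_exp)
  finally have "shift G (int t) a = zexp (m + face_exp (G - F) t)" .
  moreover have "m + face_exp (G - F) t \<in> E"
    using assms(2) by (intro add_closed m face_exp_in_exponents) auto
  ultimately show "a \<in> local_exps G" by (auto simp: local_exps_def)
qed

lemma local_exps_add:
  assumes "a \<in> local_exps F" "e \<in> exponents d"
  shows "(\<lambda>l. a l + zexp e l) \<in> local_exps F"
proof -
  obtain t m where m: "m \<in> E" "shift F (int t) a = zexp m" using assms by (auto simp: local_exps_def)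
  have "shift F (int t) (\<lambda>l. a l + zexp e l) = zexp (m + e)"
    using m(2) by (auto simp: zexp_add shift_def fun_eq_iff) (metis add.commute add.left_commute)+
  then show ?thesis using add_closed[OF m(1) assms(2)] by (auto simp: local_exps_def)
qed

lemma monomial_span_iff:
  "p \<in> monomial_span E \<longleftrightarrow> (\<forall>b. b \<notin> zexp ` E \<longrightarrow> zcoef p b = 0)"
proof
  assume "p \<in> monomial_span E"
  then show "\<forall>b. b \<notin> zexp ` E \<longrightarrow> zcoef p b = 0"
    using zcoef_nonzero[of p] unfolding monomial_span_def by blast
next
  assume *: "\<forall>b. b \<notin> zexp ` E \<longrightarrow> zcoef p b = 0"
  have "m \<in> E" if "m \<in> Poly_Mapping.keys p" for m
    using *[rule_format, of "zexp m"] that by (fastforce simp: zexp_inj in_keys_iff image_iff)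
  then show "p \<in> monomial_span E" by (auto simp: monomial_span_def)
qed

end


subsection \<open>The Stanley-Reisner complex and small exponents\<close>

lemma (in exponent_ideal) stanley_reisner_eq:
  "stanley_reisner_complex d (monomial_span E :: 'k::field mpoly set)
     = {F. F \<subseteq> {1..d} \<and> (\<forall>t. face_exp F t \<notin> E)}"
proof -
  have "(var_prod F :: 'k mpoly) \<in> ideal_radical (poly_ring d) (monomial_span E) \<longleftrightarrow> (\<exists>t. face_exp F t \<in> E)"
    if F: "F \<subseteq> {1..d}" for F
  proof -
    have "finite F" using F finite_subset by blast
    then have "(var_prod F :: 'k mpoly) [^]\<^bsub>poly_ring d\<^esub> t \<in> monomial_span E \<longleftrightarrow> face_exp F t \<in> E" for t :: nat
      by (simp add: poly_ring_nat_pow var_prod_power monom_def monomial_span_def)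
    moreover have "(var_prod F :: 'k mpoly) \<in> carrier (poly_ring d)"
      using var_prod_power_in_carrier[OF F, of 1] by simp
    ultimately show ?thesis by (simp add: ideal_radical_def)
  qed
  then show ?thesis by (auto simp: stanley_reisner_complex_def)
qed

lemma (in exponent_ideal) face_exp_mono:
  assumes "F \<subseteq> G" "G \<subseteq> {1..d}" "face_exp F t \<in> E" shows "face_exp G t \<in> E"
proof -
  have "finite G" by (rule finite_subset[OF assms(2)]) simp
  then have fin: "finite G" "finite F" "finite (G - F)" using assms(1) by (auto intro: finite_subset)
  have "face_exp G t = face_exp F t + face_exp (G - F) t"
    by (rule poly_mapping_eqI) (use assms(1) fin in \<open>auto simp: lookup_face_exp lookup_add\<close>)
  moreover have "face_exp F t + face_exp (G - F) t \<in> E"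
    using assms by (intro add_closed face_exp_in_exponents) auto
  ultimately show ?thesis by simp
qed

text \<open>Inverting the variables of a face \<open>F\<close> leaves a proper ideal in the other variables, so each
  generator of the ideal still has positive degree in these and each generator of the \<open>n\<close>-th power
  has degree at least \<open>n\<close>.\<close>

lemma (in exponent_ideal) exponent_power_degree:
  assumes F: "F \<subseteq> {1..d}" "\<forall>t. face_exp F t \<notin> E" and "m \<in> exponent_power d E n"
  shows "n \<le> (\<Sum>l\<in>{1..d} - F. Poly_Mapping.lookup m l)"
  using assms(3)
proof (induction n arbitrary: m)
  case (Suc n)
  then obtain a b where m: "m = a + b" "a \<in> exponent_power d E n" "b \<in> E" by auto
  have "finite F" using F finite_subset by blast
  have "(\<Sum>l\<in>{1..d} - F. Poly_Mapping.lookup b l) \<noteq> 0"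
  proof
    assume "(\<Sum>l\<in>{1..d} - F. Poly_Mapping.lookup b l) = 0"
    then have off0: "\<forall>l\<in>{1..d} - F. Poly_Mapping.lookup b l = 0" by simp
    have off: "Poly_Mapping.lookup b l = 0" if "l \<notin> F" for l
    proof (cases "l \<in> {1..d}")
      case False
      have "Poly_Mapping.keys b \<subseteq> {1..d}" using m(3) subset_exponents by (auto simp: exponents_def)
      then show ?thesis using False by (meson in_keys_iff subsetD)
    qed (use off0 that in auto)
    define T where "T = (\<Sum>l\<in>F. Poly_Mapping.lookup b l)"
    have le: "Poly_Mapping.lookup b l \<le> T" if "l \<in> F" for l
      unfolding T_def using that \<open>finite F\<close> by (simp add: member_le_sum)
    define e where "e = (\<Sum>l\<in>F. Poly_Mapping.single l (T - Poly_Mapping.lookup b l))"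
    have "face_exp F T = b + e"
      by (rule poly_mapping_eqI)
         (use off le \<open>finite F\<close> in \<open>auto simp: lookup_face_exp e_def lookup_add lookup_sum lookup_single when_def\<close>)
    moreover have "e \<in> exponents d"
      unfolding exponents_def e_def mem_Collect_eq by (rule keys_sum_subset) (use F in auto)
    ultimately show False using add_closed[OF m(3)] F(2) by metis
  qed
  then have "1 \<le> (\<Sum>l\<in>{1..d} - F. Poly_Mapping.lookup b l)" by linarith
  with Suc.IH[OF m(2)] have "n + 1 \<le> (\<Sum>l\<in>{1..d} - F. Poly_Mapping.lookup a l + Poly_Mapping.lookup b l)"
    unfolding sum.distrib by (rule add_mono)
  then show ?case by (simp add: m lookup_add)
qed simp

text \<open>If \<open>F\<close> is not a face, then \<open>I\<close> becomes the unit ideal after inverting \<open>x_F\<close>, and so do its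
  powers. If it is a face, then \<open>x^a x_F^t\<close> has degree less than \<open>n\<close> in the variables outside \<open>F\<close>,
  which is too small for the \<open>n\<close>-th power.\<close>

lemma (in exponent_ideal) local_exps_power_iff:
  assumes F: "F \<subseteq> {1..d}" and n: "0 < n"
    and a: "\<And>l. 0 \<le> a l" "\<And>l. l \<notin> {1..d} \<Longrightarrow> a l = 0" "(\<Sum>l\<in>{1..d}. a l) < int n"
  shows "a \<in> exponent_ideal.local_exps (exponent_power d E n) F \<longleftrightarrow> (\<exists>t. face_exp F t \<in> E)"
proof -
  interpret P: exponent_ideal d "exponent_power d E n" by (rule exponent_ideal_power)
  have "finite F" using F finite_subset by blast
  show ?thesis
  proof
    assume "\<exists>t. face_exp F t \<in> E"
    then obtain t where t: "face_exp F t \<in> E" ..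
    have pow: "face_exp F (k * t) \<in> exponent_power d E k" for k
    proof (induction k)
      case 0
      show ?case unfolding exponent_power.simps by (rule face_exp_in_exponents[OF F])
    next
      case (Suc k)
      have "face_exp F (Suc k * t) = face_exp F (k * t) + face_exp F t"
        by (rule poly_mapping_eqI) (simp add: lookup_face_exp \<open>finite F\<close> lookup_add)
      then show ?case using Suc t by auto
    qed
    define e where "e = (\<Sum>l\<in>{1..d}. Poly_Mapping.single l (nat (a l)))"
    have e: "e \<in> exponents d"
      unfolding exponents_def e_def mem_Collect_eq by (rule keys_sum_subset) auto
    have "zexp e = a"
      using a(1,2) by (auto simp: zexp_def e_def lookup_sum lookup_single when_def)
    then have "shift F (int (n * t)) a = zexp (face_exp F (n * t) + e)"
      using \<open>finite F\<close> by (auto simp: zexp_add shift_def zexp_def[of "face_exp F (n * t)"] lookup_face_exp)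
    then show "a \<in> P.local_exps F"
      using P.add_closed[OF pow e] unfolding P.local_exps_def by blast
  next
    assume "a \<in> P.local_exps F"
    then obtain t m where m: "m \<in> exponent_power d E n" "shift F (int t) a = zexp m"
      by (auto simp: P.local_exps_def)
    show "\<exists>t. face_exp F t \<in> E"
    proof (rule ccontr)
      assume "\<nexists>t. face_exp F t \<in> E"
      then have "n \<le> (\<Sum>l\<in>{1..d} - F. Poly_Mapping.lookup m l)"
        using exponent_power_degree[OF F _ m(1)] by blast
      then have "int n \<le> (\<Sum>l\<in>{1..d} - F. zexp m l)" by (simp add: zexp_def flip: of_nat_sum)
      also have "\<dots> = (\<Sum>l\<in>{1..d} - F. a l)"
        unfolding m(2)[symmetric] by (rule sum.cong) (auto simp: shift_def)
      also have "\<dots> \<le> (\<Sum>l\<in>{1..d}. a l)" using a(1) by (intro sum_mono2) auto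
      finally show False using a(3) by simp
    qed
  qed
qed


section \<open>Localizations of a monomial quotient\<close>

text \<open>The group laws hold because they hold coordinatewise. This is applied to coefficients of
  fractions and of Cech cochains.\<close>

lemma abelian_group_by_coordinates:
  fixes G (structure) and \<phi> :: "'a \<Rightarrow> 'i \<Rightarrow> 'b::ab_group_add"
  assumes inj: "\<And>x y. x \<in> carrier G \<Longrightarrow> y \<in> carrier G \<Longrightarrow> (\<And>i. \<phi> x i = \<phi> y i) \<Longrightarrow> x = y"
    and closed: "\<And>x y. x \<in> carrier G \<Longrightarrow> y \<in> carrier G \<Longrightarrow> x \<oplus> y \<in> carrier G"
    and add: "\<And>x y i. x \<in> carrier G \<Longrightarrow> y \<in> carrier G \<Longrightarrow> \<phi> (x \<oplus> y) i = \<phi> x i + \<phi> y i"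
    and zero: "\<zero> \<in> carrier G" "\<And>i. \<phi> \<zero> i = 0"
    and neg: "\<And>x. x \<in> carrier G \<Longrightarrow> \<exists>y\<in>carrier G. \<forall>i. \<phi> y i = - \<phi> x i"
  shows "abelian_group G"
proof (rule abelian_groupI)
  fix x assume x: "x \<in> carrier G"
  then obtain y where y: "y \<in> carrier G" "\<forall>i. \<phi> y i = - \<phi> x i" using neg by blast
  have "y \<oplus> x = \<zero>" by (rule inj) (use x y closed zero add in auto)
  then show "\<exists>y\<in>carrier G. y \<oplus> x = \<zero>" using y by blast
next
  fix x y z assume "x \<in> carrier G" "y \<in> carrier G" "z \<in> carrier G"
  then show "x \<oplus> y \<oplus> z = x \<oplus> (y \<oplus> z)"
    by (intro inj) (auto simp: add closed add.assoc)
next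
  fix x y assume "x \<in> carrier G" "y \<in> carrier G"
  then show "x \<oplus> y = y \<oplus> x" by (intro inj) (auto simp: add closed add.commute)
next
  fix x assume "x \<in> carrier G"
  then show "\<zero> \<oplus> x = x" by (intro inj) (auto simp: add closed zero)
qed (use closed zero in auto)

context exponent_ideal
begin

text \<open>The coset of \<open>p\<close>, that is, an element of \<open>R/J\<close>.\<close>

definition residue :: "'k::field mpoly \<Rightarrow> 'k mpoly set" where
  "residue p = (\<lambda>j. j + p) ` monomial_span E"

definition quotient :: "('k::field mpoly, 'k mpoly set) graded_module" where
  "quotient = graded_quotient (poly_graded_module d) (monomial_span E)"

lemma monomial_span_closed:
  "0 \<in> monomial_span E"
  "p \<in> monomial_span E \<Longrightarrow> q \<in> monomial_span E \<Longrightarrow> p + q \<in> monomial_span E"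
  "p \<in> monomial_span E \<Longrightarrow> - p \<in> monomial_span E"
  "p \<in> monomial_span E \<Longrightarrow> q \<in> monomial_span E \<Longrightarrow> p - q \<in> monomial_span E"
  by (simp_all add: monomial_span_iff)

lemma monomial_span_mult:
  "a \<in> carrier (poly_ring d) \<Longrightarrow> p \<in> monomial_span E \<Longrightarrow> a * p \<in> monomial_span E"
  using ideal.I_l_closed[OF ideal_monomial_span, of p a] by (simp add: poly_ring_simps)

lemma residue_eq_iff: "residue p = residue q \<longleftrightarrow> p - q \<in> monomial_span E"
proof
  assume "residue p = residue q"
  then have "p \<in> residue q" using monomial_span_closed(1) unfolding residue_def by (metis add_0 image_eqI)
  then show "p - q \<in> monomial_span E" by (auto simp: residue_def)
next
  assume *: "p - q \<in> monomial_span E"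
  have sub: "residue p \<subseteq> residue q" if "p - q \<in> monomial_span E" for p q :: "'a mpoly"
  proof
    fix x assume "x \<in> residue p"
    then obtain j where j: "j \<in> monomial_span E" "x = j + p" by (auto simp: residue_def)
    then have "j + (p - q) \<in> monomial_span E" using that monomial_span_closed(2) by blast
    then show "x \<in> residue q" unfolding residue_def by (rule rev_image_eqI) (simp add: j)
  qed
  show "residue p = residue q"
    using sub[OF *] sub[of q p] monomial_span_closed(3)[OF *] by simp
qed

lemma residue_self: "p \<in> residue p"
  unfolding residue_def by (rule image_eqI[of _ _ 0]) (auto simp: monomial_span_closed)

lemma in_residue_iff: "q \<in> residue p \<longleftrightarrow> residue q = residue p"
  unfolding residue_eq_iff by (force simp: residue_def image_iff)

lemma a_r_coset_residue: "monomial_span E +>\<^bsub>poly_graded_module d\<^esub> p = residue p"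
  by (auto simp: a_r_coset_def' residue_def poly_graded_module_def)

lemma carrier_quotient: "carrier quotient = residue ` carrier (poly_ring d)"
  by (auto simp: quotient_def graded_quotient_def module_quotient_def module.defs graded_module.defs
      A_RCOSETS_def' a_r_coset_residue) (auto simp: poly_graded_module_def)

lemma zero_quotient: "\<zero>\<^bsub>quotient\<^esub> = residue 0"
  by (auto simp: quotient_def graded_quotient_def module_quotient_def module.defs graded_module.defs
      residue_def)

lemma add_quotient: "residue p \<oplus>\<^bsub>quotient\<^esub> residue q = residue (p + q)"
proof -
  have "residue p \<oplus>\<^bsub>quotient\<^esub> residue q = {x + y | x y. x \<in> residue p \<and> y \<in> residue q}"
    by (auto simp: quotient_def graded_quotient_def module_quotient_def module.defs graded_module.defs
        set_add_def' poly_graded_module_def)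
  also have "\<dots> = residue (p + q)"
  proof (intro equalityI subsetI)
    fix z assume "z \<in> {x + y | x y. x \<in> residue p \<and> y \<in> residue q}"
    then obtain x y where z: "z = x + y" "x \<in> residue p" "y \<in> residue q" by blast
    then have "(x - p) + (y - q) \<in> monomial_span E"
      by (intro monomial_span_closed(2)) (auto simp: in_residue_iff residue_eq_iff)
    then show "z \<in> residue (p + q)" by (simp add: z in_residue_iff residue_eq_iff algebra_simps)
  next
    fix z assume "z \<in> residue (p + q)"
    then have "z - q \<in> residue p" by (simp add: in_residue_iff residue_eq_iff algebra_simps)
    then show "z \<in> {x + y | x y. x \<in> residue p \<and> y \<in> residue q}"
      using residue_self[of q] by (metis (mono_tags, lifting) diff_add_cancel mem_Collect_eq)
  qed
  finally show ?thesis .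
qed

lemma smult_quotient:
  assumes "a \<in> carrier (poly_ring d)" shows "a \<odot>\<^bsub>quotient\<^esub> residue p = residue (a * p)"
proof -
  have "a \<odot>\<^bsub>quotient\<^esub> residue p = (\<Union>x\<in>residue p. residue (a * x))"
    by (simp add: quotient_def graded_quotient_def module_quotient_def module.defs graded_module.defs
        a_r_coset_residue) (simp add: poly_graded_module_def)
  also have "\<dots> = (\<Union>x\<in>residue p. residue (a * p))"
  proof (rule SUP_cong[OF refl])
    fix x assume "x \<in> residue p"
    then have "a * (x - p) \<in> monomial_span E"
      using assms by (intro monomial_span_mult) (auto simp: in_residue_iff residue_eq_iff)
    then show "residue (a * x) = residue (a * p)" by (simp add: residue_eq_iff right_diff_distrib)
  qed
  also have "\<dots> = residue (a * p)" using residue_self[of p] by auto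
  finally show ?thesis .
qed

lemma grade_quotient:
  "grade quotient j = residue ` {p \<in> carrier (poly_ring d). \<forall>m \<in> Poly_Mapping.keys p. int (total_degree m) = j}"
  by (simp add: quotient_def graded_quotient_def module_quotient_def module.defs graded_module.defs
        a_r_coset_residue) (simp add: poly_graded_module_def)


subsection \<open>Coefficients of fractions\<close>

text \<open>The coefficient of \<open>p / x_F^s\<close> at \<open>x^a\<close>. It is set to zero where \<open>x^a\<close> itself is zero in
  the localization of \<open>R/J\<close>, which makes it independent of the representing fraction.\<close>

definition local_coef :: "nat set \<Rightarrow> 'k::field mpoly \<Rightarrow> nat \<Rightarrow> (nat \<Rightarrow> int) \<Rightarrow> 'k" where
  "local_coef F p s a = (if a \<in> local_exps F then 0 else zcoef p (shift F (int s) a))"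

definition frac :: "nat set \<Rightarrow> 'k::field mpoly \<Rightarrow> nat \<Rightarrow> ('k mpoly set \<times> nat) set" where
  "frac F p s = loc_frac (poly_ring d) quotient (var_prod F) (residue p) s"

text \<open>Membership in a monomial ideal is tested one monomial at a time, and the monomials that become
  zero in the localization do so after multiplication by a large enough power of \<open>x_F\<close>.\<close>

lemma frac_rel_iff:
  assumes F: "F \<subseteq> {1..d}" and p: "p \<in> carrier (poly_ring d)" and q: "q \<in> carrier (poly_ring d)"
  shows "((residue p, s), (residue q, s')) \<in> frac_rel (poly_ring d) quotient (var_prod F)
     \<longleftrightarrow> local_coef F p s = local_coef F q s'"
proof -
  have fin: "finite F" by (rule finite_subset[OF F]) simp
  have at_t: "((var_prod F [^]\<^bsub>poly_ring d\<^esub> (t + s')) \<odot>\<^bsub>quotient\<^esub> residue p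
        = (var_prod F [^]\<^bsub>poly_ring d\<^esub> (t + s)) \<odot>\<^bsub>quotient\<^esub> residue q)
     \<longleftrightarrow> (\<forall>a. shift F (int (t + s + s')) a \<notin> zexp ` E \<longrightarrow>
            zcoef p (shift F (int s) a) = zcoef q (shift F (int s') a))" (is "?eq \<longleftrightarrow> ?all") for t
  proof -
    have "?eq \<longleftrightarrow> var_prod F ^ (t + s') * p - var_prod F ^ (t + s) * q \<in> monomial_span E"
      by (simp add: poly_ring_nat_pow smult_quotient var_prod_power_in_carrier[OF F] residue_eq_iff)
    also have "\<dots> \<longleftrightarrow> (\<forall>b. b \<notin> zexp ` E \<longrightarrow>
        zcoef p (shift F (- int (t + s')) b) = zcoef q (shift F (- int (t + s)) b))"
      by (simp only: monomial_span_iff zcoef_linear zcoef_var_prod_mult[OF fin] right_minus_eq)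
    also have "\<dots> \<longleftrightarrow> ?all"
    proof
      assume L: "\<forall>b. b \<notin> zexp ` E \<longrightarrow>
        zcoef p (shift F (- int (t + s')) b) = zcoef q (shift F (- int (t + s)) b)"
      show ?all
      proof (intro allI impI)
        fix a assume "shift F (int (t + s + s')) a \<notin> zexp ` E"
        with L[rule_format, OF this] show "zcoef p (shift F (int s) a) = zcoef q (shift F (int s') a)"
          by simp
      qed
    next
      assume R: ?all
      show "\<forall>b. b \<notin> zexp ` E \<longrightarrow>
        zcoef p (shift F (- int (t + s')) b) = zcoef q (shift F (- int (t + s)) b)"
      proof (intro allI impI)
        fix b assume "b \<notin> zexp ` E"
        then show "zcoef p (shift F (- int (t + s')) b) = zcoef q (shift F (- int (t + s)) b)"
          using R[rule_format, of "shift F (- int (t + s + s')) b"] by simp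
      qed
    qed
    finally show ?thesis .
  qed
  have "((residue p, s), (residue q, s')) \<in> frac_rel (poly_ring d) quotient (var_prod F) \<longleftrightarrow>
     (\<exists>t. \<forall>a. shift F (int (t + s + s')) a \<notin> zexp ` E \<longrightarrow>
            zcoef p (shift F (int s) a) = zcoef q (shift F (int s') a))"
    using p q unfolding at_t[symmetric] by (simp add: frac_rel_def carrier_quotient)
  also have "\<dots> \<longleftrightarrow> local_coef F p s = local_coef F q s'"
  proof
    assume "\<exists>t. \<forall>a. shift F (int (t + s + s')) a \<notin> zexp ` E \<longrightarrow>
            zcoef p (shift F (int s) a) = zcoef q (shift F (int s') a)"
    then obtain t where t: "\<And>a. shift F (int (t + s + s')) a \<notin> zexp ` E \<Longrightarrow>
            zcoef p (shift F (int s) a) = zcoef q (shift F (int s') a)" by blast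
    show "local_coef F p s = local_coef F q s'"
    proof
      fix a
      have "zcoef p (shift F (int s) a) = zcoef q (shift F (int s') a)" if "a \<notin> local_exps F"
        by (rule t) (use that in \<open>unfold local_exps_def, blast\<close>)
      then show "local_coef F p s a = local_coef F q s' a" by (simp add: local_coef_def)
    qed
  next
    assume eq: "local_coef F p s = local_coef F q s'"
    \<comment> \<open>Outside \<open>S\<close> both coefficients vanish, so one exponent \<open>T\<close> of the denominator serves
      for all multidegrees at once.\<close>
    define S where "S = {a. zcoef p (shift F (int s) a) \<noteq> 0} \<union> {a. zcoef q (shift F (int s') a) \<noteq> 0}"
    have inj: "inj (shift F k)" for k
      by (rule inj_on_inverseI[of _ "shift F (- k)"]) simp
    have finS: "finite S"
      using finite_vimageI[OF finite_zcoef[of p] inj[of "int s"]]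
        finite_vimageI[OF finite_zcoef[of q] inj[of "int s'"]]
      unfolding S_def vimage_def by simp
    have "\<forall>a\<in>S \<inter> local_exps F. \<exists>t. shift F (int t) a \<in> zexp ` E" by (auto simp: local_exps_def)
    then obtain t where t: "\<And>a. a \<in> S \<inter> local_exps F \<Longrightarrow> shift F (int (t a)) a \<in> zexp ` E" by metis
    define T where "T = (\<Sum>a\<in>S \<inter> local_exps F. t a)"
    have tT: "t a \<le> T" if "a \<in> S \<inter> local_exps F" for a
      unfolding T_def using that finS by (intro member_le_sum) auto
    have "zcoef p (shift F (int s) a) = zcoef q (shift F (int s') a)"
      if a: "shift F (int (T + s + s')) a \<notin> zexp ` E" for a
    proof (cases "a \<in> local_exps F")
      case True
      have "a \<notin> S"
      proof
        assume "a \<in> S"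
        with True have aS: "a \<in> S \<inter> local_exps F" by simp
        have "shift F (int (T + s + s')) a \<in> zexp ` E"
          by (rule shift_in_zexp_mono[OF F t[OF aS]]) (use tT[OF aS] in simp)
        with a show False ..
      qed
      then show ?thesis by (simp add: S_def)
    next
      case False
      then show ?thesis using fun_cong[OF eq, of a] by (simp add: local_coef_def)
    qed
    then show "\<exists>t. \<forall>a. shift F (int (t + s + s')) a \<notin> zexp ` E \<longrightarrow>
            zcoef p (shift F (int s) a) = zcoef q (shift F (int s') a)" by blast
  qed
  finally show ?thesis .
qed

lemma frac_eq:
  assumes F: "F \<subseteq> {1..d}" and p: "p \<in> carrier (poly_ring d)"
  shows "frac F p s = {(residue q, s') | q s'. q \<in> carrier (poly_ring d) \<and> local_coef F q s' = local_coef F p s}"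
proof (intro equalityI subsetI)
  fix x assume "x \<in> frac F p s"
  then have x: "((residue p, s), x) \<in> frac_rel (poly_ring d) quotient (var_prod F)"
    by (simp add: frac_def loc_frac_def)
  then have "fst x \<in> carrier quotient" by (auto simp: frac_rel_def)
  then obtain q where q: "q \<in> carrier (poly_ring d)" "x = (residue q, snd x)"
    unfolding carrier_quotient by (metis imageE prod.collapse)
  from x q(2) have "((residue p, s), (residue q, snd x)) \<in> frac_rel (poly_ring d) quotient (var_prod F)"
    by simp
  then have "local_coef F q (snd x) = local_coef F p s" unfolding frac_rel_iff[OF F p q(1)] ..
  with q show "x \<in> {(residue q, s') | q s'. q \<in> carrier (poly_ring d) \<and> local_coef F q s' = local_coef F p s}"
    by blast
next
  fix x assume "x \<in> {(residue q, s') | q s'. q \<in> carrier (poly_ring d) \<and> local_coef F q s' = local_coef F p s}"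
  then obtain q s' where "x = (residue q, s')" "q \<in> carrier (poly_ring d)" "local_coef F q s' = local_coef F p s"
    by blast
  then show "x \<in> frac F p s" using frac_rel_iff[OF F p] by (simp add: frac_def loc_frac_def)
qed

lemma frac_eq_iff:
  assumes "F \<subseteq> {1..d}" and "p \<in> carrier (poly_ring d)" "q \<in> carrier (poly_ring d)"
  shows "frac F p s = frac F q s' \<longleftrightarrow> local_coef F p s = local_coef F q s'"
proof
  assume *: "frac F p s = frac F q s'"
  have "(residue p, s) \<in> frac F p s" unfolding frac_eq[OF assms(1,2)] using assms by blast
  then have "((residue q, s'), (residue p, s)) \<in> frac_rel (poly_ring d) quotient (var_prod F)"
    unfolding * by (simp add: frac_def loc_frac_def)
  then show "local_coef F p s = local_coef F q s'" using frac_rel_iff[OF assms(1,3,2)] by simp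
next
  assume "local_coef F p s = local_coef F q s'"
  then show "frac F p s = frac F q s'" using assms by (simp add: frac_eq)
qed

text \<open>The choice of the representing fraction is immaterial by \<open>frac_eq_iff\<close>.\<close>

definition coef :: "nat set \<Rightarrow> ('k::field mpoly set \<times> nat) set \<Rightarrow> (nat \<Rightarrow> int) \<Rightarrow> 'k" where
  "coef F X = (case SOME ps. fst ps \<in> carrier (poly_ring d) \<and> X = frac F (fst ps) (snd ps) of
                 (p, s) \<Rightarrow> local_coef F p s)"

lemma coef_frac:
  assumes F: "F \<subseteq> {1..d}" and p: "p \<in> carrier (poly_ring d)"
  shows "coef F (frac F p s) = local_coef F p s"
proof -
  define ps where "ps = (SOME ps. fst ps \<in> carrier (poly_ring d) \<and> frac F p s = frac F (fst ps) (snd ps))"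
  have "fst ps \<in> carrier (poly_ring d) \<and> frac F p s = frac F (fst ps) (snd ps)"
    unfolding ps_def by (rule someI[of _ "(p, s)"]) (simp add: p)
  then have "local_coef F (fst ps) (snd ps) = local_coef F p s"
    using frac_eq_iff[OF F p, of "fst ps" s "snd ps"] by simp
  then show ?thesis by (simp add: coef_def ps_def[symmetric] case_prod_unfold)
qed

lemma carrier_cech_loc: "carrier (cech_loc d quotient F) = {frac F p s | p s. p \<in> carrier (poly_ring d)}"
  by (auto simp: cech_loc_def localization_def frac_def carrier_quotient)

lemma fracE:
  assumes "X \<in> carrier (cech_loc d quotient F)"
  obtains p s where "p \<in> carrier (poly_ring d)" "X = frac F p s"
  using assms unfolding carrier_cech_loc by blast

lemma coef_inj:
  assumes F: "F \<subseteq> {1..d}" and X: "X \<in> carrier (cech_loc d quotient F)" and Y: "Y \<in> carrier (cech_loc d quotient F)"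
    and "\<And>a. coef F X a = coef F Y a"
  shows "X = Y"
proof -
  obtain p s where p: "p \<in> carrier (poly_ring d)" "X = frac F p s" using X by (rule fracE)
  obtain q s' where q: "q \<in> carrier (poly_ring d)" "Y = frac F q s'" using Y by (rule fracE)
  have "coef F X = coef F Y" using assms(4) by (rule ext)
  then show ?thesis
    unfolding p(2) q(2) coef_frac[OF F p(1)] coef_frac[OF F q(1)] frac_eq_iff[OF F p(1) q(1)] .
qed

lemma local_coef_scale:
  assumes "F \<subseteq> {1..d}"
  shows "local_coef F (var_prod F ^ t * p) (t + s) a = local_coef F p s a"
    "local_coef F (var_prod F ^ t * p) (s + t) a = local_coef F p s a"
proof -
  have "finite F" by (rule finite_subset[OF assms]) simp
  then show "local_coef F (var_prod F ^ t * p) (t + s) a = local_coef F p s a"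
    "local_coef F (var_prod F ^ t * p) (s + t) a = local_coef F p s a"
    by (simp_all add: local_coef_def zcoef_var_prod_mult)
qed

lemma local_coef_add: "local_coef F (p + q) s a = local_coef F p s a + local_coef F q s a"
  by (simp add: local_coef_def)

lemma poly_ring_closed:
  "p \<in> carrier (poly_ring d) \<Longrightarrow> q \<in> carrier (poly_ring d) \<Longrightarrow> p + q \<in> carrier (poly_ring d)"
  "p \<in> carrier (poly_ring d) \<Longrightarrow> q \<in> carrier (poly_ring d) \<Longrightarrow> p * q \<in> carrier (poly_ring d)"
  using cring.cring_simprules(1,5)[OF poly_ring_cring, of p d q] by (simp_all add: poly_ring_simps)

lemma add_cech_loc:
  assumes F: "F \<subseteq> {1..d}" and p: "p \<in> carrier (poly_ring d)" and q: "q \<in> carrier (poly_ring d)"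
  shows "frac F p s \<oplus>\<^bsub>cech_loc d quotient F\<^esub> frac F q s' = frac F (var_prod F ^ s' * p + var_prod F ^ s * q) (s + s')"
proof -
  have step: "loc_frac (poly_ring d) quotient (var_prod F)
      (((var_prod F [^]\<^bsub>poly_ring d\<^esub> t') \<odot>\<^bsub>quotient\<^esub> m) \<oplus>\<^bsub>quotient\<^esub>
       ((var_prod F [^]\<^bsub>poly_ring d\<^esub> t) \<odot>\<^bsub>quotient\<^esub> m')) (t + t')
      = frac F (var_prod F ^ s' * p + var_prod F ^ s * q) (s + s')"
    if mem: "(m, t) \<in> frac F p s" "(m', t') \<in> frac F q s'" for m t m' t'
  proof -
    obtain p' where p': "m = residue p'" "p' \<in> carrier (poly_ring d)" "local_coef F p' t = local_coef F p s"
      using mem(1) unfolding frac_eq[OF F p] by blast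
    obtain q' where q': "m' = residue q'" "q' \<in> carrier (poly_ring d)" "local_coef F q' t' = local_coef F q s'"
      using mem(2) unfolding frac_eq[OF F q] by blast
    have "local_coef F (var_prod F ^ t' * p' + var_prod F ^ t * q') (t + t')
        = local_coef F (var_prod F ^ s' * p + var_prod F ^ s * q) (s + s')"
      by (rule ext) (simp add: local_coef_add local_coef_scale[OF F] p' q')
    then have "frac F (var_prod F ^ t' * p' + var_prod F ^ t * q') (t + t')
        = frac F (var_prod F ^ s' * p + var_prod F ^ s * q) (s + s')"
      using p q p' q' by (subst frac_eq_iff[OF F]) (auto intro!: poly_ring_closed var_prod_power_in_carrier F)
    then show ?thesis
      by (simp add: poly_ring_nat_pow smult_quotient var_prod_power_in_carrier[OF F] p'(1) q'(1)
          add_quotient frac_def[symmetric])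
  qed
  have "frac F p s \<noteq> {}" "frac F q s' \<noteq> {}"
    using p q by (auto simp: frac_eq[OF F])
  then show ?thesis
    using step by (force simp: cech_loc_def localization_def)
qed

lemma add_cech_loc_closed:
  assumes F: "F \<subseteq> {1..d}" and X: "X \<in> carrier (cech_loc d quotient F)" and Y: "Y \<in> carrier (cech_loc d quotient F)"
  shows "X \<oplus>\<^bsub>cech_loc d quotient F\<^esub> Y \<in> carrier (cech_loc d quotient F)"
    and "coef F (X \<oplus>\<^bsub>cech_loc d quotient F\<^esub> Y) a = coef F X a + coef F Y a"
proof -
  obtain p s where p: "p \<in> carrier (poly_ring d)" "X = frac F p s" using X by (rule fracE)
  obtain q s' where q: "q \<in> carrier (poly_ring d)" "Y = frac F q s'" using Y by (rule fracE)
  have r: "var_prod F ^ s' * p + var_prod F ^ s * q \<in> carrier (poly_ring d)"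
    using p q by (auto intro!: poly_ring_closed var_prod_power_in_carrier F)
  then show "X \<oplus>\<^bsub>cech_loc d quotient F\<^esub> Y \<in> carrier (cech_loc d quotient F)"
    unfolding p(2) q(2) add_cech_loc[OF F p(1) q(1)] unfolding carrier_cech_loc by blast
  show "coef F (X \<oplus>\<^bsub>cech_loc d quotient F\<^esub> Y) a = coef F X a + coef F Y a"
    unfolding p(2) q(2) add_cech_loc[OF F p(1) q(1)]
    by (simp add: coef_frac[OF F] r p(1) q(1) local_coef_add local_coef_scale[OF F])
qed

lemma zero_cech_loc: "\<zero>\<^bsub>cech_loc d quotient F\<^esub> = frac F 0 0"
  by (simp add: cech_loc_def localization_def frac_def zero_quotient)

lemma zero_in_poly_ring: "0 \<in> carrier (poly_ring d)"
  by (simp add: poly_ring_simps)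

lemma zero_cech_loc_closed:
  assumes F: "F \<subseteq> {1..d}"
  shows "\<zero>\<^bsub>cech_loc d quotient F\<^esub> \<in> carrier (cech_loc d quotient F)" "coef F \<zero>\<^bsub>cech_loc d quotient F\<^esub> a = 0"
  using zero_in_poly_ring by (auto simp: zero_cech_loc carrier_cech_loc)
    (simp add: coef_frac[OF F] local_coef_def zero_in_poly_ring)

lemma smult_cech_loc:
  assumes F: "F \<subseteq> {1..d}" and p: "p \<in> carrier (poly_ring d)" and q: "q \<in> carrier (poly_ring d)"
  shows "q \<odot>\<^bsub>cech_loc d quotient F\<^esub> frac F p s = frac F (q * p) s"
    and "local_coef F (q * p) s a = (if a \<in> local_exps F then 0 else
       \<Sum>m\<in>Poly_Mapping.keys q. Poly_Mapping.lookup q m * local_coef F p s (\<lambda>l. a l - zexp m l))"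
proof -
  have lc: "local_coef F (q * p) s a = (if a \<in> local_exps F then 0 else
       \<Sum>m\<in>Poly_Mapping.keys q. Poly_Mapping.lookup q m * local_coef F p s (\<lambda>l. a l - zexp m l))"
    for p s a
  proof (cases "a \<in> local_exps F")
    case False
    have "(\<lambda>l. a l - zexp m l) \<notin> local_exps F" if "m \<in> Poly_Mapping.keys q" for m
    proof
      assume "(\<lambda>l. a l - zexp m l) \<in> local_exps F"
      then have "(\<lambda>l. (a l - zexp m l) + zexp m l) \<in> local_exps F"
        by (rule local_exps_add) (use q that in \<open>auto simp: poly_ring_simps\<close>)
      then show False using False by simp
    qed
    moreover have "shift F (int s) (\<lambda>l. a l - zexp m l) = (\<lambda>l. shift F (int s) a l - zexp m l)" for m
      by (rule ext) (simp add: shift_def)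
    ultimately show ?thesis using False by (simp add: local_coef_def zcoef_mult)
  qed (simp add: local_coef_def)
  then show "local_coef F (q * p) s a = (if a \<in> local_exps F then 0 else
       \<Sum>m\<in>Poly_Mapping.keys q. Poly_Mapping.lookup q m * local_coef F p s (\<lambda>l. a l - zexp m l))" .
  have step: "loc_frac (poly_ring d) quotient (var_prod F) (q \<odot>\<^bsub>quotient\<^esub> m) t = frac F (q * p) s"
    if mem: "(m, t) \<in> frac F p s" for m t
  proof -
    obtain p' where p': "m = residue p'" "p' \<in> carrier (poly_ring d)" "local_coef F p' t = local_coef F p s"
      using mem(1) unfolding frac_eq[OF F p] by blast
    have "frac F (q * p') t = frac F (q * p) s"
      unfolding frac_eq_iff[OF F poly_ring_closed(2)[OF q p'(2)] poly_ring_closed(2)[OF q p]]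
      by (rule ext) (simp only: lc p'(3))
    then show ?thesis by (simp add: smult_quotient q p'(1) frac_def[symmetric])
  qed
  have "frac F p s \<noteq> {}" using p by (auto simp: frac_eq[OF F])
  then show "q \<odot>\<^bsub>cech_loc d quotient F\<^esub> frac F p s = frac F (q * p) s"
    using step by (force simp: cech_loc_def localization_def)
qed

lemma smult_cech_loc_closed:
  assumes F: "F \<subseteq> {1..d}" and X: "X \<in> carrier (cech_loc d quotient F)" and q: "q \<in> carrier (poly_ring d)"
  shows "q \<odot>\<^bsub>cech_loc d quotient F\<^esub> X \<in> carrier (cech_loc d quotient F)"
    and "coef F (q \<odot>\<^bsub>cech_loc d quotient F\<^esub> X) a = (if a \<in> local_exps F then 0 else
       \<Sum>m\<in>Poly_Mapping.keys q. Poly_Mapping.lookup q m * coef F X (\<lambda>l. a l - zexp m l))"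
proof -
  obtain p s where p: "p \<in> carrier (poly_ring d)" "X = frac F p s" using X by (rule fracE)
  have qp: "q * p \<in> carrier (poly_ring d)" by (rule poly_ring_closed(2)[OF q p(1)])
  then show "q \<odot>\<^bsub>cech_loc d quotient F\<^esub> X \<in> carrier (cech_loc d quotient F)"
    unfolding p(2) smult_cech_loc(1)[OF F p(1) q] unfolding carrier_cech_loc by blast
  show "coef F (q \<odot>\<^bsub>cech_loc d quotient F\<^esub> X) a = (if a \<in> local_exps F then 0 else
       \<Sum>m\<in>Poly_Mapping.keys q. Poly_Mapping.lookup q m * coef F X (\<lambda>l. a l - zexp m l))"
    unfolding p(2) smult_cech_loc(1)[OF F p(1) q] coef_frac[OF F qp] coef_frac[OF F p(1)]
    by (rule smult_cech_loc(2)[OF F p(1) q])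
qed

lemma loc_map_closed:
  assumes F: "insert j F \<subseteq> {1..d}" and j: "j \<notin> F" and X: "X \<in> carrier (cech_loc d quotient F)"
  shows "loc_map (poly_ring d) quotient (var_prod F) (var j) X \<in> carrier (cech_loc d quotient (insert j F))"
    and "coef (insert j F) (loc_map (poly_ring d) quotient (var_prod F) (var j) X) a
       = (if a \<in> local_exps (insert j F) then 0 else coef F X a)"
proof -
  have F': "F \<subseteq> {1..d}" using F by simp
  have fin: "finite F" by (rule finite_subset[OF F']) simp
  obtain p s where p: "p \<in> carrier (poly_ring d)" "X = frac F p s" using X by (rule fracE)
  have vj: "var j = var_prod {j}" by (simp add: var_prod_def)
  have j': "{j} \<subseteq> {1..d}" using F by simp
  have mono: "a \<notin> local_exps (insert j F) \<Longrightarrow> a \<notin> local_exps F" for a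
    using local_exps_mono[OF _ F, of F] by blast
  have lc: "local_coef (insert j F) (var_prod {j} ^ t * r) t a
      = (if a \<in> local_exps (insert j F) then 0 else local_coef F r t a)" for r t a
  proof -
    have "shift {j} (- int t) (shift (insert j F) (int t) a) = shift F (int t) a"
      by (rule ext) (use j in \<open>auto simp: shift_def\<close>)
    then show ?thesis using mono by (simp add: local_coef_def zcoef_var_prod_mult)
  qed
  have closed: "var_prod {j} ^ t * r \<in> carrier (poly_ring d)" if "r \<in> carrier (poly_ring d)" for r t
    by (rule poly_ring_closed(2)[OF var_prod_power_in_carrier[OF j'] that])
  have step: "loc_frac (poly_ring d) quotient (var_prod F \<otimes>\<^bsub>poly_ring d\<^esub> var j)
      ((var j [^]\<^bsub>poly_ring d\<^esub> t) \<odot>\<^bsub>quotient\<^esub> m) t = frac (insert j F) (var_prod {j} ^ s * p) s"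
    if mem: "(m, t) \<in> frac F p s" for m t
  proof -
    obtain p' where p': "m = residue p'" "p' \<in> carrier (poly_ring d)" "local_coef F p' t = local_coef F p s"
      using mem(1) unfolding frac_eq[OF F' p(1)] by blast
    have "frac (insert j F) (var_prod {j} ^ t * p') t = frac (insert j F) (var_prod {j} ^ s * p) s"
      unfolding frac_eq_iff[OF F closed[OF p'(2)] closed[OF p(1)]]
      by (rule ext) (simp only: lc p'(3))
    moreover have "var_prod F \<otimes>\<^bsub>poly_ring d\<^esub> var j = (var_prod (insert j F) :: 'a mpoly)"
      using fin j by (simp add: var_prod_def poly_ring_simps mult.commute)
    ultimately show ?thesis
      by (simp add: vj poly_ring_nat_pow smult_quotient var_prod_power_in_carrier[OF j'] p'(1) frac_def[symmetric])
  qed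
  have "frac F p s \<noteq> {}" using p by (auto simp: frac_eq[OF F'])
  then have eq: "loc_map (poly_ring d) quotient (var_prod F) (var j) X = frac (insert j F) (var_prod {j} ^ s * p) s"
    using step unfolding loc_map_def p(2) by force
  show "loc_map (poly_ring d) quotient (var_prod F) (var j) X \<in> carrier (cech_loc d quotient (insert j F))"
    unfolding eq carrier_cech_loc using closed[OF p(1)] by blast
  show "coef (insert j F) (loc_map (poly_ring d) quotient (var_prod F) (var j) X) a
       = (if a \<in> local_exps (insert j F) then 0 else coef F X a)"
    unfolding eq unfolding p(2) coef_frac[OF F closed[OF p(1)]] coef_frac[OF F' p(1)] lc ..
qed


subsection \<open>The multidegrees that occur in a localization\<close>

text \<open>The multidegrees \<open>a\<close> in which the localization of \<open>R/J\<close> at \<open>x_F\<close> is nonzero.\<close>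

definition local_support :: "nat set \<Rightarrow> (nat \<Rightarrow> int) set" where
  "local_support F = {a. a \<notin> local_exps F \<and> (\<forall>l. l \<notin> F \<longrightarrow> 0 \<le> a l) \<and> (\<forall>l. l \<notin> {1..d} \<longrightarrow> a l = 0)}"

lemma total_degree_exponents:
  "m \<in> exponents d \<Longrightarrow> int (total_degree m) = (\<Sum>l\<in>{1..d}. zexp m l)"
proof -
  assume "m \<in> exponents d"
  then have "total_degree m = (\<Sum>l\<in>{1..d}. Poly_Mapping.lookup m l)"
    unfolding total_degree_def exponents_def by (intro sum.mono_neutral_left) (auto simp: in_keys_iff)
  then show ?thesis by (simp add: zexp_def)
qed

lemma sum_shift:
  assumes "F \<subseteq> {1..d}"
  shows "(\<Sum>l\<in>{1..d}. shift F k a l) = (\<Sum>l\<in>{1..d}. a l) + k * int (card F)"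
proof -
  have "(\<Sum>l\<in>{1..d}. shift F k a l) = (\<Sum>l\<in>{1..d}. a l + (if l \<in> F then k else 0))"
    by (rule sum.cong) (auto simp: shift_def)
  also have "\<dots> = (\<Sum>l\<in>{1..d}. a l) + (\<Sum>l\<in>{1..d}. if l \<in> F then k else 0)"
    by (rule sum.distrib)
  also have "(\<Sum>l\<in>{1..d}. if l \<in> F then k else 0) = (\<Sum>l\<in>F. k)"
    using assms by (subst sum.inter_restrict[symmetric]) (auto simp: Int_absorb1)
  finally show ?thesis by (simp add: mult.commute)
qed

lemma coef_support:
  assumes F: "F \<subseteq> {1..d}" and X: "X \<in> carrier (cech_loc d quotient F)"
  shows "coef F X a \<noteq> 0 \<Longrightarrow> a \<in> local_support F" and "finite {a. coef F X a \<noteq> 0}"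
proof -
  obtain p s where p: "p \<in> carrier (poly_ring d)" "X = frac F p s" using X by (rule fracE)
  have c: "coef F X = local_coef F p s" unfolding p(2) by (rule coef_frac[OF F p(1)])
  show "a \<in> local_support F" if nz: "coef F X a \<noteq> 0"
  proof -
    have a: "a \<notin> local_exps F" "zcoef p (shift F (int s) a) \<noteq> 0"
      using nz by (auto simp: c local_coef_def split: if_splits)
    then obtain m where m: "m \<in> Poly_Mapping.keys p" "shift F (int s) a = zexp m" using zcoef_nonzero by blast
    have "m \<in> exponents d" using m p by (auto simp: poly_ring_simps)
    then have off: "zexp m l = 0" if "l \<notin> {1..d}" for l
      using that unfolding exponents_def by (auto simp: zexp_def in_keys_iff)
    have "0 \<le> a l" if "l \<notin> F" for l
      using fun_cong[OF m(2), of l] that by (simp add: shift_def zexp_def)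
    moreover have "a l = 0" if "l \<notin> {1..d}" for l
      using fun_cong[OF m(2), of l] off[OF that] that F by (auto simp: shift_def split: if_splits)
    ultimately show ?thesis using a by (simp add: local_support_def)
  qed
  have inj: "inj (shift F k)" for k
    by (rule inj_on_inverseI[of _ "shift F (- k)"]) simp
  have "finite {a. zcoef p (shift F (int s) a) \<noteq> 0}"
    using finite_vimageI[OF finite_zcoef[of p] inj[of "int s"]] by (simp add: vimage_def)
  then show "finite {a. coef F X a \<noteq> 0}"
    by (rule rev_finite_subset) (auto simp: c local_coef_def)
qed

text \<open>Finitely many prescribed multidegrees have a common denominator \<open>x_F^s\<close>. The last conclusion
  controls the degrees of the numerator.\<close>

lemma frac_with_coefficients:
  fixes v :: "(nat \<Rightarrow> int) \<Rightarrow> 'k::field"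
  assumes F: "F \<subseteq> {1..d}" and fin: "finite {a. v a \<noteq> 0}" and supp: "\<And>a. v a \<noteq> 0 \<Longrightarrow> a \<in> local_support F"
  obtains p s where "p \<in> carrier (poly_ring d)" "local_coef F p s = v"
    "\<And>m. m \<in> Poly_Mapping.keys p \<Longrightarrow> \<exists>a. v a \<noteq> 0 \<and> zexp m = shift F (int s) a"
proof -
  define S where "S = {a. v a \<noteq> 0}"
  have finF: "finite F" by (rule finite_subset[OF F]) simp
  define s where "s = (\<Sum>a\<in>S. \<Sum>l\<in>F. nat (- a l))"
  have s: "- a l \<le> int s" if "a \<in> S" "l \<in> F" for a l
  proof -
    have "nat (- a l) \<le> (\<Sum>l\<in>F. nat (- a l))" using that finF by (intro member_le_sum) auto
    also have "\<dots> \<le> s"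
      unfolding s_def using that fin S_def by (intro member_le_sum[of a S "\<lambda>a. \<Sum>l\<in>F. nat (- a l)"]) auto
    finally show ?thesis by linarith
  qed
  define e where "e a = (\<Sum>l\<in>{1..d}. Poly_Mapping.single l (nat (shift F (int s) a l)))" for a
  have ze: "zexp (e a) = shift F (int s) a" if "a \<in> S" for a
  proof
    fix l
    have a: "a \<in> local_support F" using that supp by (simp add: S_def)
    have "0 \<le> shift F (int s) a l"
      using a s[OF that, of l] by (auto simp: local_support_def shift_def)
    moreover have "shift F (int s) a l = 0" if "l \<notin> {1..d}"
      using a F that by (auto simp: local_support_def shift_def)
    ultimately show "zexp (e a) l = shift F (int s) a l"
      by (auto simp: zexp_def e_def lookup_sum lookup_single when_def)
  qed
  define p where "p = (\<Sum>a\<in>S. Poly_Mapping.single (e a) (v a))"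
  have ee: "e a \<in> exponents d" for a
    unfolding exponents_def e_def mem_Collect_eq by (rule keys_sum_subset) auto
  have shift_inj: "shift F (int s) a = shift F (int s) b \<longleftrightarrow> a = b" for a b
  proof
    assume "shift F (int s) a = shift F (int s) b"
    then have "shift F (- int s) (shift F (int s) a) = shift F (- int s) (shift F (int s) b)" by simp
    then show "a = b" by simp
  qed simp
  have "p \<in> carrier (poly_ring d)"
    unfolding poly_ring_simps p_def mem_Collect_eq by (rule keys_sum_subset) (use ee in auto)
  moreover have "local_coef F p s = v"
  proof
    fix a
    have "zcoef p (shift F (int s) a) = (\<Sum>b\<in>S. if shift F (int s) a = zexp (e b) then v b else 0)"
      by (simp add: p_def zcoef_sum zcoef_single)
    also have "\<dots> = (\<Sum>b\<in>S. if a = b then v b else 0)"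
      by (rule sum.cong) (auto simp: ze shift_inj)
    also have "\<dots> = v a" using fin by (auto simp: S_def)
    finally show "local_coef F p s a = v a"
      using supp[of a] by (auto simp: local_coef_def local_support_def)
  qed
  moreover have "\<exists>a. v a \<noteq> 0 \<and> zexp m = shift F (int s) a" if "m \<in> Poly_Mapping.keys p" for m
  proof -
    have "Poly_Mapping.keys p \<subseteq> e ` S"
      unfolding p_def by (rule keys_sum_subset) auto
    with that obtain a where "a \<in> S" "m = e a" by blast
    then show ?thesis using ze by (auto simp: S_def)
  qed
  ultimately show ?thesis by (rule that)
qed

lemma coef_surj:
  fixes v :: "(nat \<Rightarrow> int) \<Rightarrow> 'k::field"
  assumes F: "F \<subseteq> {1..d}" and fin: "finite {a. v a \<noteq> 0}" and supp: "\<And>a. v a \<noteq> 0 \<Longrightarrow> a \<in> local_support F"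
  shows "\<exists>X\<in>carrier (cech_loc d quotient F). coef F X = v"
proof -
  obtain p s where p: "p \<in> carrier (poly_ring d)" "local_coef F p s = v"
    by (rule frac_with_coefficients[OF F fin supp])
  then show ?thesis unfolding carrier_cech_loc using coef_frac[OF F p(1)] by blast
qed

lemma grade_cech_loc_iff:
  assumes F: "F \<subseteq> {1..d}"
  shows "X \<in> grade (cech_loc d quotient F) j \<longleftrightarrow>
    X \<in> carrier (cech_loc d quotient F) \<and> (\<forall>a. coef F X a \<noteq> 0 \<longrightarrow> (\<Sum>l\<in>{1..d}. a l) = j)"
proof -
  have gr: "grade (cech_loc d quotient F) j = {frac F p s | p s. p \<in> carrier (poly_ring d) \<and>
     (\<forall>m\<in>Poly_Mapping.keys p. int (total_degree m) = j + int s * int (card F))}"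
    by (auto simp: cech_loc_def localization_def frac_def grade_quotient)
  show ?thesis
  proof
    assume "X \<in> grade (cech_loc d quotient F) j"
    then obtain p s where p: "p \<in> carrier (poly_ring d)" "X = frac F p s"
      "\<forall>m\<in>Poly_Mapping.keys p. int (total_degree m) = j + int s * int (card F)"
      unfolding gr by blast
    have "(\<Sum>l\<in>{1..d}. a l) = j" if "coef F X a \<noteq> 0" for a
    proof -
      have "zcoef p (shift F (int s) a) \<noteq> 0"
        using that unfolding p(2) coef_frac[OF F p(1)] by (auto simp: local_coef_def split: if_splits)
      then obtain m where m: "m \<in> Poly_Mapping.keys p" "shift F (int s) a = zexp m" using zcoef_nonzero by blast
      have "m \<in> exponents d" using m p by (auto simp: poly_ring_simps)
      then have "int (total_degree m) = (\<Sum>l\<in>{1..d}. a l) + int s * int (card F)"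
        by (simp only: total_degree_exponents m(2)[symmetric] sum_shift[OF F])
      then show ?thesis using p(3) m(1) by simp
    qed
    then show "X \<in> carrier (cech_loc d quotient F) \<and> (\<forall>a. coef F X a \<noteq> 0 \<longrightarrow> (\<Sum>l\<in>{1..d}. a l) = j)"
      using p(1,2) unfolding carrier_cech_loc by blast
  next
    assume X: "X \<in> carrier (cech_loc d quotient F) \<and> (\<forall>a. coef F X a \<noteq> 0 \<longrightarrow> (\<Sum>l\<in>{1..d}. a l) = j)"
    obtain p s where p: "p \<in> carrier (poly_ring d)" "local_coef F p s = coef F X"
      "\<And>m. m \<in> Poly_Mapping.keys p \<Longrightarrow> \<exists>a. coef F X a \<noteq> 0 \<and> zexp m = shift F (int s) a"
      using coef_support[OF F] X by (rule_tac frac_with_coefficients[OF F, of "coef F X"]) blast+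
    have "X = frac F p s"
    proof (rule coef_inj[OF F])
      show "frac F p s \<in> carrier (cech_loc d quotient F)" unfolding carrier_cech_loc using p(1) by blast
      show "coef F X a = coef F (frac F p s) a" for a by (simp add: coef_frac[OF F p(1)] p(2))
    qed (use X in blast)
    moreover have "int (total_degree m) = j + int s * int (card F)" if m: "m \<in> Poly_Mapping.keys p" for m
    proof -
      obtain a where a: "coef F X a \<noteq> 0" "zexp m = shift F (int s) a" using p(3)[OF m] by blast
      have "m \<in> exponents d" using m p by (auto simp: poly_ring_simps)
      then have "int (total_degree m) = (\<Sum>l\<in>{1..d}. a l) + int s * int (card F)"
        by (simp only: total_degree_exponents a(2) sum_shift[OF F])
      then show ?thesis using a(1) X by simp
    qed
    ultimately show "X \<in> grade (cech_loc d quotient F) j" unfolding gr using p(1) by blast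
  qed
qed

lemma abelian_group_cech_loc:
  assumes F: "F \<subseteq> {1..d}"
  shows "abelian_group (cech_loc d quotient F :: ('k::field mpoly, ('k mpoly set \<times> nat) set) graded_module)"
proof (rule abelian_group_by_coordinates[where \<phi> = "coef F"])
  fix X :: "('k mpoly set \<times> nat) set" assume X: "X \<in> carrier (cech_loc d quotient F)"
  have "finite {a. - coef F X a \<noteq> 0}" using coef_support(2)[OF F X] by simp
  moreover have "\<And>a. - coef F X a \<noteq> 0 \<Longrightarrow> a \<in> local_support F" using coef_support(1)[OF F X] by simp
  ultimately obtain Y where "Y \<in> carrier (cech_loc d quotient F)" "coef F Y = (\<lambda>a. - coef F X a)"
    using coef_surj[OF F, of "\<lambda>a. - coef F X a"] by blast
  then show "\<exists>Y\<in>carrier (cech_loc d quotient F). \<forall>a. coef F Y a = - coef F X a"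
    by (intro bexI[of _ Y]) auto
qed (rule coef_inj[OF F] add_cech_loc_closed[OF F] zero_cech_loc_closed[OF F]; assumption)+

end


section \<open>The multigraded strands of the Cech complex\<close>

context exponent_ideal
begin

text \<open>The sets \<open>F\<close> that contribute to multidegree \<open>a\<close> of the Cech complex. All of them contain the
  negative coordinates of \<open>a\<close>, so a nonempty \<open>degree_complex a\<close> is a simplicial complex only if there
  are none.\<close>

definition degree_complex :: "(nat \<Rightarrow> int) \<Rightarrow> nat set set" where
  "degree_complex a = {F. F \<subseteq> {1..d} \<and> a \<in> local_support F}"

lemma degree_complex_finite: "F \<in> degree_complex a \<Longrightarrow> finite F"
  unfolding degree_complex_def using finite_subset[of F "{1..d}"] by simp

text \<open>The component of the cochain \<open>c\<close> in multidegree \<open>a\<close>, as a function of the face.\<close>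

definition strand :: "nat \<Rightarrow> (nat set \<Rightarrow> ('k::field mpoly set \<times> nat) set) \<Rightarrow> (nat \<Rightarrow> int) \<Rightarrow> nat set \<Rightarrow> 'k" where
  "strand p c a F = (if F \<in> cech_index d p then coef F (c F) a else 0)"

abbreviation cech :: "nat \<Rightarrow> ('k::field mpoly, nat set \<Rightarrow> ('k mpoly set \<times> nat) set) graded_module" where
  "cech p \<equiv> cech_module d quotient p"

lemma cech_indexD: "F \<in> cech_index d p \<Longrightarrow> F \<subseteq> {1..d}" "F \<in> cech_index d p \<Longrightarrow> card F = p"
  by (auto simp: cech_index_def)

lemma finite_cech_index: "finite (cech_index d p)"
  by (rule finite_subset[of _ "Pow {1..d}"]) (auto simp: cech_index_def)

lemma cech_carrierD: "c \<in> carrier (cech p) \<Longrightarrow> F \<in> cech_index d p \<Longrightarrow> c F \<in> carrier (cech_loc d quotient F)"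
  by (auto simp: cech_module_def)

lemma strand_inj:
  assumes c: "c \<in> carrier (cech p)" "c' \<in> carrier (cech p)" and eq: "\<And>a F. strand p c a F = strand p c' a F"
  shows "c = c'"
proof (rule PiE_ext)
  show "c \<in> (\<Pi>\<^sub>E F \<in> cech_index d p. carrier (cech_loc d quotient F))"
    "c' \<in> (\<Pi>\<^sub>E F \<in> cech_index d p. carrier (cech_loc d quotient F))"
    using c by (simp_all add: cech_module_def)
  fix F assume F: "F \<in> cech_index d p"
  show "c F = c' F"
  proof (rule coef_inj[OF cech_indexD(1)[OF F]])
    show "coef F (c F) a = coef F (c' F) a" for a
      using eq[of a F] F by (simp add: strand_def)
  qed (use cech_carrierD[OF _ F] c in auto)
qed

lemma strand_support:
  assumes "c \<in> carrier (cech p)" "strand p c a F \<noteq> 0" shows "F \<in> degree_complex a" "card F = p"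
proof -
  have F: "F \<in> cech_index d p" "coef F (c F) a \<noteq> 0" using assms(2) by (auto simp: strand_def split: if_splits)
  show "card F = p" by (rule cech_indexD(2)[OF F(1)])
  show "F \<in> degree_complex a"
    using coef_support(1)[OF cech_indexD(1)[OF F(1)] cech_carrierD[OF assms(1) F(1)] F(2)] cech_indexD(1)[OF F(1)]
    by (simp add: degree_complex_def)
qed

lemma finite_strand:
  assumes "c \<in> carrier (cech p)" shows "finite {a. \<exists>F. strand p c a F \<noteq> 0}"
proof (rule finite_subset)
  show "{a. \<exists>F. strand p c a F \<noteq> 0} \<subseteq> (\<Union>F\<in>cech_index d p. {a. coef F (c F) a \<noteq> 0})"
    by (auto simp: strand_def split: if_splits)
  show "finite (\<Union>F\<in>cech_index d p. {a. coef F (c F) a \<noteq> 0})"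
    using coef_support(2)[OF cech_indexD(1) cech_carrierD[OF assms]] finite_cech_index by auto
qed

lemma strand_surj:
  fixes u :: "(nat \<Rightarrow> int) \<Rightarrow> nat set \<Rightarrow> 'k::field"
  assumes supp: "\<And>a F. u a F \<noteq> 0 \<Longrightarrow> F \<in> degree_complex a \<and> card F = p"
    and fin: "finite {a. \<exists>F. u a F \<noteq> 0}"
  obtains c where "c \<in> carrier (cech p)" "strand p c = u"
proof -
  have "\<exists>X\<in>carrier (cech_loc d quotient F). coef F X = (\<lambda>a. u a F)" if F: "F \<in> cech_index d p" for F
  proof (rule coef_surj[OF cech_indexD(1)[OF F]])
    show "finite {a. u a F \<noteq> 0}" by (rule finite_subset[OF _ fin]) auto
    show "u a F \<noteq> 0 \<Longrightarrow> a \<in> local_support F" for a using supp[of a F] by (simp add: degree_complex_def)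
  qed
  then obtain X where X: "\<And>F. F \<in> cech_index d p \<Longrightarrow> X F \<in> carrier (cech_loc d quotient F)"
    "\<And>F. F \<in> cech_index d p \<Longrightarrow> coef F (X F) = (\<lambda>a. u a F)" by metis
  show ?thesis
  proof (rule that)
    show "restrict X (cech_index d p) \<in> carrier (cech p)" using X(1) by (auto simp: cech_module_def)
    show "strand p (restrict X (cech_index d p)) = u"
    proof (intro ext)
      fix a F
      show "strand p (restrict X (cech_index d p)) a F = u a F"
        using X(2)[of F] supp[of a F] by (auto simp: strand_def cech_index_def degree_complex_def)
    qed
  qed
qed

lemma add_cech:
  assumes "c \<in> carrier (cech p)" "c' \<in> carrier (cech p)"
  shows "c \<oplus>\<^bsub>cech p\<^esub> c' \<in> carrier (cech p)"
    and "strand p (c \<oplus>\<^bsub>cech p\<^esub> c') a F = strand p c a F + strand p c' a F"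
proof -
  have D: "c F \<oplus>\<^bsub>cech_loc d quotient F\<^esub> c' F \<in> carrier (cech_loc d quotient F)"
    "coef F (c F \<oplus>\<^bsub>cech_loc d quotient F\<^esub> c' F) a = coef F (c F) a + coef F (c' F) a"
    if F: "F \<in> cech_index d p" for F a
    by (rule add_cech_loc_closed[OF cech_indexD(1)[OF F] cech_carrierD[OF assms(1) F] cech_carrierD[OF assms(2) F]])+
  show "c \<oplus>\<^bsub>cech p\<^esub> c' \<in> carrier (cech p)"
    using D(1) by (auto simp: cech_module_def)
  show "strand p (c \<oplus>\<^bsub>cech p\<^esub> c') a F = strand p c a F + strand p c' a F"
    using D(2)[of F a] by (auto simp: strand_def cech_module_def)
qed

lemma zero_cech:
  "\<zero>\<^bsub>cech p\<^esub> \<in> carrier (cech p)" "strand p \<zero>\<^bsub>cech p\<^esub> a F = 0"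
  using zero_cech_loc_closed[OF cech_indexD(1)] by (auto simp: cech_module_def strand_def)

lemma smult_cech:
  assumes c: "c \<in> carrier (cech p)" and q: "q \<in> carrier (poly_ring d)"
  shows "q \<odot>\<^bsub>cech p\<^esub> c \<in> carrier (cech p)"
    and "strand p (q \<odot>\<^bsub>cech p\<^esub> c) a F = (if a \<in> local_exps F then 0 else
       \<Sum>m\<in>Poly_Mapping.keys q. Poly_Mapping.lookup q m * strand p c (\<lambda>l. a l - zexp m l) F)"
proof -
  have D: "q \<odot>\<^bsub>cech_loc d quotient F\<^esub> c F \<in> carrier (cech_loc d quotient F)"
    "coef F (q \<odot>\<^bsub>cech_loc d quotient F\<^esub> c F) a = (if a \<in> local_exps F then 0 else
       \<Sum>m\<in>Poly_Mapping.keys q. Poly_Mapping.lookup q m * coef F (c F) (\<lambda>l. a l - zexp m l))"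
    if F: "F \<in> cech_index d p" for F a
    by (rule smult_cech_loc_closed[OF cech_indexD(1)[OF F] cech_carrierD[OF c F] q])+
  show "q \<odot>\<^bsub>cech p\<^esub> c \<in> carrier (cech p)"
    using D(1) by (auto simp: cech_module_def)
  show "strand p (q \<odot>\<^bsub>cech p\<^esub> c) a F = (if a \<in> local_exps F then 0 else
       \<Sum>m\<in>Poly_Mapping.keys q. Poly_Mapping.lookup q m * strand p c (\<lambda>l. a l - zexp m l) F)"
    using D(2)[of F a] by (auto simp: strand_def cech_module_def)
qed

lemma finsum_cech_loc:
  fixes x :: "nat \<Rightarrow> ('k::field mpoly set \<times> nat) set"
  assumes F: "F \<subseteq> {1..d}" and "finite S" and x: "\<And>j. j \<in> S \<Longrightarrow> x j \<in> carrier (cech_loc d quotient F)"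
  shows "(\<Oplus>\<^bsub>cech_loc d quotient F\<^esub> j\<in>S. x j) \<in> carrier (cech_loc d quotient F) \<and>
     coef F (\<Oplus>\<^bsub>cech_loc d quotient F\<^esub> j\<in>S. x j) a = (\<Sum>j\<in>S. coef F (x j) a)"
proof -
  interpret L: abelian_group "cech_loc d quotient F :: ('k mpoly, ('k mpoly set \<times> nat) set) graded_module"
    by (rule abelian_group_cech_loc[OF F])
  show ?thesis using assms(2,3)
  proof (induction S rule: finite_induct)
    case empty
    then show ?case using zero_cech_loc_closed[OF F] by simp
  next
    case (insert j S)
    then have "x \<in> S \<rightarrow> carrier (cech_loc d quotient F)" "x j \<in> carrier (cech_loc d quotient F)" by auto
    moreover from this insert have "(\<Oplus>\<^bsub>cech_loc d quotient F\<^esub> j\<in>S. x j) \<in> carrier (cech_loc d quotient F)" by simp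
    ultimately show ?case
      using insert by (simp add: L.finsum_insert add_cech_loc_closed[OF F])
  qed
qed

lemma position_sign_mpoly:
  "(position_sign j F :: 'k::field mpoly) = Poly_Mapping.single 0 (position_sign j F)"
proof -
  have "(- 1 :: 'k mpoly) ^ n = Poly_Mapping.single 0 ((- 1) ^ n)" for n
    by (induction n) (auto simp: single_uminus)
  then show ?thesis by (simp add: position_sign_def)
qed

lemma position_sign_nonzero: "position_sign j F \<noteq> (0 :: 'k::field)"
  by (simp add: position_sign_def)

lemma cech_diff_coef:
  fixes c :: "nat set \<Rightarrow> ('k::field mpoly set \<times> nat) set"
  assumes c: "c \<in> carrier (cech p)" and F: "F \<in> cech_index d (Suc p)"
  shows "cech_diff d quotient p c F \<in> carrier (cech_loc d quotient F)"
    and "coef F (cech_diff d quotient p c F) a = (if a \<in> local_exps F then 0 else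
       \<Sum>j\<in>F. position_sign j F * strand p c a (F - {j}))"
proof -
  define x where "x j = position_sign j F \<odot>\<^bsub>cech_loc d quotient F\<^esub>
            loc_map (poly_ring d) quotient (var_prod (F - {j})) (var j) (c (F - {j}))" for j
  have Fd: "F \<subseteq> {1..d}" by (rule cech_indexD(1)[OF F])
  have finF: "finite F" by (rule finite_subset[OF Fd]) simp
  have ps: "(position_sign j F :: 'k mpoly) \<in> carrier (poly_ring d)" for j
    by (simp add: position_sign_mpoly poly_ring_simps exponents_zero)
  have x: "x j \<in> carrier (cech_loc d quotient F)"
    "coef F (x j) a = (if a \<in> local_exps F then 0 else position_sign j F * strand p c a (F - {j}))"
    if j: "j \<in> F" for j
  proof -
    have ins: "insert j (F - {j}) = F" using j by blast
    have idx: "F - {j} \<in> cech_index d p" using F j finF by (auto simp: cech_index_def)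
    have L: "loc_map (poly_ring d) quotient (var_prod (F - {j})) (var j) (c (F - {j})) \<in> carrier (cech_loc d quotient F)"
      "coef F (loc_map (poly_ring d) quotient (var_prod (F - {j})) (var j) (c (F - {j}))) a
        = (if a \<in> local_exps F then 0 else coef (F - {j}) (c (F - {j})) a)"
      using loc_map_closed[of j "F - {j}" "c (F - {j})"] Fd cech_carrierD[OF c idx] unfolding ins by auto
    show "x j \<in> carrier (cech_loc d quotient F)"
      unfolding x_def by (rule smult_cech_loc_closed(1)[OF Fd L(1) ps])
    have z: "zexp 0 l = 0" for l by (simp add: zexp_def)
    show "coef F (x j) a = (if a \<in> local_exps F then 0 else position_sign j F * strand p c a (F - {j}))"
      unfolding x_def smult_cech_loc_closed(2)[OF Fd L(1) ps]
      by (simp add: position_sign_mpoly position_sign_nonzero z L(2) strand_def idx)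
  qed
  have eq: "cech_diff d quotient p c F = (\<Oplus>\<^bsub>cech_loc d quotient F\<^esub> j\<in>F. x j)"
    using F by (simp add: cech_diff_def x_def)
  note S = finsum_cech_loc[OF Fd finF, of x]
  show "cech_diff d quotient p c F \<in> carrier (cech_loc d quotient F)"
    unfolding eq using S x(1) by blast
  have "coef F (cech_diff d quotient p c F) a = (\<Sum>j\<in>F. coef F (x j) a)"
    unfolding eq using S x(1) by blast
  then show "coef F (cech_diff d quotient p c F) a = (if a \<in> local_exps F then 0 else
       \<Sum>j\<in>F. position_sign j F * strand p c a (F - {j}))"
    using x(2) by simp
qed

lemma cech_diff_closed:
  assumes "c \<in> carrier (cech p)" shows "cech_diff d quotient p c \<in> carrier (cech (Suc p))"
proof -
  have "cech_diff d quotient p c = restrict (cech_diff d quotient p c) (cech_index d (Suc p))"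
    unfolding cech_diff_def by simp
  then show ?thesis
    using cech_diff_coef(1)[OF assms] unfolding cech_module_def by (auto simp: PiE_iff extensional_def cech_diff_def)
qed

text \<open>In multidegree \<open>a\<close> every localization map between nonzero terms is the identity of the field, so
  only the signs remain.\<close>

lemma strand_cech_diff:
  assumes c: "c \<in> carrier (cech p)"
  shows "strand (Suc p) (cech_diff d quotient p c) a = codiff (degree_complex a) (strand p c a)"
proof
  fix F
  consider (other) "F \<notin> degree_complex a" | (size) "F \<in> degree_complex a" "card F \<noteq> Suc p"
    | (main) "F \<in> degree_complex a" "card F = Suc p" by blast
  then show "strand (Suc p) (cech_diff d quotient p c) a F = codiff (degree_complex a) (strand p c a) F"
  proof cases
    case other
    then show ?thesis
      using strand_support(1)[OF cech_diff_closed[OF c]] by (auto simp: codiff_def)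
  next
    case size
    have "strand p c a (F - {j}) = 0" if "j \<in> F" for j
    proof -
      have "card (F - {j}) \<noteq> p"
        using size card_Suc_Diff1[OF degree_complex_finite[OF size(1)] that] by auto
      then show ?thesis using strand_support(2)[OF c] by blast
    qed
    then show ?thesis
      using strand_support(2)[OF cech_diff_closed[OF c], of a F] size by (auto simp: codiff_def)
  next
    case main
    then have "F \<in> cech_index d (Suc p)" "a \<notin> local_exps F"
      by (auto simp: cech_index_def degree_complex_def local_support_def)
    then show ?thesis using main by (simp add: strand_def[of "Suc p"] cech_diff_coef(2)[OF c] codiff_def)
  qed
qed

lemma cech_diff_smult:
  assumes c: "c \<in> carrier (cech p)" and q: "q \<in> carrier (poly_ring d)"
  shows "cech_diff d quotient p (q \<odot>\<^bsub>cech p\<^esub> c) = q \<odot>\<^bsub>cech (Suc p)\<^esub> cech_diff d quotient p c"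
proof (rule strand_inj)
  note qc = smult_cech[OF c q] and dc = cech_diff_closed[OF c]
  show "cech_diff d quotient p (q \<odot>\<^bsub>cech p\<^esub> c) \<in> carrier (cech (Suc p))"
    by (rule cech_diff_closed[OF qc(1)])
  show "q \<odot>\<^bsub>cech (Suc p)\<^esub> cech_diff d quotient p c \<in> carrier (cech (Suc p))"
    by (rule smult_cech(1)[OF dc q])
  fix a F
  show "strand (Suc p) (cech_diff d quotient p (q \<odot>\<^bsub>cech p\<^esub> c)) a F
      = strand (Suc p) (q \<odot>\<^bsub>cech (Suc p)\<^esub> cech_diff d quotient p c) a F"
  proof (cases "F \<in> cech_index d (Suc p) \<and> a \<notin> local_exps F")
    case True
    then have F: "F \<in> cech_index d (Suc p)" and a: "a \<notin> local_exps F" by auto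
    have sub: "a \<notin> local_exps (F - {j})" for j
      using a local_exps_mono[of "F - {j}" F] cech_indexD(1)[OF F] by blast
    have am: "(\<lambda>l. a l - zexp m l) \<notin> local_exps F" if "m \<in> Poly_Mapping.keys q" for m
    proof
      assume "(\<lambda>l. a l - zexp m l) \<in> local_exps F"
      then have "(\<lambda>l. (a l - zexp m l) + zexp m l) \<in> local_exps F"
        by (rule local_exps_add) (use q that in \<open>auto simp: poly_ring_simps\<close>)
      then show False using a by simp
    qed
    have "strand (Suc p) (cech_diff d quotient p (q \<odot>\<^bsub>cech p\<^esub> c)) a F
       = (\<Sum>j\<in>F. \<Sum>m\<in>Poly_Mapping.keys q.
            Poly_Mapping.lookup q m * (position_sign j F * strand p c (\<lambda>l. a l - zexp m l) (F - {j})))"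
      using F a sub by (simp add: strand_def[of "Suc p"] cech_diff_coef(2)[OF qc(1)] qc(2)
          sum_distrib_left mult.left_commute)
    also have "\<dots> = (\<Sum>m\<in>Poly_Mapping.keys q. Poly_Mapping.lookup q m *
            (\<Sum>j\<in>F. position_sign j F * strand p c (\<lambda>l. a l - zexp m l) (F - {j})))"
      by (subst sum.swap) (simp add: sum_distrib_left)
    also have "\<dots> = strand (Suc p) (q \<odot>\<^bsub>cech (Suc p)\<^esub> cech_diff d quotient p c) a F"
      unfolding smult_cech(2)[OF dc q] using F a am
      by (auto simp: strand_def[of "Suc p"] cech_diff_coef(2)[OF c] intro!: sum.cong)
    finally show ?thesis .
  next
    case False
    then show ?thesis
      using cech_diff_coef(2)[OF qc(1)] smult_cech(2)[OF dc q] by (auto simp: strand_def[of "Suc p"])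
  qed
qed

lemma abelian_group_cech:
  "abelian_group (cech p :: ('k::field mpoly, nat set \<Rightarrow> ('k mpoly set \<times> nat) set) graded_module)"
proof (rule abelian_group_by_coordinates[where \<phi> = "\<lambda>c i. strand p c (fst i) (snd i)"])
  fix c :: "nat set \<Rightarrow> ('k mpoly set \<times> nat) set" assume c: "c \<in> carrier (cech p)"
  obtain c' where "c' \<in> carrier (cech p)" "strand p c' = (\<lambda>a F. - strand p c a F)"
    by (rule strand_surj[of "\<lambda>a F. - strand p c a F" p])
       (use strand_support[OF c] finite_strand[OF c] in auto)
  then show "\<exists>c'\<in>carrier (cech p). \<forall>i. strand p c' (fst i) (snd i) = - strand p c (fst i) (snd i)"
    by (intro bexI[of _ c']) auto
next
  fix c c' :: "nat set \<Rightarrow> ('k mpoly set \<times> nat) set"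
  assume "c \<in> carrier (cech p)" "c' \<in> carrier (cech p)"
    "\<And>i. strand p c (fst i) (snd i) = strand p c' (fst i) (snd i)"
  then show "c = c'" by (intro strand_inj[of c p c']) (metis fst_conv snd_conv)+
qed (simp_all add: add_cech zero_cech)

lemma strand_a_inv:
  fixes c :: "nat set \<Rightarrow> ('k::field mpoly set \<times> nat) set"
  assumes "c \<in> carrier (cech p)"
  shows "\<ominus>\<^bsub>cech p\<^esub> c \<in> carrier (cech p)" "strand p (\<ominus>\<^bsub>cech p\<^esub> c) a F = - strand p c a F"
proof -
  interpret G: abelian_group "cech p :: ('k mpoly, nat set \<Rightarrow> ('k mpoly set \<times> nat) set) graded_module"
    by (rule abelian_group_cech)
  show *: "\<ominus>\<^bsub>cech p\<^esub> c \<in> carrier (cech p)" using assms by simp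
  have "strand p (\<ominus>\<^bsub>cech p\<^esub> c \<oplus>\<^bsub>cech p\<^esub> c) a F = 0"
    using assms by (simp add: G.l_neg zero_cech)
  then show "strand p (\<ominus>\<^bsub>cech p\<^esub> c) a F = - strand p c a F"
    by (simp add: add_cech(2)[OF * assms] eq_neg_iff_add_eq_0)
qed


subsection \<open>Cocycles and coboundaries, degree by degree\<close>

lemma cocycle_iff:
  "c \<in> cech_cocycles d quotient p \<longleftrightarrow>
     c \<in> carrier (cech p) \<and> (\<forall>a. codiff (degree_complex a) (strand p c a) = (\<lambda>_. 0))"
proof -
  have "cech_diff d quotient p c = \<zero>\<^bsub>cech (Suc p)\<^esub> \<longleftrightarrow>
      (\<forall>a. codiff (degree_complex a) (strand p c a) = (\<lambda>_. 0))" if c: "c \<in> carrier (cech p)"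
  proof
    assume 0: "cech_diff d quotient p c = \<zero>\<^bsub>cech (Suc p)\<^esub>"
    show "\<forall>a. codiff (degree_complex a) (strand p c a) = (\<lambda>_. 0)"
      unfolding strand_cech_diff[OF c, symmetric] 0 by (intro allI ext) (rule zero_cech)
  next
    assume "\<forall>a. codiff (degree_complex a) (strand p c a) = (\<lambda>_. 0)"
    then show "cech_diff d quotient p c = \<zero>\<^bsub>cech (Suc p)\<^esub>"
      by (intro strand_inj[OF cech_diff_closed[OF c]])
         (auto simp: strand_cech_diff[OF c] zero_cech)
  qed
  then show ?thesis by (auto simp: cech_cocycles_def)
qed

text \<open>A preimage can be chosen in each multidegree separately. Taking it to be zero wherever \<open>c\<close> is
  zero keeps the support finite, so that the choices form a cochain.\<close>

lemma coboundary_iff: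
  "c \<in> cech_coboundaries d quotient p \<longleftrightarrow>
     c \<in> carrier (cech p) \<and> (\<forall>a. is_coboundary (degree_complex a) p (strand p c a))"
proof (cases p)
  case 0
  have triv: "is_coboundary D 0 u \<longleftrightarrow> u = (\<lambda>_. 0)" for D and u :: "nat set \<Rightarrow> 'a"
    by (auto simp: is_coboundary_def codiff_def fun_eq_iff)
  have "c = \<zero>\<^bsub>cech 0\<^esub>" if "c \<in> carrier (cech 0)" "\<forall>a. strand 0 c a = (\<lambda>_. 0)"
    by (rule strand_inj[OF that(1)]) (simp_all add: zero_cech that(2))
  moreover have "strand 0 \<zero>\<^bsub>cech 0\<^esub> a = (\<lambda>_. 0 :: 'a)" for a by (rule ext) (rule zero_cech)
  ultimately show ?thesis by (auto simp: 0 cech_coboundaries_def triv zero_cech)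
next
  case (Suc q)
  show ?thesis
  proof
    assume "c \<in> cech_coboundaries d quotient p"
    then obtain b where b: "b \<in> carrier (cech q)" "c = cech_diff d quotient q b"
      by (auto simp: cech_coboundaries_def Suc)
    have "is_coboundary (degree_complex a) p (strand p c a)" for a
      unfolding is_coboundary_def
      by (rule exI[of _ "strand q b a"]) (use b strand_support[OF b(1)] in \<open>auto simp: Suc strand_cech_diff\<close>)
    then show "c \<in> carrier (cech p) \<and> (\<forall>a. is_coboundary (degree_complex a) p (strand p c a))"
      using cech_diff_closed[OF b(1)] b(2) Suc by auto
  next
    assume c: "c \<in> carrier (cech p) \<and> (\<forall>a. is_coboundary (degree_complex a) p (strand p c a))"
    then obtain w where w: "\<And>a F. w a F \<noteq> 0 \<Longrightarrow> F \<in> degree_complex a \<and> Suc (card F) = p"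
      "\<And>a. codiff (degree_complex a) (w a) = strand p c a"
      unfolding is_coboundary_def by metis
    define w' where "w' a F = (if \<exists>G. strand p c a G \<noteq> 0 then w a F else 0)" for a F
    have "finite {a. \<exists>F. w' a F \<noteq> 0}"
      by (rule finite_subset[OF _ finite_strand[of c p]]) (use c in \<open>auto simp: w'_def\<close>)
    then obtain b where b: "b \<in> carrier (cech q)" "strand q b = w'"
      using w(1) by (rule_tac strand_surj[of w' q]) (auto simp: w'_def Suc split: if_splits)
    have "codiff (degree_complex a) (w' a) = strand p c a" for a
    proof (cases "\<exists>G. strand p c a G \<noteq> 0")
      case True
      then have "w' a = w a" by (intro ext) (auto simp: w'_def)
      then show ?thesis using w(2) by simp
    next
      case False
      then have "w' a = (\<lambda>_. 0)" "strand p c a = (\<lambda>_. 0)" by (auto simp: w'_def fun_eq_iff)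
      then show ?thesis by (simp add: codiff_def fun_eq_iff)
    qed
    then have "cech_diff d quotient q b = c"
      using c cech_diff_closed[OF b(1)] by (intro strand_inj[of _ p]) (auto simp: Suc strand_cech_diff[OF b(1)] b(2))
    then show "c \<in> cech_coboundaries d quotient p"
      using b(1) by (auto simp: cech_coboundaries_def Suc)
  qed
qed

lemma cocycles_closed:
  "\<zero>\<^bsub>cech p\<^esub> \<in> cech_cocycles d quotient p"
  "c \<in> cech_cocycles d quotient p \<Longrightarrow> c' \<in> cech_cocycles d quotient p \<Longrightarrow> c \<oplus>\<^bsub>cech p\<^esub> c' \<in> cech_cocycles d quotient p"
  "c \<in> cech_cocycles d quotient p \<Longrightarrow> \<ominus>\<^bsub>cech p\<^esub> c \<in> cech_cocycles d quotient p"
proof -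
  have z: "strand p \<zero>\<^bsub>cech p\<^esub> a = (\<lambda>_. 0 :: 'a)" for a by (rule ext) (rule zero_cech)
  show "\<zero>\<^bsub>cech p\<^esub> \<in> cech_cocycles d (quotient :: ('a mpoly, _) graded_module) p"
    by (simp add: cocycle_iff zero_cech(1) z) (simp add: codiff_def fun_eq_iff)
next
  assume c: "c \<in> cech_cocycles d quotient p" "c' \<in> cech_cocycles d quotient p"
  then have "strand p (c \<oplus>\<^bsub>cech p\<^esub> c') a = (\<lambda>F. strand p c a F + strand p c' a F)" for a
    by (intro ext add_cech(2)) (auto simp: cocycle_iff)
  then show "c \<oplus>\<^bsub>cech p\<^esub> c' \<in> cech_cocycles d quotient p"
    using c by (simp add: cocycle_iff add_cech(1) codiff_add)
next
  assume c: "c \<in> cech_cocycles d quotient p"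
  then have "strand p (\<ominus>\<^bsub>cech p\<^esub> c) a = (\<lambda>F. - strand p c a F)" for a
    by (intro ext strand_a_inv(2)) (auto simp: cocycle_iff)
  then show "\<ominus>\<^bsub>cech p\<^esub> c \<in> cech_cocycles d quotient p"
    using c by (simp add: cocycle_iff strand_a_inv(1) codiff_uminus)
qed

lemma coboundaries_closed:
  "\<zero>\<^bsub>cech p\<^esub> \<in> cech_coboundaries d quotient p"
  "c \<in> cech_coboundaries d quotient p \<Longrightarrow> c' \<in> cech_coboundaries d quotient p \<Longrightarrow> c \<oplus>\<^bsub>cech p\<^esub> c' \<in> cech_coboundaries d quotient p"
  "c \<in> cech_coboundaries d quotient p \<Longrightarrow> \<ominus>\<^bsub>cech p\<^esub> c \<in> cech_coboundaries d quotient p"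
proof -
  have z: "strand p \<zero>\<^bsub>cech p\<^esub> a = (\<lambda>_. 0 :: 'a)" for a by (rule ext) (rule zero_cech)
  show "\<zero>\<^bsub>cech p\<^esub> \<in> cech_coboundaries d (quotient :: ('a mpoly, _) graded_module) p"
    by (simp add: coboundary_iff zero_cech(1) z is_coboundary_zero)
next
  assume c: "c \<in> cech_coboundaries d quotient p" "c' \<in> cech_coboundaries d quotient p"
  then have "strand p (c \<oplus>\<^bsub>cech p\<^esub> c') a = (\<lambda>F. strand p c a F + strand p c' a F)" for a
    by (intro ext add_cech(2)) (auto simp: coboundary_iff)
  then show "c \<oplus>\<^bsub>cech p\<^esub> c' \<in> cech_coboundaries d quotient p"
    using c by (simp add: coboundary_iff add_cech(1) is_coboundary_add)
next
  assume c: "c \<in> cech_coboundaries d quotient p"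
  then have "strand p (\<ominus>\<^bsub>cech p\<^esub> c) a = (\<lambda>F. - strand p c a F)" for a
    by (intro ext strand_a_inv(2)) (auto simp: coboundary_iff)
  then show "\<ominus>\<^bsub>cech p\<^esub> c \<in> cech_coboundaries d quotient p"
    using c by (simp add: coboundary_iff strand_a_inv(1) is_coboundary_uminus)
qed

lemma smult_zero_cech:
  assumes q: "q \<in> carrier (poly_ring d)" shows "q \<odot>\<^bsub>cech p\<^esub> \<zero>\<^bsub>cech p\<^esub> = \<zero>\<^bsub>cech p\<^esub>"
  by (rule strand_inj[of _ p]) (simp_all add: smult_cech[OF zero_cech(1) q] zero_cech)

lemma smult_cocycle:
  assumes q: "q \<in> carrier (poly_ring d)" and c: "c \<in> cech_cocycles d quotient p"
  shows "q \<odot>\<^bsub>cech p\<^esub> c \<in> cech_cocycles d quotient p"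
  using c smult_cech(1)[OF _ q] cech_diff_smult[OF _ q] smult_zero_cech[OF q]
  by (auto simp: cech_cocycles_def)

lemma smult_coboundary:
  assumes q: "q \<in> carrier (poly_ring d)" and c: "c \<in> cech_coboundaries d quotient p"
  shows "q \<odot>\<^bsub>cech p\<^esub> c \<in> cech_coboundaries d quotient p"
proof (cases p)
  case 0
  then show ?thesis using c smult_zero_cech[OF q] by (simp add: cech_coboundaries_def)
next
  case (Suc r)
  then show ?thesis using c smult_cech(1)[OF _ q] by (auto simp: cech_coboundaries_def cech_diff_smult[OF _ q, symmetric])
qed

lemma smult_add_cech:
  assumes q: "q \<in> carrier (poly_ring d)" and c: "c \<in> carrier (cech p)" "c' \<in> carrier (cech p)"
  shows "q \<odot>\<^bsub>cech p\<^esub> (c \<oplus>\<^bsub>cech p\<^esub> c') = q \<odot>\<^bsub>cech p\<^esub> c \<oplus>\<^bsub>cech p\<^esub> q \<odot>\<^bsub>cech p\<^esub> c'"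
proof (rule strand_inj[of _ p])
  fix a F
  show "strand p (q \<odot>\<^bsub>cech p\<^esub> (c \<oplus>\<^bsub>cech p\<^esub> c')) a F = strand p (q \<odot>\<^bsub>cech p\<^esub> c \<oplus>\<^bsub>cech p\<^esub> q \<odot>\<^bsub>cech p\<^esub> c') a F"
    by (simp add: smult_cech[OF _ q] add_cech c distrib_left sum.distrib)
qed (simp_all add: smult_cech(1)[OF _ q] add_cech c)

end


section \<open>Local cohomology in a single multidegree\<close>

context exponent_ideal
begin

abbreviation cocycles :: "nat \<Rightarrow> (nat set \<Rightarrow> ('k::field mpoly set \<times> nat) set) set" where
  "cocycles i \<equiv> cech_cocycles d quotient i"

abbreviation coboundaries :: "nat \<Rightarrow> (nat set \<Rightarrow> ('k::field mpoly set \<times> nat) set) set" where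
  "coboundaries i \<equiv> cech_coboundaries d quotient i"

abbreviation cohomology :: "nat \<Rightarrow> ('k::field mpoly, (nat set \<Rightarrow> ('k mpoly set \<times> nat) set) set) graded_module" where
  "cohomology i \<equiv> local_cohomology d i quotient"

definition cohomology_class ::
    "nat \<Rightarrow> (nat set \<Rightarrow> ('k::field mpoly set \<times> nat) set) \<Rightarrow> (nat set \<Rightarrow> ('k mpoly set \<times> nat) set) set" where
  "cohomology_class i c = coboundaries i +>\<^bsub>cech i\<^esub> c"

lemma coboundaries_abelian_subgroup:
  "abelian_subgroup (coboundaries i) (cech i :: ('k::field mpoly, nat set \<Rightarrow> ('k mpoly set \<times> nat) set) graded_module)"
proof (rule abelian_subgroupI3)
  show G: "abelian_group (cech i :: ('k mpoly, nat set \<Rightarrow> ('k mpoly set \<times> nat) set) graded_module)"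
    by (rule abelian_group_cech)
  show "additive_subgroup (coboundaries i) (cech i :: ('k mpoly, nat set \<Rightarrow> ('k mpoly set \<times> nat) set) graded_module)"
  proof (rule additive_subgroupI, rule group.subgroupI)
    show "group (add_monoid (cech i :: ('k mpoly, nat set \<Rightarrow> ('k mpoly set \<times> nat) set) graded_module))"
      by (rule abelian_group.a_group[OF G])
    show "coboundaries i \<subseteq> carrier (add_monoid (cech i :: ('k mpoly, nat set \<Rightarrow> ('k mpoly set \<times> nat) set) graded_module))"
      by (auto simp: coboundary_iff)
    show "coboundaries i \<noteq> ({} :: (nat set \<Rightarrow> ('k mpoly set \<times> nat) set) set)"
      using coboundaries_closed(1) by blast
  qed (use coboundaries_closed(2,3)[of _ i] in \<open>simp_all add: a_inv_def\<close>)
qed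

lemma cohomology_class_self: "c \<in> cocycles i \<Longrightarrow> c \<in> cohomology_class i c"
  unfolding cohomology_class_def
  by (rule abelian_subgroup.a_rcos_self[OF coboundaries_abelian_subgroup]) (simp add: cocycle_iff)

lemma cohomology_classE:
  assumes "x \<in> cohomology_class i c"
  obtains b where "b \<in> coboundaries i" "x = b \<oplus>\<^bsub>cech i\<^esub> c"
  using assms unfolding cohomology_class_def a_r_coset_def' by blast

lemma cohomology_class_zero_iff:
  assumes "c \<in> cocycles i"
  shows "cohomology_class i c = coboundaries i \<longleftrightarrow> c \<in> coboundaries i"
  using abelian_subgroup.a_rcos_const[OF coboundaries_abelian_subgroup, of c i]
    cohomology_class_self[OF assms] unfolding cohomology_class_def by blast

lemma cohomology_class_zero: "cohomology_class i \<zero>\<^bsub>cech i\<^esub> = coboundaries i"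
  unfolding cohomology_class_zero_iff[OF cocycles_closed(1)] by (rule coboundaries_closed(1))

lemma carrier_cohomology: "carrier (cohomology i) = cohomology_class i ` cocycles i"
  by (auto simp: local_cohomology_def graded_quotient_def module_quotient_def module.defs graded_module.defs
      A_RCOSETS_def' cohomology_class_def a_r_coset_def')

lemma zero_cohomology: "\<zero>\<^bsub>cohomology i\<^esub> = coboundaries i"
  by (auto simp: local_cohomology_def graded_quotient_def module_quotient_def module.defs graded_module.defs)

lemma add_cohomology:
  assumes "c \<in> cocycles i" "c' \<in> cocycles i"
  shows "cohomology_class i c \<oplus>\<^bsub>cohomology i\<^esub> cohomology_class i c' = cohomology_class i (c \<oplus>\<^bsub>cech i\<^esub> c')"
proof -
  have "cohomology_class i c \<oplus>\<^bsub>cohomology i\<^esub> cohomology_class i c'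
      = cohomology_class i c <+>\<^bsub>cech i\<^esub> cohomology_class i c'"
    by (simp add: local_cohomology_def graded_quotient_def module_quotient_def module.defs graded_module.defs
        set_add_def')
  also have "\<dots> = cohomology_class i (c \<oplus>\<^bsub>cech i\<^esub> c')"
    using assms unfolding cohomology_class_def
    by (intro abelian_subgroup.a_rcos_sum[OF coboundaries_abelian_subgroup]) (simp_all add: cocycle_iff)
  finally show ?thesis .
qed

lemma smult_cohomology:
  assumes c: "c \<in> cocycles i" and q: "q \<in> carrier (poly_ring d)"
  shows "q \<odot>\<^bsub>cohomology i\<^esub> cohomology_class i c = cohomology_class i (q \<odot>\<^bsub>cech i\<^esub> c)"
proof -
  have cc: "c \<in> carrier (cech i)" using c by (simp add: cocycle_iff)
  have "q \<odot>\<^bsub>cohomology i\<^esub> cohomology_class i c = (\<Union>x\<in>cohomology_class i c. cohomology_class i (q \<odot>\<^bsub>cech i\<^esub> x))"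
    by (simp add: local_cohomology_def graded_quotient_def module_quotient_def module.defs graded_module.defs
        cohomology_class_def a_r_coset_def')
  also have "\<dots> = (\<Union>x\<in>cohomology_class i c. cohomology_class i (q \<odot>\<^bsub>cech i\<^esub> c))"
  proof (rule SUP_cong[OF refl])
    fix x assume "x \<in> cohomology_class i c"
    then obtain b where b: "b \<in> coboundaries i" "x = b \<oplus>\<^bsub>cech i\<^esub> c" by (rule cohomology_classE)
    have bc: "b \<in> carrier (cech i)" using b(1) by (simp add: coboundary_iff)
    have qb: "q \<odot>\<^bsub>cech i\<^esub> b \<in> coboundaries i" by (rule smult_coboundary[OF q b(1)])
    have "q \<odot>\<^bsub>cech i\<^esub> x = q \<odot>\<^bsub>cech i\<^esub> b \<oplus>\<^bsub>cech i\<^esub> q \<odot>\<^bsub>cech i\<^esub> c"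
      unfolding b(2) by (rule smult_add_cech[OF q bc cc])
    then have "q \<odot>\<^bsub>cech i\<^esub> x \<in> cohomology_class i (q \<odot>\<^bsub>cech i\<^esub> c)"
      using qb unfolding cohomology_class_def a_r_coset_def' by blast
    then show "cohomology_class i (q \<odot>\<^bsub>cech i\<^esub> x) = cohomology_class i (q \<odot>\<^bsub>cech i\<^esub> c)"
      unfolding cohomology_class_def
      by (rule abelian_subgroup.a_repr_independence'[OF coboundaries_abelian_subgroup, symmetric])
         (rule smult_cech(1)[OF cc q])
  qed
  also have "\<dots> = cohomology_class i (q \<odot>\<^bsub>cech i\<^esub> c)" using cohomology_class_self[OF c] by auto
  finally show ?thesis .
qed

lemma grade_cohomology: "grade (cohomology i) j = cohomology_class i ` (cocycles i \<inter> grade (cech i) j)"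
  by (simp add: local_cohomology_def graded_quotient_def module_quotient_def module.defs graded_module.defs
        cohomology_class_def a_r_coset_def')

lemma grade_cech_iff:
  assumes "c \<in> carrier (cech i)"
  shows "c \<in> grade (cech i) j \<longleftrightarrow> (\<forall>a F. strand i c a F \<noteq> 0 \<longrightarrow> (\<Sum>l\<in>{1..d}. a l) = j)"
proof -
  have ext: "c \<in> extensional (cech_index d i)" using assms by (auto simp: cech_module_def PiE_def)
  have "c \<in> grade (cech i) j \<longleftrightarrow> (\<forall>F\<in>cech_index d i. c F \<in> grade (cech_loc d quotient F) j)"
    using ext by (auto simp: cech_module_def PiE_iff)
  also have "\<dots> \<longleftrightarrow> (\<forall>F\<in>cech_index d i. \<forall>a. coef F (c F) a \<noteq> 0 \<longrightarrow> (\<Sum>l\<in>{1..d}. a l) = j)"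
    using cech_carrierD[OF assms] by (intro ball_cong refl) (simp add: grade_cech_loc_iff[OF cech_indexD(1)])
  also have "\<dots> \<longleftrightarrow> (\<forall>a F. strand i c a F \<noteq> 0 \<longrightarrow> (\<Sum>l\<in>{1..d}. a l) = j)"
    by (auto simp: strand_def split: if_splits)
  finally show ?thesis .
qed

text \<open>A class of degree \<open>j\<close> has components only in multidegrees of total degree \<open>j\<close>, and each of
  these is a coboundary.\<close>

lemma grade_cohomology_zero:
  assumes acyclic: "\<And>a. (\<Sum>l\<in>{1..d}. a l) = j \<Longrightarrow> acyclic_at TYPE('k::field) (degree_complex a) i"
  shows "grade (cohomology i) j = {\<zero>\<^bsub>cohomology i :: ('k mpoly, _) graded_module\<^esub>}"
proof -
  have "cohomology_class i c = coboundaries i"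
    if c: "c \<in> cocycles i" "c \<in> grade (cech i) j" for c :: "nat set \<Rightarrow> ('k mpoly set \<times> nat) set"
  proof -
    have cc: "c \<in> carrier (cech i)" and cyc: "\<And>a. codiff (degree_complex a) (strand i c a) = (\<lambda>_. 0)"
      using c(1) by (simp_all add: cocycle_iff)
    have "is_coboundary (degree_complex a) i (strand i c a)" for a
    proof (cases "(\<Sum>l\<in>{1..d}. a l) = j")
      case True
      then show ?thesis
        using acyclic[OF True] cyc strand_support[OF cc] unfolding acyclic_at_def by blast
    next
      case False
      then have "strand i c a = (\<lambda>_. 0)"
        using c(2) unfolding grade_cech_iff[OF cc] by blast
      then show ?thesis by (simp add: is_coboundary_zero)
    qed
    then have "c \<in> coboundaries i" using cc by (simp add: coboundary_iff)
    then show ?thesis using cohomology_class_zero_iff[OF c(1)] by blast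
  qed
  moreover have "\<zero>\<^bsub>cech i\<^esub> \<in> grade (cech i :: ('k mpoly, _) graded_module) j"
    by (simp add: grade_cech_iff[OF zero_cech(1)] zero_cech(2))
  ultimately show ?thesis
    using cocycles_closed(1)[of i] unfolding grade_cohomology zero_cohomology by blast
qed

text \<open>A cocycle on a single strand, extended by zero, represents a class in that multidegree.\<close>

lemma single_degree_cocycle:
  fixes u :: "nat set \<Rightarrow> 'k::field"
  assumes u: "\<forall>F. u F \<noteq> 0 \<longrightarrow> F \<in> degree_complex a \<and> card F = i" "codiff (degree_complex a) u = (\<lambda>_. 0)"
  obtains c where "c \<in> cocycles i" "strand i c = (\<lambda>b. if b = a then u else (\<lambda>_. 0))"
proof -
  let ?v = "\<lambda>b. if b = a then u else (\<lambda>_. 0)"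
  have "finite {b. \<exists>F. ?v b F \<noteq> 0}" by (rule finite_subset[of _ "{a}"]) (auto split: if_splits)
  then obtain c where c: "c \<in> carrier (cech i)" "strand i c = ?v"
    using u(1) by (rule_tac strand_surj[of ?v i]) (auto split: if_splits)
  have "codiff D (\<lambda>_. 0 :: 'k) = (\<lambda>_. 0)" for D by (simp add: codiff_def fun_eq_iff)
  then have "c \<in> cocycles i" using c u(2) by (simp add: cocycle_iff)
  then show ?thesis using c(2) by (rule that)
qed

lemma grade_cohomology_nonzero:
  assumes "\<not> acyclic_at TYPE('k::field) (degree_complex a) i"
  shows "grade (cohomology i) (\<Sum>l\<in>{1..d}. a l) \<noteq> {\<zero>\<^bsub>cohomology i :: ('k mpoly, _) graded_module\<^esub>}"
proof
  assume eq: "grade (cohomology i) (\<Sum>l\<in>{1..d}. a l) = {\<zero>\<^bsub>cohomology i :: ('k mpoly, _) graded_module\<^esub>}"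
  obtain u :: "nat set \<Rightarrow> 'k" where u: "\<forall>F. u F \<noteq> 0 \<longrightarrow> F \<in> degree_complex a \<and> card F = i"
    "codiff (degree_complex a) u = (\<lambda>_. 0)" "\<not> is_coboundary (degree_complex a) i u"
    using assms unfolding acyclic_at_def by blast
  obtain c where c: "c \<in> cocycles i" "strand i c = (\<lambda>b. if b = a then u else (\<lambda>_. 0))"
    by (rule single_degree_cocycle[OF u(1,2)])
  have "c \<in> grade (cech i) (\<Sum>l\<in>{1..d}. a l)"
    using c(1) by (subst grade_cech_iff) (auto simp: cocycle_iff c(2) split: if_splits)
  then have "cohomology_class i c \<in> grade (cohomology i) (\<Sum>l\<in>{1..d}. a l)"
    unfolding grade_cohomology using c(1) by blast
  then have "c \<in> coboundaries i"
    unfolding eq zero_cohomology using cohomology_class_zero_iff[OF c(1)] by blast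
  then have "is_coboundary (degree_complex a) i (strand i c a)" by (simp add: coboundary_iff)
  then show False using u(3) by (simp add: c(2))
qed


section \<open>Noetherian local cohomology vanishes in negative multidegrees\<close>

lemma group_cohomology: "group (add_monoid (cohomology i :: ('k::field mpoly, _) graded_module))"
proof (rule groupI)
  interpret G: abelian_group "cech i :: ('k mpoly, nat set \<Rightarrow> ('k mpoly set \<times> nat) set) graded_module"
    by (rule abelian_group_cech)
  have Z: "c \<in> carrier (cech i)" if "c \<in> cocycles i" for c :: "nat set \<Rightarrow> ('k mpoly set \<times> nat) set"
    using that by (simp add: cocycle_iff)
  have one: "\<one>\<^bsub>add_monoid (cohomology i)\<^esub> = cohomology_class i (\<zero>\<^bsub>cech i\<^esub> :: nat set \<Rightarrow> ('k mpoly set \<times> nat) set)"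
    by (simp add: zero_cohomology cohomology_class_zero)
  show "\<one>\<^bsub>add_monoid (cohomology i)\<^esub> \<in> carrier (add_monoid (cohomology i :: ('k mpoly, _) graded_module))"
    unfolding one by (simp add: carrier_cohomology cocycles_closed(1))
  show "x \<otimes>\<^bsub>add_monoid (cohomology i)\<^esub> y \<in> carrier (add_monoid (cohomology i :: ('k mpoly, _) graded_module))"
    if "x \<in> carrier (add_monoid (cohomology i :: ('k mpoly, _) graded_module))"
       "y \<in> carrier (add_monoid (cohomology i :: ('k mpoly, _) graded_module))" for x y
    using that by (auto simp: carrier_cohomology add_cohomology cocycles_closed(2))
  show "x \<otimes>\<^bsub>add_monoid (cohomology i)\<^esub> y \<otimes>\<^bsub>add_monoid (cohomology i)\<^esub> z
      = x \<otimes>\<^bsub>add_monoid (cohomology i)\<^esub> (y \<otimes>\<^bsub>add_monoid (cohomology i)\<^esub> z)"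
    if "x \<in> carrier (add_monoid (cohomology i :: ('k mpoly, _) graded_module))"
       "y \<in> carrier (add_monoid (cohomology i :: ('k mpoly, _) graded_module))"
       "z \<in> carrier (add_monoid (cohomology i :: ('k mpoly, _) graded_module))" for x y z
    using that by (auto simp: carrier_cohomology add_cohomology cocycles_closed(2) G.a_assoc Z)
  show "\<one>\<^bsub>add_monoid (cohomology i)\<^esub> \<otimes>\<^bsub>add_monoid (cohomology i)\<^esub> x = x"
    if "x \<in> carrier (add_monoid (cohomology i :: ('k mpoly, _) graded_module))" for x
    using that unfolding one by (auto simp: carrier_cohomology add_cohomology cocycles_closed(1) Z)
  show "\<exists>y\<in>carrier (add_monoid (cohomology i)). y \<otimes>\<^bsub>add_monoid (cohomology i)\<^esub> x = \<one>\<^bsub>add_monoid (cohomology i)\<^esub>"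
    if x: "x \<in> carrier (add_monoid (cohomology i :: ('k mpoly, _) graded_module))" for x
  proof -
    obtain c where c: "c \<in> cocycles i" "x = cohomology_class i c" using x by (auto simp: carrier_cohomology)
    show ?thesis unfolding one
      by (rule bexI[of _ "cohomology_class i (\<ominus>\<^bsub>cech i\<^esub> c)"])
         (use c cocycles_closed(3)[OF c(1)] in \<open>auto simp: carrier_cohomology add_cohomology G.l_neg Z\<close>)
  qed
qed

lemma submodule_cohomology:
  assumes S: "S \<subseteq> (cocycles i :: (nat set \<Rightarrow> ('k::field mpoly set \<times> nat) set) set)" "\<zero>\<^bsub>cech i\<^esub> \<in> S"
    and add: "\<And>c c'. c \<in> S \<Longrightarrow> c' \<in> S \<Longrightarrow> c \<oplus>\<^bsub>cech i\<^esub> c' \<in> S"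
    and neg: "\<And>c. c \<in> S \<Longrightarrow> \<ominus>\<^bsub>cech i\<^esub> c \<in> S"
    and smult: "\<And>q c. q \<in> carrier (poly_ring d) \<Longrightarrow> c \<in> S \<Longrightarrow> q \<odot>\<^bsub>cech i\<^esub> c \<in> S"
  shows "submodule (cohomology_class i ` S) (poly_ring d) (cohomology i)"
proof -
  interpret G: abelian_group "cech i :: ('k mpoly, nat set \<Rightarrow> ('k mpoly set \<times> nat) set) graded_module"
    by (rule abelian_group_cech)
  interpret H: group "add_monoid (cohomology i :: ('k mpoly, _) graded_module)" by (rule group_cohomology)
  have SZ: "c \<in> S \<Longrightarrow> c \<in> cocycles i" for c using S(1) by blast
  have Z: "c \<in> S \<Longrightarrow> c \<in> carrier (cech i)" for c using SZ by (simp add: cocycle_iff)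
  show ?thesis
  proof (intro submodule.intro H.subgroupI)
    show "cohomology_class i ` S \<subseteq> carrier (add_monoid (cohomology i))"
      using S(1) by (auto simp: carrier_cohomology)
    show "cohomology_class i ` S \<noteq> {}" using S(2) by blast
    fix x assume "x \<in> cohomology_class i ` S"
    then obtain c where c: "c \<in> S" "x = cohomology_class i c" by blast
    have "cohomology_class i (\<ominus>\<^bsub>cech i\<^esub> c) \<otimes>\<^bsub>add_monoid (cohomology i)\<^esub> x = \<one>\<^bsub>add_monoid (cohomology i)\<^esub>"
      by (simp add: c(2) add_cohomology SZ c(1) neg G.l_neg Z zero_cohomology cohomology_class_zero)
    then have "inv\<^bsub>add_monoid (cohomology i)\<^esub> x = cohomology_class i (\<ominus>\<^bsub>cech i\<^esub> c)"
      by (rule H.inv_equality) (use c neg SZ in \<open>auto simp: carrier_cohomology\<close>)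
    then show "inv\<^bsub>add_monoid (cohomology i)\<^esub> x \<in> cohomology_class i ` S" using neg[OF c(1)] by simp
    fix y assume "y \<in> cohomology_class i ` S"
    then obtain c' where c': "c' \<in> S" "y = cohomology_class i c'" by blast
    show "x \<otimes>\<^bsub>add_monoid (cohomology i)\<^esub> y \<in> cohomology_class i ` S"
      using add[OF c(1) c'(1)] by (simp add: c(2) c'(2) add_cohomology SZ c(1) c'(1))
  next
    show "submodule_axioms (cohomology_class i ` S) (poly_ring d) (cohomology i)"
      unfolding submodule_axioms_def using smult SZ by (auto simp: smult_cohomology)
  qed
qed

text \<open>The variable \<open>x_k\<close> is invertible in the localization, so its exponent is irrelevant.\<close>

lemma local_exps_update:
  assumes F: "F \<subseteq> {1..d}" and k: "k \<in> F" and a: "a \<in> local_exps F"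
  shows "a(k := y) \<in> local_exps F"
proof -
  obtain t m where m: "m \<in> E" "shift F (int t) a = zexp m" using a by (auto simp: local_exps_def)
  have finF: "finite F" by (rule finite_subset[OF F]) simp
  define r where "r = nat (a k - y)"
  define e where "e = face_exp (F - {k}) r + Poly_Mapping.single k (nat (y + int r - a k))"
  have "shift F (int (t + r)) (a(k := y)) = zexp (m + e)"
  proof
    fix l
    have zm: "zexp m l = shift F (int t) a l" using m(2) by simp
    show "shift F (int (t + r)) (a(k := y)) l = zexp (m + e) l"
      unfolding zexp_add zm
      using finF k by (auto simp: shift_def e_def zexp_def lookup_add lookup_face_exp lookup_single when_def r_def)
  qed
  moreover have "e \<in> exponents d"
    unfolding e_def using F k
    by (intro exponents_add face_exp_in_exponents) (auto simp: exponents_def)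
  ultimately show ?thesis using add_closed[OF m(1)] unfolding local_exps_def by blast
qed

text \<open>Every member of either family contains \<open>k\<close>, and \<open>x_k\<close> is invertible there.\<close>

lemma degree_complex_update:
  assumes "a k < 0" "y < 0" "k \<in> {1..d}"
  shows "degree_complex (a(k := y)) = degree_complex a"
proof -
  have sub: "degree_complex a \<subseteq> degree_complex (a(k := y))" if "a k < 0" "y < 0" for a y
  proof
    fix F assume F: "F \<in> degree_complex a"
    then have kF: "k \<in> F" and Fd: "F \<subseteq> {1..d}" using that by (force simp: degree_complex_def local_support_def)+
    have "a(k := y) \<notin> local_exps F"
    proof
      assume "a(k := y) \<in> local_exps F"
      then have "(a(k := y))(k := a k) \<in> local_exps F" by (rule local_exps_update[OF Fd kF])
      then show False using F by (simp add: degree_complex_def local_support_def)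
    qed
    then show "F \<in> degree_complex (a(k := y))"
      using F kF assms(3) by (auto simp: degree_complex_def local_support_def)
  qed
  show ?thesis using sub[of a y] sub[of "a(k := y)" "a k"] assms(1,2) by auto
qed

text \<open>The classes represented by cocycles whose \<open>k\<close>-th exponents are at least \<open>- r\<close> form a submodule,
  because multiplication by polynomials only increases exponents. Finitely many generators lie in one
  such submodule, which then is everything. But the cocycle \<open>u\<close> can be moved to a multidegree whose
  \<open>k\<close>-th coordinate is less than \<open>- r\<close>, and its class there lies in the submodule only if \<open>u\<close> is a
  coboundary.\<close>

lemma noetherian_imp_acyclic:
  assumes noeth: "noetherian_module (poly_ring d) (cohomology i :: ('k::field mpoly, _) graded_module)"
    and neg: "a k < 0"
  shows "acyclic_at TYPE('k) (degree_complex a) i"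
  unfolding acyclic_at_def
proof (intro allI impI, elim conjE)
  fix u :: "nat set \<Rightarrow> 'k"
  assume u: "\<forall>F. u F \<noteq> 0 \<longrightarrow> F \<in> degree_complex a \<and> card F = i" "codiff (degree_complex a) u = (\<lambda>_. 0)"
  show "is_coboundary (degree_complex a) i u"
  proof (cases "k \<in> {1..d}")
    case False
    then have "degree_complex a = {}" using neg by (auto simp: degree_complex_def local_support_def)
    then have "u = (\<lambda>_. 0)" using u(1) by auto
    then show ?thesis by (simp add: is_coboundary_zero)
  next
    case kd: True
    define S where "S r = {c \<in> cocycles i. \<forall>b F. b k < - int r \<longrightarrow> strand i c b F = (0 :: 'k)}" for r
    have SZ: "S r \<subseteq> cocycles i" for r by (auto simp: S_def)
    have Z: "c \<in> S r \<Longrightarrow> c \<in> carrier (cech i)" for c r by (simp add: S_def cocycle_iff)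
    have sub: "submodule (cohomology_class i ` S r) (poly_ring d) (cohomology i)" for r
    proof (rule submodule_cohomology[OF SZ])
      show "\<zero>\<^bsub>cech i\<^esub> \<in> S r" using cocycles_closed(1)[of i] by (simp add: S_def zero_cech)
      fix c c' assume c: "c \<in> S r"
      show "\<ominus>\<^bsub>cech i\<^esub> c \<in> S r"
        using c Z[OF c] cocycles_closed(3)[of c i] by (simp add: S_def strand_a_inv)
      show "c \<oplus>\<^bsub>cech i\<^esub> c' \<in> S r" if c': "c' \<in> S r"
        using c c' Z[OF c] Z[OF c'] cocycles_closed(2)[of c i c'] by (simp add: S_def add_cech)
      fix q :: "'k mpoly" assume q: "q \<in> carrier (poly_ring d)"
      have "strand i c (\<lambda>l. b l - zexp m l) F = 0" if "b k < - int r" for b m F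
        using c that unfolding S_def by (auto simp: zexp_def)
      then show "q \<odot>\<^bsub>cech i\<^esub> c \<in> S r"
        using c smult_cocycle[OF q, of c i] by (auto simp: S_def smult_cech[OF Z[OF c] q] intro!: sum.neutral)
    qed
    have "submodule (carrier (cohomology i)) (poly_ring d) (cohomology i :: ('k mpoly, _) graded_module)"
      unfolding carrier_cohomology
      by (rule submodule_cohomology) (auto intro: cocycles_closed smult_cocycle)
    from noeth[unfolded noetherian_module_def, rule_format, OF this]
    obtain A where A: "A \<subseteq> carrier (cohomology i :: ('k mpoly, _) graded_module)" "finite A"
      "carrier (cohomology i) = \<Inter>{K. submodule K (poly_ring d) (cohomology i) \<and> A \<subseteq> K}"
      by (elim exE conjE)
    have bound: "\<exists>r. X \<in> cohomology_class i ` S r" if X: "X \<in> A" for X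
    proof -
      obtain c where c: "c \<in> cocycles i" "X = cohomology_class i c"
        using A(1) X by (auto simp: carrier_cohomology)
      define B where "B = {b. \<exists>F. strand i c b F \<noteq> 0}"
      have fin: "finite B" unfolding B_def using c(1) by (intro finite_strand) (simp add: cocycle_iff)
      have "- b k \<le> int (\<Sum>b\<in>B. nat (- b k))" if "b \<in> B" for b
      proof -
        have "nat (- b k) \<le> (\<Sum>b\<in>B. nat (- b k))"
          using that fin by (intro member_le_sum[of b B "\<lambda>b. nat (- b k)"]) auto
        then show ?thesis by linarith
      qed
      then have "c \<in> S (\<Sum>b\<in>B. nat (- b k))" using c(1) by (force simp: S_def B_def)
      then show ?thesis using c(2) by blast
    qed
    then have "\<forall>X\<in>A. \<exists>r. X \<in> cohomology_class i ` S r" ..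
    from bchoice[OF this] obtain r where r: "\<And>X. X \<in> A \<Longrightarrow> X \<in> cohomology_class i ` S (r X)"
      by blast
    define R where "R = (\<Sum>X\<in>A. r X)"
    have "A \<subseteq> cohomology_class i ` S R"
    proof
      fix X assume X: "X \<in> A"
      have "r X \<le> R" unfolding R_def using X A(2) by (intro member_le_sum) auto
      then have "S (r X) \<subseteq> S R" by (force simp: S_def)
      then show "X \<in> cohomology_class i ` S R" using r[OF X] by blast
    qed
    then have all: "carrier (cohomology i) \<subseteq> cohomology_class i ` S R"
      unfolding A(3) using sub[of R] by (intro Inter_lower) simp
    define a' where "a' = a(k := - int R - 1)"
    have D: "degree_complex a' = degree_complex a"
      unfolding a'_def by (rule degree_complex_update[where a = a]) (use neg kd in auto)
    obtain c where c: "c \<in> cocycles i" "strand i c = (\<lambda>b. if b = a' then u else (\<lambda>_. 0))"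
      by (rule single_degree_cocycle[of u a' i]) (use u D in auto)
    have "cohomology_class i c \<in> cohomology_class i ` S R"
      using all c(1) by (auto simp: carrier_cohomology)
    then obtain c' where c': "c' \<in> S R" "cohomology_class i c = cohomology_class i c'" by blast
    have "c \<in> cohomology_class i c'"
      using cohomology_class_self[OF c(1)] unfolding c'(2) .
    then obtain b where b: "b \<in> coboundaries i" "c = b \<oplus>\<^bsub>cech i\<^esub> c'"
      by (rule cohomology_classE)
    have "strand i b a' = u"
    proof
      fix F
      have "strand i c a' F = strand i b a' F + strand i c' a' F"
        unfolding b(2) by (rule add_cech(2)[OF _ Z[OF c'(1)]]) (use b(1) in \<open>simp add: coboundary_iff\<close>)
      moreover have "strand i c' a' F = 0" using c'(1) by (simp add: S_def a'_def)
      ultimately show "strand i b a' F = u F" by (simp add: c(2))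
    qed
    moreover have "is_coboundary (degree_complex a') i (strand i b a')"
      using b(1) unfolding coboundary_iff by blast
    ultimately show ?thesis by (simp only: D)
  qed
qed

end


section \<open>Powers of a monomial ideal\<close>

text \<open>In degrees less than \<open>n\<close> the \<open>n\<close>-th power of the ideal is indistinguishable from its
  radical.\<close>

lemma (in exponent_ideal) degree_complex_power:
  assumes n: "0 < n" and a: "\<And>l. 0 \<le> a l" "\<And>l. l \<notin> {1..d} \<Longrightarrow> a l = 0" "(\<Sum>l\<in>{1..d}. a l) < int n"
  shows "exponent_ideal.degree_complex d (exponent_power d E n) a
      = stanley_reisner_complex d (monomial_span E :: 'k::field mpoly set)"
proof -
  interpret P: exponent_ideal d "exponent_power d E n" by (rule exponent_ideal_power)
  have "F \<in> P.degree_complex a \<longleftrightarrow> F \<subseteq> {1..d} \<and> (\<forall>t. face_exp F t \<notin> E)" for F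
    unfolding P.degree_complex_def P.local_support_def
    using a local_exps_power_iff[OF _ n, of F a] by auto
  then show ?thesis unfolding stanley_reisner_eq by blast
qed

lemma (in exponent_ideal) grade_cohomology_power_zero:
  fixes i n :: nat
  defines "H \<equiv> exponent_ideal.cohomology d (exponent_power d E n) i :: ('k::field mpoly, _) graded_module"
  assumes noeth: "noetherian_module (poly_ring d) H"
    and j: "j < int n" "j < 0 \<or> acyclic_at TYPE('k) (stanley_reisner_complex d (monomial_span E :: 'k mpoly set)) i"
  shows "grade H j = {\<zero>\<^bsub>H\<^esub>}"
proof -
  interpret P: exponent_ideal d "exponent_power d E n" by (rule exponent_ideal_power)
  have "acyclic_at TYPE('k) (P.degree_complex a) i" if deg: "(\<Sum>l\<in>{1..d}. a l) = j" for a
  proof (cases "\<exists>k. a k < 0")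
    case True
    then show ?thesis using P.noetherian_imp_acyclic[OF noeth[unfolded H_def]] by blast
  next
    case False
    then have pos: "0 \<le> a l" for l by (simp add: not_less)
    then have "0 \<le> j" using deg sum_nonneg[of "{1..d}" a] by simp
    show ?thesis
    proof (cases "\<forall>l. l \<notin> {1..d} \<longrightarrow> a l = 0")
      case True
      then have "P.degree_complex a = stanley_reisner_complex d (monomial_span E :: 'k mpoly set)"
        using pos deg j(1) \<open>0 \<le> j\<close> by (intro degree_complex_power) auto
      then show ?thesis using j(2) \<open>0 \<le> j\<close> by simp
    next
      case False
      then have D: "P.degree_complex a = {}" by (auto simp: P.degree_complex_def P.local_support_def)
      show ?thesis unfolding D acyclic_at_def
      proof (intro allI impI, elim conjE)
        fix u :: "nat set \<Rightarrow> 'k" assume "\<forall>F. u F \<noteq> 0 \<longrightarrow> F \<in> {} \<and> card F = i"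
        then have "u = (\<lambda>_. 0)" by auto
        then show "is_coboundary {} i u" by (simp add: is_coboundary_zero)
      qed
    qed
  qed
  then show ?thesis unfolding H_def by (rule P.grade_cohomology_zero)
qed

lemma (in exponent_ideal) zero_homology_iff_acyclic:
  fixes \<Delta> :: "nat set set"
  defines "\<Delta> \<equiv> stanley_reisner_complex d (monomial_span E :: 'k::field mpoly set)"
  shows "zero_module (reduced_homology \<Delta> (int i - 1) :: ('k, (nat set \<Rightarrow>\<^sub>0 'k) set) module)
      \<longleftrightarrow> acyclic_at TYPE('k) \<Delta> i"
proof -
  have \<Delta>: "\<Delta> = {F. F \<subseteq> {1..d} \<and> (\<forall>t. face_exp F t \<notin> E)}" unfolding \<Delta>_def by (rule stanley_reisner_eq)
  show ?thesis unfolding zero_reduced_homology_iff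
  proof (rule acyclic_iff_chains_exact[symmetric])
    show "finite \<Delta>" by (rule finite_subset[of _ "Pow {1..d}"]) (auto simp: \<Delta>)
    show "finite F" if "F \<in> \<Delta>" for F using that finite_subset[of F "{1..d}"] by (simp add: \<Delta>)
    show "G \<in> \<Delta>" if "F \<in> \<Delta>" "G \<subseteq> F" for F G using that face_exp_mono[of G F] by (auto simp: \<Delta>)
  qed
qed

theorem theorem4p3:
  fixes d i :: nat
    and I :: "'k::field mpoly set"
  defines "H \<equiv> (\<lambda>n. local_cohomology d i
                  (graded_quotient (poly_graded_module d) (ideal_power (poly_ring d) I n)))"
  assumes "monomial_ideal d I"
    and "\<forall>\<^sub>F n in sequentially. noetherian_module (poly_ring d) (H n)"
  shows "(\<not> zero_module (reduced_homology (stanley_reisner_complex d I) (int i - 1)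
              :: ('k, (nat set \<Rightarrow>\<^sub>0 'k) set) module)
            \<longrightarrow> (\<forall>\<^sub>F n in sequentially. indeg (H n) = 0))
       \<and> (zero_module (reduced_homology (stanley_reisner_complex d I) (int i - 1)
              :: ('k, (nat set \<Rightarrow>\<^sub>0 'k) set) module)
            \<longrightarrow> liminf (\<lambda>n. indeg (H n) / ereal (real n)) \<ge> 1)"
proof -
  obtain A where A: "A \<subseteq> exponents d" "I = genideal (poly_ring d) (monom ` A)"
    using assms(2) unfolding monomial_ideal_def exponents_def by blast
  define E where "E = up_closure d A"
  interpret exponent_ideal d E unfolding E_def by (rule exponent_ideal_up_closure[OF A(1)])
  have I: "I = monomial_span E" unfolding E_def A(2) by (rule genideal_monomials[OF A(1)])
  define \<Delta> where "\<Delta> = stanley_reisner_complex d I"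
  have H: "H n = exponent_ideal.cohomology d (exponent_power d E n) i" for n
    unfolding H_def I ideal_power_monomial_span
    by (simp add: exponent_ideal.quotient_def[OF exponent_ideal_power])
  have homology: "zero_module (reduced_homology \<Delta> (int i - 1) :: ('k, (nat set \<Rightarrow>\<^sub>0 'k) set) module)
      \<longleftrightarrow> acyclic_at TYPE('k) \<Delta> i"
    unfolding \<Delta>_def I by (rule zero_homology_iff_acyclic)
  have vanish: "grade (H n) j = {\<zero>\<^bsub>H n\<^esub>}"
    if "noetherian_module (poly_ring d) (H n)" "j < int n" "j < 0 \<or> acyclic_at TYPE('k) \<Delta> i" for n j
    unfolding H by (rule grade_cohomology_power_zero) (use that in \<open>simp_all add: H \<Delta>_def I\<close>)
  have lower: "ereal (real_of_int r) \<le> indeg (H n)"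
    if "\<And>j. j < r \<Longrightarrow> grade (H n) j = {\<zero>\<^bsub>H n\<^esub>}" for n r
    unfolding indeg_def
  proof (rule INF_greatest)
    fix j assume "j \<in> {j. grade (H n) j \<noteq> {\<zero>\<^bsub>H n\<^esub>}}"
    then have "r \<le> j" using that[of j] by (simp add: not_less[symmetric]) blast
    then show "ereal (real_of_int r) \<le> ereal (real_of_int j)" by simp
  qed
  have noeth: "\<forall>\<^sub>F n in sequentially. noetherian_module (poly_ring d) (H n) \<and> 0 < n"
    using assms(3) eventually_gt_at_top[of 0] by (rule eventually_conj)
  show ?thesis unfolding \<Delta>_def[symmetric] homology
  proof (intro conjI impI)
    assume nac: "\<not> acyclic_at TYPE('k) \<Delta> i"
    show "\<forall>\<^sub>F n in sequentially. indeg (H n) = 0"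
      using noeth
    proof (rule eventually_mono, elim conjE)
      fix n :: nat assume n: "noetherian_module (poly_ring d) (H n)" "0 < n"
      interpret P: exponent_ideal d "exponent_power d E n" by (rule exponent_ideal_power)
      have "P.degree_complex (\<lambda>_. 0) = \<Delta>"
        unfolding \<Delta>_def I using n(2) by (intro degree_complex_power) auto
      then have "grade (H n) 0 \<noteq> {\<zero>\<^bsub>H n\<^esub>}"
        using P.grade_cohomology_nonzero[of "\<lambda>_. 0" i, where 'k = 'k] nac by (simp add: H)
      then have "0 \<in> {j. grade (H n) j \<noteq> {\<zero>\<^bsub>H n\<^esub>}}" by simp
      then have "indeg (H n) \<le> ereal (real_of_int 0)"
        unfolding indeg_def by (rule INF_lower)
      moreover have "ereal (real_of_int 0) \<le> indeg (H n)"
        by (rule lower, rule vanish[OF n(1)]) (use n(2) in auto)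
      ultimately have "indeg (H n) = ereal (real_of_int 0)" by (rule order.antisym)
      then show "indeg (H n) = 0" by (simp add: zero_ereal_def)
    qed
  next
    assume ac: "acyclic_at TYPE('k) \<Delta> i"
    have "\<forall>\<^sub>F n in sequentially. 1 \<le> indeg (H n) / ereal (real n)"
      using noeth
    proof (rule eventually_mono, elim conjE)
      fix n :: nat assume n: "noetherian_module (poly_ring d) (H n)" "0 < n"
      have "ereal (real_of_int (int n)) \<le> indeg (H n)"
        by (rule lower, rule vanish[OF n(1)]) (use ac in auto)
      then show "1 \<le> indeg (H n) / ereal (real n)"
        using n(2) by (simp add: ereal_le_divide_pos)
    qed
    then show "1 \<le> liminf (\<lambda>n. indeg (H n) / ereal (real n))"
      by (rule Liminf_bounded)
  qed
qed

end
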